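(* Let (Unit LP) be a unit linear program with a numb half-space $H$, and let $M_0\ge M$ where $M=\max_{i=1,\ldots,n}\|a_i\|$. Then: 1. Let $U\in O(d)$ be arbitrary. If the algorithm Adding Constraints does not return "Failure", then a solution of (Unit LP$^+$) with the objective function $\langle z_0,x\rangle$ is the index set $\{n+1,\ldots,n+d\}$. 2. With probability at least $1/4$ in the choice of a random rotation $U\in O(d)$ (Haar distributed) and of the random vectors $a_{n+1},\ldots,a_{n+d}$, the algorithm Adding Constraints does not return "Failure" and the vectors $a_{n+1},\ldots,a_{n+d}$ lie in the numb half-space $H$.
   Context: (Unit LP) is the program: maximize $\langle z,x\rangle$ subject to $\langle a_i,x\rangle\le 1$, $i=1,\ldots,n$, with constraint vectors $a_1,\ldots,a_n\in\mathbb{R}^d$ in general position. A solution is identified with the index set of the constraints that become equalities at the optimal point. Two programs are equivalent if one is bounded iff the other is, and, when bounded, they have the same solution. The numb set of (Unit LP) is the set of vectors $a$ such that adding the constraint $\langle a,x\rangle\le1$ produces an equivalent program; a numb half-space is a half-space contained in the numb set (one always exists). (Unit LP$^+$) is (Unit LP) with the added constraints $\langle a_i,x\rangle\le 1$, $i=n+1,\ldots,n+d$. Set $\ell = c_1/\sqrt{\log d}$ and $\sigma_1=\min\big(\frac{1}{6\sqrt{d\log n}},\frac{c_1}{d^{3/2}\log d}\big)$ with $c_1=1/300$. Algorithm Adding Constraints, with input $M_0>0$ and a rotation $U\in O(d)$: (1) let $z_0'$ be a fixed unit vector and $\bar a'_{n+1},\ldots,\bar a'_{n+d}$ the vertices of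 a fixed regular simplex with center and normal $z_0'$ and radius $\|z_0'-\bar a_i'\|=\ell$; (2) let $z_0=2M_0Uz_0'$ and $\bar a_i=2M_0U\bar a_i'$; (3) let $a_i$, $i=n+1,\ldots,n+d$, be independent Gaussian vectors with mean $\bar a_i$ and standard deviation $2M_0\sigma_1$; (4) check that (a) $z_0$ lies in the nonnegative cone (set of nonnegative linear combinations) of $a_{n+1},\ldots,a_{n+d}$ and (b) the distance from $0$ to the affine span of $a_{n+1},\ldots,a_{n+d}$ is at least $M$; if not, return "Failure"; otherwise output $a_{n+1},\ldots,a_{n+d}$ and $z_0$.
   Formalization: The numb half-space H is required to have the origin in its closure (far-translated ones make part 2 false); part 1 is stated for added vectors such that all n+d constraint vectors are in general position, which is shown to hold almost surely for every U; d,n≥2 is assumed. *)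

theory Defs
  imports "HOL-Probability.Probability"
begin

section \<open>Unit linear programs\<close>

text \<open>
  The program with parameters \<open>n\<close>, \<open>a\<close>, \<open>z\<close> maximizes \<open>z \<bullet> x\<close> subject to \<open>a i \<bullet> x \<le> 1\<close> for
  \<open>i \<in> {1..n}\<close>; the values of \<open>a\<close> outside \<open>{1..n}\<close> are irrelevant.
\<close>

definition general_position :: "nat \<Rightarrow> (nat \<Rightarrow> real ^ 'd) \<Rightarrow> bool" where
  "general_position n a \<longleftrightarrow>
     (\<forall>J \<subseteq> {1..n}. card J \<le> CARD('d) + 1 \<longrightarrow> inj_on a J \<and> \<not> affine_dependent (a ` J))"

definition lp_feasible :: "nat \<Rightarrow> (nat \<Rightarrow> real ^ 'd) \<Rightarrow> (real ^ 'd) set" where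
  "lp_feasible n a = {x. \<forall>i\<in>{1..n}. a i \<bullet> x \<le> 1}"

definition lp_bounded :: "nat \<Rightarrow> (nat \<Rightarrow> real ^ 'd) \<Rightarrow> real ^ 'd \<Rightarrow> bool" where
  "lp_bounded n a z \<longleftrightarrow> bdd_above ((\<lambda>x. z \<bullet> x) ` lp_feasible n a)"

definition lp_optimal :: "nat \<Rightarrow> (nat \<Rightarrow> real ^ 'd) \<Rightarrow> real ^ 'd \<Rightarrow> real ^ 'd \<Rightarrow> bool" where
  "lp_optimal n a z x \<longleftrightarrow> x \<in> lp_feasible n a \<and> (\<forall>y\<in>lp_feasible n a. z \<bullet> y \<le> z \<bullet> x)"

definition lp_solution :: "nat \<Rightarrow> (nat \<Rightarrow> real ^ 'd) \<Rightarrow> real ^ 'd \<Rightarrow> nat set \<Rightarrow> bool" where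
  "lp_solution n a z J \<longleftrightarrow> (\<exists>x. lp_optimal n a z x \<and> J = {i \<in> {1..n}. a i \<bullet> x = 1})"

text \<open>
  For degenerate objectives the optimal point need not be unique, so ``the same solution'' is
  read as ``the same set of solutions''.
\<close>

definition lp_equivalent ::
  "nat \<Rightarrow> (nat \<Rightarrow> real ^ 'd) \<Rightarrow> real ^ 'd \<Rightarrow> nat \<Rightarrow> (nat \<Rightarrow> real ^ 'd) \<Rightarrow> real ^ 'd \<Rightarrow> bool" where
  "lp_equivalent n a z n' a' z' \<longleftrightarrow>
     (lp_bounded n a z \<longleftrightarrow> lp_bounded n' a' z') \<and>
     (lp_bounded n a z \<longrightarrow> (\<forall>J. lp_solution n a z J \<longleftrightarrow> lp_solution n' a' z' J))"

definition numb_set :: "nat \<Rightarrow> (nat \<Rightarrow> real ^ 'd) \<Rightarrow> real ^ 'd \<Rightarrow> (real ^ 'd) set" where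
  "numb_set n a z = {v. lp_equivalent n a z (n + 1) (a(n + 1 := v)) z}"

definition halfspace :: "(real ^ 'd) set \<Rightarrow> bool" where
  "halfspace H \<longleftrightarrow> (\<exists>h t. h \<noteq> 0 \<and> (H = {x. h \<bullet> x \<le> t} \<or> H = {x. h \<bullet> x < t}))"

text \<open>
  Half-spaces are understood to have the origin in their interior or on their boundary, as do the
  standard examples \<open>{v. x \<bullet> v \<le> 0}\<close> with \<open>x\<close> an optimal point (or a direction in which an
  unbounded program increases).  Translating a numb half-space away from the origin gives smaller
  subsets of the numb set that the randomly added constraints have almost no chance of hitting.
\<close>

definition numb_halfspace ::
  "nat \<Rightarrow> (nat \<Rightarrow> real ^ 'd) \<Rightarrow> real ^ 'd \<Rightarrow> (real ^ 'd) set \<Rightarrow> bool" where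
  "numb_halfspace n a z H \<longleftrightarrow> halfspace H \<and> 0 \<in> closure H \<and> H \<subseteq> numb_set n a z"

text \<open>The constraint vectors of (Unit LP\<open>\<^sup>+\<close>): \<open>a\<close> on \<open>{1..n}\<close>, then \<open>b\<close> on \<open>{n+1..n+d}\<close>.\<close>

definition add_constraints ::
  "nat \<Rightarrow> (nat \<Rightarrow> real ^ 'd) \<Rightarrow> (nat \<Rightarrow> real ^ 'd) \<Rightarrow> nat \<Rightarrow> real ^ 'd" where
  "add_constraints n a b = (\<lambda>i. if i \<le> n then a i else b i)"

section \<open>Gaussian vectors and Haar measure on the orthogonal group\<close>

definition gaussian :: "real ^ 'd \<Rightarrow> real \<Rightarrow> (real ^ 'd) measure" where
  "gaussian m s = density lborel (\<lambda>x. ennreal (\<Prod>k\<in>UNIV. normal_density (m $ k) s (x $ k)))"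

definition haar_orthogonal :: "(real ^ 'd ^ 'd) measure \<Rightarrow> bool" where
  "haar_orthogonal \<mu> \<longleftrightarrow>
     prob_space \<mu> \<and>
     sets \<mu> = sets (restrict_space borel {Q. orthogonal_matrix Q}) \<and>
     (\<forall>Q. orthogonal_matrix Q \<longrightarrow> distr \<mu> \<mu> (\<lambda>V. Q ** V) = \<mu>)"

section \<open>Algorithm Adding Constraints\<close>

definition c1 :: real where
  "c1 = 1 / 300"

definition simplex_radius :: "nat \<Rightarrow> real" where
  "simplex_radius d = c1 / sqrt (ln (real d))"

definition sigma1 :: "nat \<Rightarrow> nat \<Rightarrow> real" where
  "sigma1 d n = min (1 / (6 * sqrt (real d * ln (real n))))
                    (c1 / (real d powr (3 / 2) * ln (real d)))"

text \<open>
  A regular simplex of dimension \<open>card J - 1\<close> with center \<open>c\<close>, normal \<open>w\<close> and radius \<open>r\<close>, whose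
  vertices are indexed by \<open>J\<close>.
\<close>

definition regular_simplex ::
  "nat set \<Rightarrow> (nat \<Rightarrow> real ^ 'd) \<Rightarrow> real ^ 'd \<Rightarrow> real ^ 'd \<Rightarrow> real \<Rightarrow> bool" where
  "regular_simplex J v c w r \<longleftrightarrow>
     (\<exists>s>0. \<forall>i\<in>J. \<forall>j\<in>J. i \<noteq> j \<longrightarrow> dist (v i) (v j) = s) \<and>
     c = (1 / real (card J)) *\<^sub>R (\<Sum>i\<in>J. v i) \<and>
     (\<forall>i\<in>J. (v i - c) \<bullet> w = 0) \<and>
     (\<forall>i\<in>J. norm (c - v i) = r)"

definition nonneg_cone :: "nat set \<Rightarrow> (nat \<Rightarrow> real ^ 'd) \<Rightarrow> (real ^ 'd) set" where
  "nonneg_cone J v = {\<Sum>i\<in>J. c i *\<^sub>R v i | c. \<forall>i\<in>J. 0 \<le> c i}"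

text \<open>The law of the added vectors for a given rotation \<open>U\<close>.\<close>

definition added_law ::
  "nat \<Rightarrow> (nat \<Rightarrow> real ^ 'd) \<Rightarrow> real \<Rightarrow> real ^ 'd ^ 'd \<Rightarrow> (nat \<Rightarrow> real ^ 'd) measure" where
  "added_law n abar' M0 U =
     PiM {n+1..n+CARD('d)}
       (\<lambda>i. gaussian ((2 * M0) *\<^sub>R (U *v abar' i)) (2 * M0 * sigma1 CARD('d) n))"

text \<open>
  The output for the rotation \<open>U\<close> and the realization \<open>b\<close> of the Gaussian
  vectors; \<open>None\<close> stands for ``Failure''.
\<close>

definition adding_constraints ::
  "nat \<Rightarrow> (nat \<Rightarrow> real ^ 'd) \<Rightarrow> real ^ 'd \<Rightarrow> real \<Rightarrow> real ^ 'd ^ 'd \<Rightarrow> (nat \<Rightarrow> real ^ 'd)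
     \<Rightarrow> ((nat \<Rightarrow> real ^ 'd) \<times> (real ^ 'd)) option" where
  "adding_constraints n a z0' M0 U b =
     (let J = {n+1..n+CARD('d)};
          M = Max ((\<lambda>i. norm (a i)) ` {1..n});
          z0 = (2 * M0) *\<^sub>R (U *v z0')
      in if z0 \<in> nonneg_cone J b \<and> infdist 0 (affine hull (b ` J)) \<ge> M
         then Some (b, z0) else None)"

text \<open>The joint law of the rotation, drawn from \<open>\<mu>\<close>, and of the added vectors.\<close>

definition rotation_added_law ::
  "nat \<Rightarrow> (nat \<Rightarrow> real ^ 'd) \<Rightarrow> real \<Rightarrow> (real ^ 'd ^ 'd) measure
     \<Rightarrow> ((real ^ 'd ^ 'd) \<times> (nat \<Rightarrow> real ^ 'd)) measure" where
  "rotation_added_law n abar' M0 \<mu> =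
     \<mu> \<bind> (\<lambda>U. distr (added_law n abar' M0 U)
                   (\<mu> \<Otimes>\<^sub>M PiM {n+1..n+CARD('d)} (\<lambda>_. borel)) (\<lambda>b. (U, b)))"

end

theory Submission
  imports Defs
begin

text \<open>
  Write \<open>v i = abar' i + \<sigma> g i\<close> with \<open>g i\<close> standard Gaussian; by rotation invariance the added vectors are
  \<open>2 M\<^sub>0 U (v i)\<close> with \<open>U\<close> and \<open>g\<close> independent, so the success of the algorithm depends on \<open>g\<close> only.
  If \<open>z\<^sub>0'\<close> is written as \<open>\<Sum>c i v i\<close>, testing against the edges of the simplex shows that \<open>c\<close> is close to
  a multiple of \<open>(1,\<dots>,1)\<close> once \<open>\<sigma>\<close> times the Frobenius norm of the noise is below the inradius scale of
  the simplex; the same norm controls the tilt of the hyperplane through the \<open>v i\<close>.  A chi-square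
  Chernoff bound gives this for dimension at least 3; in the plane the Frobenius bound is too lossy and
  linear functionals of the noise are used.  The probability of success is at least 0.55.
  For fixed \<open>g\<close>, left invariance of Haar measure allows one to average the event \<open>h \<bullet> U (v i) < 0\<close> over a
  Gaussian \<open>h\<close>; then \<open>h \<bullet> U z\<^sub>0'\<close> dominates \<open>h \<bullet> U (v i - z\<^sub>0')\<close>, and the event has probability at least 0.465.
\<close>

text \<open>By symmetry a half-space bounded by a hyperplane through the origin catches the random
  direction \<open>U *v z0'\<close> with probability 1/2, so the claimed 1/4 leaves little room:
  against the factor 0.465 for the rotation, the sample itself has to succeed with probability above
  0.538. This is why low dimensions are the obstacle. The cone condition asks the noise orthogonal
  to \<open>z0'\<close>, a chi-square variable with d(d-1) degrees of freedom, to stay below twice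
  its mean, and the Chernoff bound for failure is (2/e)^(d(d-1)/2): about 0.40 for d = 3, but 0.74
  for d = 2. The size of \<open>c1\<close> serves the rotation step: the sampled vertices stay
  within 4l of \<open>z0'\<close>, where l is the simplex radius, and with c1 = 1/300 each vertex
  crosses a margin of 0.06 with probability below d^(-10), so the union over d vertices is harmless.
  A second difficulty is measurability: cone membership and distance to an affine hull quantify over
  real coefficients. They are treated as projections of closed sets along finitely many
  coefficients, or as intersections of closed sets.\<close>

section \<open>Gaussian vectors\<close>

text \<open>The image measure is translation invariant; comparing it with \<open>lborel\<close> by Fubini shows that the two are
  proportional, and the unit ball fixes the constant.\<close>

lemma lborel_distr_orthogonal:
  fixes T :: "real ^ 'd \<Rightarrow> real ^ 'd"
  assumes T: "orthogonal_transformation T"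
  shows "distr lborel borel T = lborel"
proof (rule measure_eqI)
  define B where "B = (ball 0 1 :: (real ^ 'd) set)"
  define \<nu> where "\<nu> = distr lborel borel T"
  have lin: "linear T" and inj: "inj T" and nrm: "\<And>x. norm (T x) = norm x"
    using T orthogonal_transformation_inj[OF T] orthogonal_transformation by auto
  obtain S where S: "\<And>x. T (S x) = x" "linear S"
    using orthogonal_transformation_surj[OF T] lin
    by (metis T orthogonal_transformation_inv orthogonal_transformation_linear surj_f_inv_f)
  have [measurable]: "T \<in> borel \<rightarrow>\<^sub>M borel"
    by (intro borel_measurable_continuous_onI linear_continuous_on linear_conv_bounded_linear[THEN iffD1] lin)
  have trl: "(\<integral>\<^sup>+x. f (x + c) \<partial>lborel) = (\<integral>\<^sup>+x. f x \<partial>lborel)"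
    if [measurable]: "f \<in> borel_measurable borel" for f :: "real ^ 'd \<Rightarrow> ennreal" and c
  proof -
    have "(\<integral>\<^sup>+x. f x \<partial>lborel) = (\<integral>\<^sup>+x. f x \<partial>density (distr lborel borel (\<lambda>x. c + 1 *\<^sub>R x)) (\<lambda>_. ennreal (\<bar>1\<bar>^DIM(real^'d))))"
      by (subst lborel_affine[of 1 c]) auto
    also have "\<dots> = (\<integral>\<^sup>+x. f (x + c) \<partial>lborel)"
      by (simp add: nn_integral_density nn_integral_distr add.commute)
    finally show ?thesis by simp
  qed
  have trn: "(\<integral>\<^sup>+x. f (x + c) \<partial>\<nu>) = (\<integral>\<^sup>+x. f x \<partial>\<nu>)"
    if [measurable]: "f \<in> borel_measurable borel" for f :: "real ^ 'd \<Rightarrow> ennreal" and c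
  proof -
    have "(\<integral>\<^sup>+x. f (x + c) \<partial>\<nu>) = (\<integral>\<^sup>+x. f (T (x + S c)) \<partial>lborel)"
      by (simp add: \<nu>_def nn_integral_distr linear_add[OF lin] S)
    also have "\<dots> = (\<integral>\<^sup>+x. f (T x) \<partial>lborel)"
      by (rule trl) measurable
    finally show ?thesis by (simp add: \<nu>_def nn_integral_distr)
  qed
  have B1: "emeasure \<nu> B = emeasure lborel B"
    by (auto simp: \<nu>_def B_def emeasure_distr nrm vimage_def ball_def intro!: arg_cong[where f="emeasure lborel"])
  have Bfin: "emeasure lborel B \<noteq> \<infinity>" "emeasure lborel B \<noteq> 0"
  proof -
    show "emeasure lborel B \<noteq> \<infinity>"
      by (metis B_def bounded_ball emeasure_bounded_finite infinity_ennreal_def less_irrefl)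
    show "emeasure lborel B \<noteq> 0"
      unfolding B_def by (simp add: emeasure_ball order_less_imp_not_eq2)
  qed
  \<comment> \<open>Needed for Fubini. \<open>T\<close> preserves norms, so centred balls have the
    same measure under \<open>\<nu>\<close> as under \<open>lborel\<close>.\<close>
  have sf: "sigma_finite_measure \<nu>"
  proof
    show "\<exists>A. countable A \<and> A \<subseteq> sets \<nu> \<and> \<Union> A = space \<nu> \<and> (\<forall>a\<in>A. emeasure \<nu> a \<noteq> \<infinity>)"
    proof (intro exI conjI ballI)
      let ?A = "range (\<lambda>k::nat. ball (0::real^'d) (real k))"
      show "countable ?A" "?A \<subseteq> sets \<nu>" by (auto simp: \<nu>_def)
      show "\<Union> ?A = space \<nu>"
        by (auto simp: \<nu>_def reals_Archimedean2)
      fix a assume "a \<in> ?A"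
      then obtain k :: nat where a: "a = ball 0 (real k)" by auto
      have "emeasure \<nu> a = emeasure lborel a"
        by (auto simp: \<nu>_def a emeasure_distr nrm vimage_def ball_def intro!: arg_cong[where f="emeasure lborel"])
      then show "emeasure \<nu> a \<noteq> \<infinity>"
        unfolding a by (metis bounded_ball emeasure_bounded_finite infinity_ennreal_def less_irrefl)
    qed
  qed
  interpret N: sigma_finite_measure \<nu> by fact
  interpret P: pair_sigma_finite \<nu> lborel ..
  have [measurable_cong]: "sets \<nu> = sets borel" by (simp add: \<nu>_def)
  have [measurable]: "B \<in> sets borel" by (simp add: B_def)
  fix A assume "A \<in> sets (distr lborel borel T)"
  then have [measurable]: "A \<in> sets borel" by simp
  define f where "f = (indicator A :: real^'d \<Rightarrow> ennreal)"
  define g where "g = (indicator B :: real^'d \<Rightarrow> ennreal)"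
  have [measurable]: "f \<in> borel_measurable borel" "g \<in> borel_measurable borel" by (auto simp: f_def g_def)
  \<comment> \<open>After the shift of \<open>x\<close> by \<open>y\<close> below, \<open>g\<close>
    is evaluated at \<open>- x\<close>; a ball is chosen for \<open>B\<close> because it is
    symmetric and is its own preimage under \<open>T\<close>.\<close>
  have sym: "g (- x) = g x" for x by (simp add: g_def B_def indicator_def)
  have "(\<integral>\<^sup>+x. f x \<partial>\<nu>) * (\<integral>\<^sup>+y. g y \<partial>lborel) = (\<integral>\<^sup>+x. f x * (\<integral>\<^sup>+y. g (y + (-x)) \<partial>lborel) \<partial>\<nu>)"
    by (simp add: trl nn_integral_multc del: add_uminus_conv_diff)
  also have "\<dots> = (\<integral>\<^sup>+x. (\<integral>\<^sup>+y. f x * g (y - x) \<partial>lborel) \<partial>\<nu>)"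
    by (intro nn_integral_cong) (simp add: nn_integral_cmult)
  also have "\<dots> = (\<integral>\<^sup>+y. (\<integral>\<^sup>+x. f x * g (y - x) \<partial>\<nu>) \<partial>lborel)"
    by (rule P.Fubini'[symmetric]) measurable
  also have "\<dots> = (\<integral>\<^sup>+y. (\<integral>\<^sup>+x. f (x + y) * g (y - (x + y)) \<partial>\<nu>) \<partial>lborel)"
    by (intro nn_integral_cong trn[symmetric]) measurable
  also have "\<dots> = (\<integral>\<^sup>+y. (\<integral>\<^sup>+x. f (x + y) * g x \<partial>\<nu>) \<partial>lborel)"
    by (simp add: sym)
  also have "\<dots> = (\<integral>\<^sup>+x. (\<integral>\<^sup>+y. f (x + y) * g x \<partial>lborel) \<partial>\<nu>)"
    by (rule P.Fubini') measurable
  also have "\<dots> = (\<integral>\<^sup>+x. (\<integral>\<^sup>+y. f y \<partial>lborel) * g x \<partial>\<nu>)"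
  proof (intro nn_integral_cong)
    fix x
    have "(\<integral>\<^sup>+y. f (x + y) * g x \<partial>lborel) = (\<integral>\<^sup>+y. f (y + x) \<partial>lborel) * g x"
      by (simp add: nn_integral_multc add.commute)
    then show "(\<integral>\<^sup>+y. f (x + y) * g x \<partial>lborel) = (\<integral>\<^sup>+y. f y \<partial>lborel) * g x" by (simp add: trl)
  qed
  also have "\<dots> = (\<integral>\<^sup>+y. f y \<partial>lborel) * (\<integral>\<^sup>+x. g x \<partial>\<nu>)"
    by (rule nn_integral_cmult) measurable
  finally have "emeasure \<nu> A * emeasure lborel B = emeasure lborel A * emeasure lborel B"
    by (simp add: f_def g_def B1)
  then show "emeasure (distr lborel borel T) A = emeasure lborel A"
    using Bfin unfolding \<nu>_def by (simp add: ennreal_mult_cancel_left mult.commute[of _ "emeasure lborel B"])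
qed simp

lemma nn_integral_lborel_vec_prod:
  fixes f :: "'d::finite \<Rightarrow> real \<Rightarrow> ennreal"
  assumes [measurable]: "\<And>k. f k \<in> borel_measurable borel"
  shows "(\<integral>\<^sup>+x. (\<Prod>k\<in>UNIV. f k (x $ k)) \<partial>lborel) = (\<Prod>k\<in>UNIV. (\<integral>\<^sup>+x. f k x \<partial>lborel))"
proof -
  \<comment> \<open>\<open>ix\<close> recovers the coordinate from its basis vector, which turns the
    product formula over \<open>Basis\<close> into one over coordinates.\<close>
  define ix :: "real ^ 'd \<Rightarrow> 'd" where "ix = inv_into UNIV (\<lambda>k. axis k 1)"
  have inj: "inj (\<lambda>k::'d. axis k (1::real))"
    by (rule injI) (metis axis_eq_axis zero_neq_one)
  have ix: "ix (axis k 1) = k" for k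
    unfolding ix_def by (rule inv_into_f_f) (auto intro: inj)
  have Bas: "(Basis :: (real^'d) set) = (\<lambda>k. axis k 1) ` UNIV"
    by (auto simp: Basis_vec_def)
  have re: "(\<Prod>b\<in>Basis. h b) = (\<Prod>k\<in>UNIV. h (axis k (1::real)))" for h :: "real ^ 'd \<Rightarrow> ennreal"
    unfolding Bas by (rule prod.reindex_cong[OF inj]) auto
  have "(\<integral>\<^sup>+x. (\<Prod>b\<in>Basis. f (ix b) (x \<bullet> b)) \<partial>lborel) = (\<Prod>b\<in>Basis. (\<integral>\<^sup>+x. f (ix b) x \<partial>lborel))"
    by (rule nn_integral_lborel_prod) auto
  then show ?thesis by (simp add: re ix inner_axis)
qed

section \<open>Gaussian densities, rotation invariance and exponential moments\<close>

lemma gaussian_density_measurable [measurable]: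
  "(\<lambda>x::real^'d. ennreal (\<Prod>k\<in>UNIV. normal_density (m $ k) s (x $ k))) \<in> borel_measurable borel"
  by measurable

lemma sets_gaussian [simp, measurable_cong]: "sets (gaussian m s) = sets borel"
  and space_gaussian [simp]: "space (gaussian m s) = UNIV"
  by (auto simp: gaussian_def)

lemma nn_integral_normal_density:
  "s > 0 \<Longrightarrow> (\<integral>\<^sup>+x. ennreal (normal_density m s x) \<partial>lborel) = 1"
  by (subst nn_integral_eq_integral) auto

lemma prob_space_gaussian:
  assumes s: "s > 0"
  shows "prob_space (gaussian m s)"
proof (rule prob_spaceI)
  have "(\<integral>\<^sup>+x. (\<Prod>k\<in>UNIV. ennreal (normal_density (m $ k) s (x $ k))) \<partial>lborel) = 1"
    using nn_integral_lborel_vec_prod[of "\<lambda>k x. ennreal (normal_density (m $ k) s x)"]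
    by (simp add: nn_integral_normal_density s)
  then show "emeasure (gaussian m s) (space (gaussian m s)) = 1"
    by (simp add: gaussian_def emeasure_density prod_ennreal)
qed

lemma vec_norm_sq: "(norm (x::real^'d))\<^sup>2 = (\<Sum>k\<in>UNIV. (x $ k)\<^sup>2)"
  by (simp add: norm_vec_def L2_set_def sum_nonneg)

lemma gaussian_density_eq:
  fixes m x :: "real ^ 'd"
  assumes "s > 0"
  shows "(\<Prod>k\<in>UNIV. normal_density (m $ k) s (x $ k)) =
     (1 / sqrt (2 * pi * s\<^sup>2)) ^ CARD('d) * exp (- (norm (x - m))\<^sup>2 / (2 * s\<^sup>2))"
proof -
  have "(\<Prod>k\<in>UNIV. normal_density (m $ k) s (x $ k)) =
      (\<Prod>k\<in>(UNIV::'d set). 1 / sqrt (2 * pi * s\<^sup>2)) * (\<Prod>k\<in>UNIV. exp (- (x $ k - m $ k)\<^sup>2 / (2 * s\<^sup>2)))"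
    unfolding normal_density_def prod.distrib ..
  also have "(\<Prod>k\<in>UNIV. exp (- (x $ k - m $ k)\<^sup>2 / (2 * s\<^sup>2))) = exp (- (norm (x - m))\<^sup>2 / (2 * s\<^sup>2))"
    by (simp add: vec_norm_sq sum_negf sum_divide_distrib flip: exp_sum)
  finally show ?thesis by simp
qed

text \<open>The standard density depends only on the norm, so \<open>T\<close> is absorbed by the
  invariance of \<open>lborel\<close>; what remains is the affine substitution by
  \<open>m + s *\<^sub>R x\<close>. This lets one standard family drive the samples for all
  rotations simultaneously.\<close>

lemma gaussian_distr_orthogonal:
  fixes T :: "real ^ 'd \<Rightarrow> real ^ 'd"
  assumes T: "orthogonal_transformation T" and s: "s > 0"
  shows "distr (gaussian 0 1) borel (\<lambda>x. m + s *\<^sub>R T x) = gaussian m s"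
proof -
  have lin: "linear T" and nrm: "\<And>x. norm (T x) = norm x"
    using T orthogonal_transformation by auto
  have [measurable]: "T \<in> borel \<rightarrow>\<^sub>M borel"
    by (intro borel_measurable_continuous_onI linear_continuous_on linear_conv_bounded_linear[THEN iffD1] lin)
  show "distr (gaussian 0 1) borel (\<lambda>x. m + s *\<^sub>R T x) = gaussian m s"
  proof (rule measure_eqI)
    fix A assume "A \<in> sets (distr (gaussian 0 1) borel (\<lambda>x. m + s *\<^sub>R T x))"
    then have [measurable]: "A \<in> sets borel" by simp
    define h where "h x = ennreal ((1 / sqrt (2 * pi)) ^ CARD('d) * exp (- (norm x)\<^sup>2 / 2)) * indicator A (m + s *\<^sub>R x)"
      for x :: "real ^ 'd"
    have [measurable]: "h \<in> borel_measurable borel" unfolding h_def by measurable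
    have "emeasure (distr (gaussian 0 1) borel (\<lambda>x. m + s *\<^sub>R T x)) A
       = (\<integral>\<^sup>+x. h (T x) \<partial>lborel)"
      by (simp add: emeasure_distr gaussian_def emeasure_density gaussian_density_eq h_def nrm
          gaussian_density_eq[where m=0 and s=1, simplified] indicator_def vimage_def if_distrib cong: if_cong)
    also have "\<dots> = (\<integral>\<^sup>+x. h x \<partial>distr lborel borel T)"
      by (simp add: nn_integral_distr)
    also have "\<dots> = (\<integral>\<^sup>+x. h x \<partial>lborel)"
      by (simp add: lborel_distr_orthogonal[OF T])
    also have "\<dots> = (\<integral>\<^sup>+x. ennreal (s ^ CARD('d) * (\<Prod>k\<in>UNIV. normal_density (m $ k) s ((m + s *\<^sub>R x) $ k)))
         * indicator A (m + s *\<^sub>R x) \<partial>lborel)"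
      unfolding gaussian_density_eq[OF s] h_def using s
      by (intro nn_integral_cong) (simp add: power_mult_distrib real_sqrt_mult power_divide)
    also have "\<dots> = (\<integral>\<^sup>+x. ennreal (\<Prod>k\<in>UNIV. normal_density (m $ k) s (x $ k)) * indicator A x
        \<partial>(density (distr lborel borel (\<lambda>x. m + s *\<^sub>R x)) (\<lambda>_. ennreal (\<bar>s\<bar>^DIM(real^'d)))))"
      using s by (simp add: nn_integral_density nn_integral_distr ennreal_mult' prod_nonneg mult_ac
          ennreal_power[symmetric] )
    also have "\<dots> = (\<integral>\<^sup>+x. ennreal (\<Prod>k\<in>UNIV. normal_density (m $ k) s (x $ k)) * indicator A x \<partial>lborel)"
      using lborel_affine[of s m] s by simp
    also have "\<dots> = emeasure (gaussian m s) A"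
      by (simp add: gaussian_def emeasure_density)
    finally show "emeasure (distr (gaussian 0 1) borel (\<lambda>x. m + s *\<^sub>R T x)) A = emeasure (gaussian m s) A" .
  qed simp
qed

text \<open>Completing the square: the exponential tilt turns the standard density into a constant
  multiple of the density with mean \<open>u\<close>.\<close>

lemma nn_integral_exp_inner_gaussian:
  fixes u :: "real ^ 'd"
  shows "(\<integral>\<^sup>+x. ennreal (exp (u \<bullet> x)) \<partial>gaussian 0 1) = ennreal (exp ((norm u)\<^sup>2 / 2))"
proof -
  interpret U: prob_space "gaussian u 1" by (rule prob_space_gaussian) simp
  have eq: "- (norm x)\<^sup>2 / 2 + u \<bullet> x = (norm u)\<^sup>2 / 2 + - (norm (x - u))\<^sup>2 / 2" for x
    by (simp add: power2_norm_eq_inner inner_diff_left inner_diff_right inner_commute field_simps)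
  have "(\<integral>\<^sup>+x. ennreal (exp (u \<bullet> x)) \<partial>gaussian 0 1)
     = (\<integral>\<^sup>+x. ennreal (exp ((norm u)\<^sup>2 / 2)) * ennreal (\<Prod>k\<in>UNIV. normal_density (u $ k) 1 (x $ k)) \<partial>lborel)"
  proof -
    have "(\<Prod>k\<in>UNIV. normal_density ((0::real^'d) $ k) 1 (x $ k)) * exp (u \<bullet> x)
        = exp ((norm u)\<^sup>2 / 2) * (\<Prod>k\<in>UNIV. normal_density (u $ k) 1 (x $ k))" for x :: "real ^ 'd"
    proof -
      have "exp (- (norm x)\<^sup>2 / 2) * exp (u \<bullet> x) = exp ((norm u)\<^sup>2 / 2) * exp (- (norm (x - u))\<^sup>2 / 2)"
        unfolding exp_add[symmetric] eq ..
      then show ?thesis unfolding gaussian_density_eq[OF zero_less_one] by simp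
    qed
    then show ?thesis
      unfolding gaussian_def
      by (subst nn_integral_density) (simp_all add: prod_nonneg flip: ennreal_mult)
  qed
  also have "\<dots> = ennreal (exp ((norm u)\<^sup>2 / 2)) * emeasure (gaussian u 1) UNIV"
    by (subst nn_integral_cmult) (auto simp: gaussian_def emeasure_density)
  finally show ?thesis using U.emeasure_space_1 by simp
qed

text \<open>The tilted integrand is a multiple of the centred normal density of variance 1/(1 - 2l),
  which is meaningful exactly for l < 1/2.\<close>

lemma nn_integral_exp_square_normal_density:
  assumes "l < 1/2"
  shows "(\<integral>\<^sup>+x. ennreal (normal_density 0 1 x * exp (l * x\<^sup>2)) \<partial>lborel) = ennreal (1 / sqrt (1 - 2 * l))"
proof -
  define s where "s = 1 / sqrt (1 - 2 * l)"
  have s: "s > 0" and s2: "s\<^sup>2 = 1 / (1 - 2 * l)" using assms by (auto simp: s_def power_divide)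
  have e: "- x\<^sup>2 / 2 + l * x\<^sup>2 = - x\<^sup>2 / (2 * s\<^sup>2)" for x
    using assms unfolding s2 by (simp add: field_simps)
  have e': "exp (- x\<^sup>2 / 2) * exp (l * x\<^sup>2) = exp (- x\<^sup>2 / (2 * s\<^sup>2))" for x
    by (metis e exp_add)
  have "normal_density 0 1 x * exp (l * x\<^sup>2) = s * normal_density 0 s x" for x
    using s e'[of x] by (simp add: normal_density_def real_sqrt_mult)
  then show ?thesis
    using s by (simp add: ennreal_mult nn_integral_cmult nn_integral_normal_density s_def[symmetric])
qed

lemma nn_integral_exp_square_coords_gaussian:
  fixes K :: "'d::finite set"
  assumes l: "l < 1/2"
  shows "(\<integral>\<^sup>+x. ennreal (exp (l * (\<Sum>k\<in>K. (x $ k)\<^sup>2))) \<partial>gaussian 0 1) = ennreal ((1 / sqrt (1 - 2 * l)) ^ card K)"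
proof -
  define f where "f k x = ennreal (normal_density 0 1 x * (if k \<in> K then exp (l * x\<^sup>2) else 1))" for k :: 'd and x
  have [measurable]: "f k \<in> borel_measurable borel" for k unfolding f_def by measurable
  have "(\<integral>\<^sup>+x. ennreal (exp (l * (\<Sum>k\<in>K. (x $ k)\<^sup>2))) \<partial>gaussian 0 1) = (\<integral>\<^sup>+x. (\<Prod>k\<in>UNIV. f k (x $ k)) \<partial>lborel)"
    unfolding gaussian_def
    by (subst nn_integral_density)
       (auto simp: f_def prod_ennreal sum_distrib_left exp_sum prod.distrib prod.If_cases
          ennreal_mult prod_nonneg intro!: nn_integral_cong)
  also have "\<dots> = (\<Prod>k\<in>UNIV. (\<integral>\<^sup>+x. f k x \<partial>lborel))"
    by (rule nn_integral_lborel_vec_prod) measurable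
  also have "\<dots> = (\<Prod>k\<in>(UNIV::'d set). if k \<in> K then ennreal (1 / sqrt (1 - 2 * l)) else 1)"
    by (intro prod.cong refl)
       (auto simp: f_def nn_integral_exp_square_normal_density[OF l] nn_integral_normal_density)
  also have "\<dots> = ennreal ((1 / sqrt (1 - 2 * l)) ^ card K)"
    using l by (simp add: prod.If_cases ennreal_power)
  finally show ?thesis .
qed

lemma nn_integral_gaussian_orthogonal:
  fixes T :: "real ^ 'd \<Rightarrow> real ^ 'd"
  assumes T: "orthogonal_transformation T" and [measurable]: "f \<in> borel_measurable borel"
  shows "(\<integral>\<^sup>+x. f (T x) \<partial>gaussian 0 1) = (\<integral>\<^sup>+x. f x \<partial>gaussian 0 1)"
proof -
  have [measurable]: "T \<in> borel \<rightarrow>\<^sub>M borel"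
    using T by (intro borel_measurable_continuous_onI linear_continuous_on linear_conv_bounded_linear[THEN iffD1])
      (simp add: orthogonal_transformation)
  have "(\<integral>\<^sup>+x. f x \<partial>gaussian 0 1) = (\<integral>\<^sup>+x. f x \<partial>distr (gaussian 0 1) borel T)"
    using gaussian_distr_orthogonal[OF T, of 1 0] by simp
  then show ?thesis by (simp add: nn_integral_distr)
qed

text \<open>Together with rotation invariance this reduces statements about the component along
  \<open>u\<close> to a single coordinate.\<close>

lemma unit_vector_as_axis:
  fixes u :: "real ^ 'd" and k :: 'd
  assumes "norm u = 1"
  obtains T :: "real ^ 'd \<Rightarrow> real ^ 'd" where "orthogonal_transformation T" "\<And>x. T x \<bullet> u = x $ k"
proof -
  have "norm (axis k 1 :: real ^ 'd) = norm u" using assms by simp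
  from orthogonal_transformation_exists[OF this] obtain T :: "real ^ 'd \<Rightarrow> real ^ 'd"
    where T: "orthogonal_transformation T" "T (axis k 1) = u" by blast
  have "T x \<bullet> u = x $ k" for x
    using T by (metis orthogonal_transformation_def inner_axis inner_real_def mult.right_neutral)
  with T that show ?thesis by blast
qed

text \<open>In the second claim a rotation carrying an axis to \<open>u\<close> makes
  \<open>x \<bullet> u\<close> one coordinate; subtracting its square removes one degree of freedom,
  hence the exponent \<open>CARD('d) - 1\<close>.\<close>

lemma nn_integral_exp_norm_sq_gaussian:
  fixes u :: "real ^ 'd"
  assumes l: "l < 1/2"
  shows "(\<integral>\<^sup>+(x::real^'d). ennreal (exp (l * (norm x)\<^sup>2)) \<partial>gaussian 0 1) = ennreal ((1 / sqrt (1 - 2 * l)) ^ CARD('d))"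
    and "norm u = 1 \<Longrightarrow> (\<integral>\<^sup>+x. ennreal (exp (l * ((norm x)\<^sup>2 - (x \<bullet> u)\<^sup>2))) \<partial>gaussian 0 1)
            = ennreal ((1 / sqrt (1 - 2 * l)) ^ (CARD('d) - 1))"
proof -
  show "(\<integral>\<^sup>+(x::real^'d). ennreal (exp (l * (norm x)\<^sup>2)) \<partial>gaussian 0 1) = ennreal ((1 / sqrt (1 - 2 * l)) ^ CARD('d))"
    using nn_integral_exp_square_coords_gaussian[OF l, of "UNIV :: 'd set"] by (simp add: vec_norm_sq)
  assume u: "norm u = 1"
  fix k :: 'd
  obtain T :: "real ^ 'd \<Rightarrow> real ^ 'd" where T: "orthogonal_transformation T" "\<And>x. T x \<bullet> u = x $ k"
    using unit_vector_as_axis[OF u] by blast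
  have nT: "norm (T x) = norm x" for x using T(1) by (simp add: orthogonal_transformation)
  have "(\<integral>\<^sup>+x. ennreal (exp (l * ((norm x)\<^sup>2 - (x \<bullet> u)\<^sup>2))) \<partial>gaussian 0 1)
     = (\<integral>\<^sup>+x. ennreal (exp (l * ((norm (T x))\<^sup>2 - (T x \<bullet> u)\<^sup>2))) \<partial>gaussian 0 1)"
    by (rule nn_integral_gaussian_orthogonal[OF T(1), symmetric]) measurable
  also have "\<dots> = (\<integral>\<^sup>+x. ennreal (exp (l * (\<Sum>j\<in>UNIV - {k}. (x $ j)\<^sup>2))) \<partial>gaussian 0 1)"
    by (intro nn_integral_cong) (simp add: nT T(2) vec_norm_sq sum_diff1)
  also have "\<dots> = ennreal ((1 / sqrt (1 - 2 * l)) ^ (CARD('d) - 1))"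
    by (subst nn_integral_exp_square_coords_gaussian[OF l]) (simp add: card_Diff_singleton)
  finally show "(\<integral>\<^sup>+x. ennreal (exp (l * ((norm x)\<^sup>2 - (x \<bullet> u)\<^sup>2))) \<partial>gaussian 0 1)
            = ennreal ((1 / sqrt (1 - 2 * l)) ^ (CARD('d) - 1))" .
qed

section \<open>Chernoff bounds and anticoncentration\<close>

lemma exp_markov:
  assumes "prob_space M" and [measurable]: "X \<in> borel_measurable M"
    and C: "(\<integral>\<^sup>+x. ennreal (exp (X x)) \<partial>M) \<le> ennreal C" "C \<ge> 0"
  shows "measure M {x \<in> space M. X x \<ge> t} \<le> exp (- t) * C"
proof -
  interpret prob_space M by fact
  have "emeasure M {x \<in> space M. X x \<ge> t} = (\<integral>\<^sup>+x. indicator {x \<in> space M. X x \<ge> t} x \<partial>M)"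
    by simp
  also have "\<dots> \<le> (\<integral>\<^sup>+x. ennreal (exp (- t)) * ennreal (exp (X x)) \<partial>M)"
    by (intro nn_integral_mono) (auto simp: indicator_def simp flip: ennreal_mult exp_add)
  also have "\<dots> \<le> ennreal (exp (- t)) * ennreal C"
    by (subst nn_integral_cmult) (auto intro!: mult_left_mono C)
  finally show ?thesis
    using C(2) by (simp add: emeasure_eq_measure flip: ennreal_mult)
qed

abbreviation gaussian_family :: "nat set \<Rightarrow> (nat \<Rightarrow> real ^ 'd) measure" where
  "gaussian_family I \<equiv> PiM I (\<lambda>_. gaussian 0 1)"

lemma prob_space_gaussian_family: "prob_space (gaussian_family I)"
  by (intro prob_space_PiM prob_space_gaussian) simp

lemma nn_integral_gaussian_family_prod:
  assumes "finite I" and "\<And>i. i \<in> I \<Longrightarrow> f i \<in> borel_measurable borel"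
  shows "(\<integral>\<^sup>+g. (\<Prod>i\<in>I. f i (g i)) \<partial>gaussian_family I) = (\<Prod>i\<in>I. \<integral>\<^sup>+x. f i x \<partial>gaussian 0 1)"
proof -
  interpret product_prob_space "\<lambda>_::nat. gaussian (0 :: real^'d) 1"
    by (intro product_prob_spaceI prob_space_gaussian) simp
  show ?thesis using assms by (intro product_nn_integral_prod) auto
qed

lemma gaussian_family_linear_tail:
  fixes u :: "nat \<Rightarrow> real ^ 'd"
  assumes I: "finite I" and V: "(\<Sum>i\<in>I. (norm (u i))\<^sup>2) \<le> V" "V > 0" and t: "t \<ge> 0"
  shows "measure (gaussian_family I) {g \<in> space (gaussian_family I). (\<Sum>i\<in>I. u i \<bullet> g i) \<ge> t} \<le> exp (- t\<^sup>2 / (2 * V))"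
proof -
  \<comment> \<open>The minimizer of -st + s^2 V/2, the exponent of the Chernoff bound.\<close>
  define s where "s = t / V"
  have s: "s \<ge> 0" using t V by (simp add: s_def)
  have "(\<integral>\<^sup>+g. ennreal (exp (s * (\<Sum>i\<in>I. u i \<bullet> g i))) \<partial>gaussian_family I)
      = (\<integral>\<^sup>+g. (\<Prod>i\<in>I. ennreal (exp ((s *\<^sub>R u i) \<bullet> g i))) \<partial>gaussian_family I)"
    using I by (simp add: prod_ennreal sum_distrib_left exp_sum)
  also have "\<dots> = (\<Prod>i\<in>I. \<integral>\<^sup>+x. ennreal (exp ((s *\<^sub>R u i) \<bullet> x)) \<partial>gaussian 0 1)"
    by (rule nn_integral_gaussian_family_prod[OF I]) measurable
  also have "\<dots> = ennreal (exp (s\<^sup>2 / 2 * (\<Sum>i\<in>I. (norm (u i))\<^sup>2)))"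
    unfolding nn_integral_exp_inner_gaussian using I
    by (simp add: prod_ennreal sum_distrib_left exp_sum power_mult_distrib)
  also have "\<dots> \<le> ennreal (exp (s\<^sup>2 / 2 * V))"
    using V by (simp add: mult_left_mono)
  finally have "measure (gaussian_family I) {g \<in> space (gaussian_family I). s * (\<Sum>i\<in>I. u i \<bullet> g i) \<ge> s * t}
      \<le> exp (- (s * t)) * exp (s\<^sup>2 / 2 * V)"
    by (intro exp_markov prob_space_gaussian_family) auto
  also have "exp (- (s * t)) * exp (s\<^sup>2 / 2 * V) = exp (- t\<^sup>2 / (2 * V))"
    using V by (simp add: s_def power2_eq_square field_simps flip: exp_add)
  finally have *: "measure (gaussian_family I) {g \<in> space (gaussian_family I). s * (\<Sum>i\<in>I. u i \<bullet> g i) \<ge> s * t}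
      \<le> exp (- t\<^sup>2 / (2 * V))" .
  interpret prob_space "gaussian_family I :: (nat \<Rightarrow> real^'d) measure" by (rule prob_space_gaussian_family)
  have "measure (gaussian_family I) {g \<in> space (gaussian_family I). (\<Sum>i\<in>I. u i \<bullet> g i) \<ge> t}
     \<le> measure (gaussian_family I) {g \<in> space (gaussian_family I). s * (\<Sum>i\<in>I. u i \<bullet> g i) \<ge> s * t}"
    using s by (intro finite_measure_mono) (auto intro!: mult_left_mono)
  with * show ?thesis by linarith
qed

text \<open>Chi-square Chernoff bounds, with one factor 1/sqrt(1 - 2l) per degree of freedom. The
  parameter \<open>l\<close> stays free so that it can be chosen to make this factor simple: 1/4
  gives sqrt 2 and 3/8 gives 2.\<close>

lemma gaussian_family_norm_sq_tail:
  fixes u :: "real ^ 'd"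
  assumes I: "finite I" and l: "0 \<le> l" "l < 1/2"
  shows "measure (gaussian_family I) {g \<in> space (gaussian_family I). l * (\<Sum>i\<in>I. (norm (g i :: real^'d))\<^sup>2) \<ge> t}
           \<le> exp (- t) * (1 / sqrt (1 - 2 * l)) ^ (CARD('d) * card I)"
    and "norm u = 1 \<Longrightarrow>
     measure (gaussian_family I) {g \<in> space (gaussian_family I). l * (\<Sum>i\<in>I. (norm (g i))\<^sup>2 - (g i \<bullet> u)\<^sup>2) \<ge> t}
           \<le> exp (- t) * (1 / sqrt (1 - 2 * l)) ^ ((CARD('d) - 1) * card I)"
proof -
  have *: "measure (gaussian_family I) {g \<in> space (gaussian_family I). l * (\<Sum>i\<in>I. q (g i :: real^'d)) \<ge> t}
           \<le> exp (- t) * (1 / sqrt (1 - 2 * l)) ^ (k * card I)"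
    if [measurable]: "q \<in> borel_measurable borel"
      and q: "(\<integral>\<^sup>+x. ennreal (exp (l * q x)) \<partial>gaussian 0 1) = ennreal ((1 / sqrt (1 - 2 * l)) ^ k)" for q k
  proof -
    have "(\<integral>\<^sup>+g. ennreal (exp (l * (\<Sum>i\<in>I. q (g i)))) \<partial>gaussian_family I)
      = (\<integral>\<^sup>+g. (\<Prod>i\<in>I. ennreal (exp (l * q (g i)))) \<partial>gaussian_family I)"
      using I by (simp add: prod_ennreal sum_distrib_left exp_sum)
    also have "\<dots> = (\<Prod>i\<in>I. \<integral>\<^sup>+x. ennreal (exp (l * q x)) \<partial>gaussian 0 1)"
      by (rule nn_integral_gaussian_family_prod[OF I]) measurable
    also have "\<dots> = ennreal ((1 / sqrt (1 - 2 * l)) ^ (k * card I))"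
      unfolding q using l by (simp add: power_mult ennreal_power)
    finally show ?thesis
      using l I by (intro exp_markov prob_space_gaussian_family) auto
  qed
  show "measure (gaussian_family I) {g \<in> space (gaussian_family I). l * (\<Sum>i\<in>I. (norm (g i :: real^'d))\<^sup>2) \<ge> t}
           \<le> exp (- t) * (1 / sqrt (1 - 2 * l)) ^ (CARD('d) * card I)"
    by (rule *) (measurable, rule nn_integral_exp_norm_sq_gaussian(1)[OF l(2)])
  show "measure (gaussian_family I) {g \<in> space (gaussian_family I). l * (\<Sum>i\<in>I. (norm (g i))\<^sup>2 - (g i \<bullet> u)\<^sup>2) \<ge> t}
           \<le> exp (- t) * (1 / sqrt (1 - 2 * l)) ^ ((CARD('d) - 1) * card I)" if "norm u = 1"
    by (rule *) (measurable, rule nn_integral_exp_norm_sq_gaussian(2)[OF l(2) that])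
qed

text \<open>The version for a single vector. Here \<open>V\<close> bounds the standard deviation,
  whereas in \<open>gaussian_family_linear_tail\<close> it bounds the variance.\<close>

lemma gaussian_linear_tail:
  fixes r :: "real ^ 'd"
  assumes V: "norm r \<le> V" "V > 0" and t: "t \<ge> 0"
  shows "measure (gaussian 0 1) {w. w \<bullet> r \<ge> t} \<le> exp (- t\<^sup>2 / (2 * V\<^sup>2))"
proof -
  define s where "s = t / V\<^sup>2"
  have s: "s \<ge> 0" using t V by (simp add: s_def)
  interpret prob_space "gaussian 0 1 :: (real^'d) measure" by (rule prob_space_gaussian) simp
  have "(\<integral>\<^sup>+w. ennreal (exp (s * (w \<bullet> r))) \<partial>gaussian 0 1) = (\<integral>\<^sup>+w. ennreal (exp ((s *\<^sub>R r) \<bullet> w)) \<partial>gaussian 0 1)"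
    by (simp add: inner_commute)
  also have "\<dots> = ennreal (exp ((norm (s *\<^sub>R r))\<^sup>2 / 2))"
    by (rule nn_integral_exp_inner_gaussian)
  also have "\<dots> \<le> ennreal (exp (s\<^sup>2 * V\<^sup>2 / 2))"
    using V by (auto simp: power_mult_distrib intro!: mult_left_mono power_mono)
  finally have "measure (gaussian 0 1) {w \<in> space (gaussian 0 1). s * (w \<bullet> r) \<ge> s * t}
      \<le> exp (- (s * t)) * exp (s\<^sup>2 * V\<^sup>2 / 2)"
    by (intro exp_markov prob_space_axioms) auto
  also have "exp (- (s * t)) * exp (s\<^sup>2 * V\<^sup>2 / 2) = exp (- t\<^sup>2 / (2 * V\<^sup>2))"
    using V by (simp add: s_def power2_eq_square field_simps flip: exp_add)
  finally have *: "measure (gaussian 0 1) {w \<in> space (gaussian 0 1). s * (w \<bullet> r) \<ge> s * t} \<le> exp (- t\<^sup>2 / (2 * V\<^sup>2))" .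
  have "measure (gaussian 0 1) {w. w \<bullet> r \<ge> t} \<le> measure (gaussian 0 1) {w \<in> space (gaussian 0 1). s * (w \<bullet> r) \<ge> s * t}"
    using s by (intro finite_measure_mono) (auto intro!: mult_left_mono)
  with * show ?thesis by linarith
qed

text \<open>The slab where the absolute value of \<open>w \<bullet> u\<close> is at most t has width
  2t and density at most 1/2, hence mass at most t; by the symmetry of the Gaussian the remaining
  mass is shared equally by the two sides.\<close>

lemma gaussian_anticoncentration:
  fixes u :: "real ^ 'd"
  assumes u: "norm u = 1" and t: "t \<ge> 0"
  shows "measure (gaussian 0 1) {w. w \<bullet> u < - t} \<ge> 1/2 - t/2"
proof -
  interpret prob_space "gaussian 0 1 :: (real^'d) measure" by (rule prob_space_gaussian) simp
  fix k :: 'd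
  obtain T :: "real ^ 'd \<Rightarrow> real ^ 'd" where T: "orthogonal_transformation T" "\<And>x. T x \<bullet> u = x $ k"
    using unit_vector_as_axis[OF u] by blast
  define f where "f j x = ennreal (normal_density 0 1 x) * (if j = k then indicator {-t..t} x else 1)" for j :: 'd and x
  have [measurable]: "f j \<in> borel_measurable borel" for j unfolding f_def by measurable
  have "emeasure (gaussian 0 1) {w. \<bar>w \<bullet> u\<bar> \<le> t} = (\<integral>\<^sup>+w. indicator {-t..t} (w \<bullet> u) \<partial>gaussian 0 1)"
  proof -
    have "(\<integral>\<^sup>+w. indicator {-t..t} (w \<bullet> u) \<partial>gaussian 0 1) = (\<integral>\<^sup>+w. indicator {w. \<bar>w \<bullet> u\<bar> \<le> t} w \<partial>gaussian 0 1)"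
      by (intro nn_integral_cong) (auto simp: indicator_def)
    then show ?thesis by simp
  qed
  also have "\<dots> = (\<integral>\<^sup>+w. indicator {-t..t} (T w \<bullet> u) \<partial>gaussian 0 1)"
    by (rule nn_integral_gaussian_orthogonal[OF T(1), symmetric]) measurable
  also have "\<dots> = (\<integral>\<^sup>+w. (\<Prod>j\<in>UNIV. f j (w $ j)) \<partial>lborel)"
    unfolding gaussian_def T(2)
    by (subst nn_integral_density) (auto simp: f_def prod.distrib prod_ennreal intro!: nn_integral_cong)
  also have "\<dots> = (\<Prod>j\<in>UNIV. (\<integral>\<^sup>+x. f j x \<partial>lborel))"
    by (rule nn_integral_lborel_vec_prod) measurable
  also have "\<dots> = (\<Prod>j\<in>(UNIV::'d set). if j = k then (\<integral>\<^sup>+x. f k x \<partial>lborel) else 1)"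
    by (intro prod.cong refl) (auto simp: f_def[abs_def] nn_integral_normal_density)
  also have "\<dots> = (\<integral>\<^sup>+x. f k x \<partial>lborel)"
    by (simp add: prod.If_cases f_def[abs_def])
  also have "\<dots> \<le> (\<integral>\<^sup>+x. ennreal (1/2) * indicator {-t..t} x \<partial>lborel)"
  proof (intro nn_integral_mono)
    fix x :: real
    \<comment> \<open>Replacing 2 pi by 4 bounds the normal density by the round constant
      1/2.\<close>
    have "sqrt 4 \<le> sqrt (2 * pi)" using pi_gt3 by (intro real_sqrt_le_mono) linarith
    then have "exp (- x\<^sup>2 / 2) / sqrt (2 * pi) \<le> 1 / 2" by (intro frac_le) auto
    then have "normal_density 0 1 x \<le> 1/2" by (simp add: normal_density_def)
    then show "f k x \<le> ennreal (1/2) * indicator {-t..t} x"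
      unfolding f_def by (cases "x \<in> {-t..t}") (simp_all del: ennreal_half add: ennreal_leI)
  qed
  also have "\<dots> = ennreal t"
  proof -
    have "(\<integral>\<^sup>+x. ennreal (1/2) * indicator {-t..t} x \<partial>lborel) = ennreal (1/2) * ennreal (2 * t)"
      using t by (subst nn_integral_cmult) auto
    also have "\<dots> = ennreal t"
      using t by (subst ennreal_mult[symmetric]) auto
    finally show ?thesis .
  qed
  finally have 1: "measure (gaussian 0 1) {w. \<bar>w \<bullet> u\<bar> \<le> t} \<le> t"
    using t by (simp add: emeasure_eq_measure)
  have "emeasure (gaussian 0 1) {w. w \<bullet> u > t} = (\<integral>\<^sup>+w. indicator {w. w \<bullet> u > t} w \<partial>gaussian 0 1)"
    by simp
  also have "\<dots> = (\<integral>\<^sup>+w. indicator {w. w \<bullet> u > t} (- w) \<partial>gaussian 0 1)"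
    by (rule nn_integral_gaussian_orthogonal[symmetric])
       (auto simp: orthogonal_transformation_def linear_iff)
  also have "\<dots> = (\<integral>\<^sup>+w. indicator {w. w \<bullet> u < - t} w \<partial>gaussian 0 1)"
    by (intro nn_integral_cong) (auto simp: indicator_def)
  finally have 2: "measure (gaussian 0 1) {w. w \<bullet> u > t} = measure (gaussian 0 1) {w. w \<bullet> u < - t}"
    by (simp add: emeasure_eq_measure)
  have *: "{w. \<bar>w \<bullet> u\<bar> \<le> t} \<union> ({w. w \<bullet> u > t} \<union> {w. w \<bullet> u < - t}) = UNIV" by auto
  have "1 = measure (gaussian 0 1) ({w. \<bar>w \<bullet> u\<bar> \<le> t} \<union> ({w. w \<bullet> u > t} \<union> {w. w \<bullet> u < - t}))"
    unfolding * using prob_space by simp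
  also have "\<dots> \<le> measure (gaussian 0 1) {w. \<bar>w \<bullet> u\<bar> \<le> t} +
      (measure (gaussian 0 1) {w. w \<bullet> u > t} + measure (gaussian 0 1) {w. w \<bullet> u < - t})"
    by (intro order_trans[OF measure_Un_le] add_left_mono measure_Un_le) auto
  finally show ?thesis using 1 2 by simp
qed

section \<open>Affine combinations and the solution of the extended program\<close>

text \<open>Projection along a compact factor preserves closedness; the tube lemma gives a
  neighbourhood of each point outside the projection.\<close>

lemma closed_ex_compact:
  assumes K: "compact K" and C: "closed C"
  shows "closed {x. \<exists>u\<in>K. (x, u) \<in> C}"
proof -
  have "open (- {x. \<exists>u\<in>K. (x, u) \<in> C})"
  proof (subst open_subopen, intro ballI)
    fix x assume x: "x \<in> - {x. \<exists>u\<in>K. (x, u) \<in> C}"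
    have "\<exists>X0. x \<in> X0 \<and> open X0 \<and> X0 \<times> K \<subseteq> - C"
      using x C by (intro Elementary_Topology.tube_lemma[OF K]) auto
    then show "\<exists>T. open T \<and> x \<in> T \<and> T \<subseteq> - {x. \<exists>u\<in>K. (x, u) \<in> C}" by blast
  qed
  then show ?thesis by (simp add: closed_open)
qed

lemma compact_box_fun:
  "compact {u :: nat \<Rightarrow> real. \<forall>i. \<bar>u i\<bar> \<le> r}"
proof -
  have "compactin (product_topology (\<lambda>_. euclidean) UNIV) (PiE UNIV (\<lambda>_::nat. {-r..r}))"
    by (subst compactin_PiE) simp
  moreover have "PiE UNIV (\<lambda>_::nat. {-r..r}) = {u. \<forall>i. \<bar>u i\<bar> \<le> r}"
    by (auto simp: PiE_def Pi_def abs_le_iff minus_le_iff)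
  ultimately show ?thesis by (simp add: euclidean_product_topology)
qed

text \<open>A projection of a closed set along a noncompact factor need not be closed. Since the
  coefficients vanish outside a fixed finite set, each of them lies in some box with integer bound,
  compact by Tychonoff, and the projection is a countable union of closed sets.\<close>

lemma borel_ex_finite_support:
  fixes C :: "('x::topological_space \<times> (nat \<Rightarrow> real)) set"
  assumes C: "closed C" and J: "finite J" and supp: "\<And>x u i. (x, u) \<in> C \<Longrightarrow> i \<notin> J \<Longrightarrow> u i = 0"
  shows "{x. \<exists>u. (x, u) \<in> C} \<in> sets borel"
proof -
  have "{x. \<exists>u. (x, u) \<in> C} = (\<Union>r::nat. {x. \<exists>u\<in>{u. \<forall>i. \<bar>u i\<bar> \<le> real r}. (x, u) \<in> C})"
  proof (safe, goal_cases)
    case (1 x u)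
    obtain r :: nat where r: "(\<Sum>i\<in>J. \<bar>u i\<bar>) \<le> real r" using real_arch_simple by blast
    have "\<bar>u i\<bar> \<le> real r" for i
    proof (cases "i \<in> J")
      case True
      then have "\<bar>u i\<bar> \<le> (\<Sum>i\<in>J. \<bar>u i\<bar>)" using J by (intro member_le_sum) auto
      then show ?thesis using r by simp
    next
      case False
      then show ?thesis using supp[OF 1] by simp
    qed
    with 1 show ?case by auto
  qed auto
  also have "\<dots> \<in> sets borel"
    by (intro sets.countable_UN image_subsetI borel_closed closed_ex_compact compact_box_fun C)
  finally show ?thesis .
qed

section \<open>Affine hulls and affine independence in terms of coefficients\<close>

lemma affine_hull_image_eq:
  fixes c :: "'i \<Rightarrow> 'a::real_vector"
  assumes K: "finite K"
  shows "affine hull (c ` K) = {\<Sum>i\<in>K. u i *\<^sub>R c i | u. (\<Sum>i\<in>K. u i) = 1}"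
proof
  show "affine hull (c ` K) \<subseteq> {\<Sum>i\<in>K. u i *\<^sub>R c i | u. (\<Sum>i\<in>K. u i) = 1}"
  proof (rule hull_minimal)
    show "c ` K \<subseteq> {\<Sum>i\<in>K. u i *\<^sub>R c i | u. (\<Sum>i\<in>K. u i) = 1}"
    proof (safe, goal_cases)
      case (1 x i)
      then show ?case
        using K by (intro exI[of _ "\<lambda>j. if j = i then 1 else 0"]) (simp add: if_distrib[where f="\<lambda>t. t *\<^sub>R _"] cong: if_cong)
    qed
    show "affine {\<Sum>i\<in>K. u i *\<^sub>R c i | u. (\<Sum>i\<in>K. u i) = 1}"
      unfolding affine_def
    proof (intro ballI allI impI)
      fix x y and r t :: real
      assume "x \<in> {\<Sum>i\<in>K. u i *\<^sub>R c i | u. (\<Sum>i\<in>K. u i) = 1}"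
        and "y \<in> {\<Sum>i\<in>K. u i *\<^sub>R c i | u. (\<Sum>i\<in>K. u i) = 1}" and rt: "r + t = 1"
      then obtain u v where "x = (\<Sum>i\<in>K. u i *\<^sub>R c i)" "(\<Sum>i\<in>K. u i) = 1"
        "y = (\<Sum>i\<in>K. v i *\<^sub>R c i)" "(\<Sum>i\<in>K. v i) = 1" by blast
      then have "r *\<^sub>R x + t *\<^sub>R y = (\<Sum>i\<in>K. (r * u i + t * v i) *\<^sub>R c i)" "(\<Sum>i\<in>K. r * u i + t * v i) = 1"
        using rt by (simp_all add: sum.distrib scaleR_add_left scaleR_sum_right sum_distrib_left[symmetric])
      then show "r *\<^sub>R x + t *\<^sub>R y \<in> {\<Sum>i\<in>K. u i *\<^sub>R c i | u. (\<Sum>i\<in>K. u i) = 1}"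
        unfolding mem_Collect_eq by (intro exI[of _ "\<lambda>i. r * u i + t * v i"] conjI)
    qed
  qed
  show "{\<Sum>i\<in>K. u i *\<^sub>R c i | u. (\<Sum>i\<in>K. u i) = 1} \<subseteq> affine hull (c ` K)"
  proof (safe, goal_cases)
    case (1 _ u)
    \<comment> \<open>The family may repeat points, so the weights of all indices with the same
      point are collected.\<close>
    define v where "v x = (\<Sum>i\<in>{i\<in>K. c i = x}. u i)" for x
    have "(\<Sum>i\<in>K. u i *\<^sub>R c i) = (\<Sum>x\<in>c ` K. \<Sum>i\<in>{i\<in>K. c i = x}. u i *\<^sub>R c i)"
      using K by (rule sum.image_gen)
    also have "\<dots> = (\<Sum>x\<in>c ` K. v x *\<^sub>R x)"
      by (intro sum.cong refl) (simp add: v_def scaleR_sum_left)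
    finally have "(\<Sum>i\<in>K. u i *\<^sub>R c i) = (\<Sum>x\<in>c ` K. v x *\<^sub>R x)" .
    moreover have "(\<Sum>x\<in>c ` K. v x) = 1"
      using 1 sum.image_gen[OF K, of u c] by (simp add: v_def)
    ultimately show ?case
      using K by (auto simp: affine_hull_finite)
  qed
qed

lemma affine_independent_family_iff:
  fixes a :: "'i \<Rightarrow> 'a::real_vector"
  assumes J: "finite J"
  shows "inj_on a J \<and> \<not> affine_dependent (a ` J) \<longleftrightarrow>
    (\<forall>u. (\<Sum>i\<in>J. u i) = 0 \<longrightarrow> (\<Sum>i\<in>J. u i *\<^sub>R a i) = 0 \<longrightarrow> (\<forall>i\<in>J. u i = 0))" (is "?L \<longleftrightarrow> ?R")
proof
  assume L: ?L
  show ?R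
  proof (intro allI impI ballI, rule ccontr)
    fix u i assume u: "(\<Sum>i\<in>J. u i) = 0" "(\<Sum>i\<in>J. u i *\<^sub>R a i) = 0" and i: "i \<in> J" "u i \<noteq> 0"
    have "affine_dependent (a ` J)"
      unfolding affine_dependent_explicit_finite[OF finite_imageI[OF J]]
    proof (intro exI[of _ "u \<circ> inv_into J a"] conjI bexI)
      show "sum (u \<circ> inv_into J a) (a ` J) = 0" "(\<Sum>v\<in>a ` J. (u \<circ> inv_into J a) v *\<^sub>R v) = 0"
        using L u by (simp_all add: sum.reindex cong: sum.cong)
      show "(u \<circ> inv_into J a) (a i) \<noteq> 0" "a i \<in> a ` J" using L i by (auto simp: inv_into_f_f)
    qed
    then show False using L by simp
  qed
next
  assume R: ?R
  have inj: "inj_on a J"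
  proof (rule inj_onI, rule ccontr)
    fix i j assume ij: "i \<in> J" "j \<in> J" "a i = a j" "i \<noteq> j"
    define u where "u k = (if k = i then 1 else 0) - (if k = j then 1 else (0::real))" for k
    have "(\<Sum>k\<in>J. u k) = 0"
      using J ij by (simp add: u_def sum_subtractf)
    moreover have "(\<Sum>k\<in>J. u k *\<^sub>R a k) = 0"
      using J ij by (simp add: u_def sum_subtractf scaleR_diff_left if_distrib[where f="\<lambda>t. t *\<^sub>R _"] cong: if_cong)
    ultimately have "u i = 0" using R ij by blast
    then show False using ij by (simp add: u_def)
  qed
  moreover have "\<not> affine_dependent (a ` J)"
  proof
    assume "affine_dependent (a ` J)"
    then obtain U v where U: "sum U (a ` J) = 0" "v \<in> a ` J" "U v \<noteq> 0" "(\<Sum>v\<in>a ` J. U v *\<^sub>R v) = 0"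
      unfolding affine_dependent_explicit_finite[OF finite_imageI[OF J]] by auto
    have "(\<Sum>i\<in>J. U (a i)) = 0" "(\<Sum>i\<in>J. U (a i) *\<^sub>R a i) = 0"
      using U inj by (simp_all add: sum.reindex)
    then have "\<forall>i\<in>J. U (a i) = 0" using R by (auto dest: spec[of _ "\<lambda>i. U (a i)"])
    then show False using U by auto
  qed
  ultimately show ?L by blast
qed

text \<open>A linear dependence with nonzero coefficient sum could be normalized to an affine
  combination equal to 0. Hence \<open>0\<close> lying off the affine hull upgrades affine to linear
  independence, and d independent vectors span the space.\<close>

lemma affine_independent_linear_combination:
  fixes b :: "nat \<Rightarrow> real ^ 'd"
  assumes J: "finite J" "card J = CARD('d)"
    and ind: "inj_on b J" "\<not> affine_dependent (b ` J)" and 0: "0 \<notin> affine hull (b ` J)"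
  obtains c where "z = (\<Sum>i\<in>J. c i *\<^sub>R b i)"
proof -
  have lin: "\<forall>i\<in>J. u i = 0" if u: "(\<Sum>i\<in>J. u i *\<^sub>R b i) = 0" for u
  proof (cases "(\<Sum>i\<in>J. u i) = 0")
    case True
    then show ?thesis using affine_independent_family_iff[OF J(1), of b] ind u by blast
  next
    case False
    define s where "s = (\<Sum>i\<in>J. u i)"
    have "(\<Sum>i\<in>J. (u i / s) *\<^sub>R b i) = (1 / s) *\<^sub>R (\<Sum>i\<in>J. u i *\<^sub>R b i)"
      by (simp add: scaleR_sum_right)
    then have "(\<Sum>i\<in>J. (u i / s) *\<^sub>R b i) = 0" using u by simp
    moreover have "(\<Sum>i\<in>J. u i / s) = 1" using False by (simp add: s_def flip: sum_divide_distrib)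
    ultimately have "0 \<in> affine hull (b ` J)"
      unfolding affine_hull_image_eq[OF J(1)] by (auto intro!: exI[of _ "\<lambda>i. u i / s"])
    then show ?thesis using 0 by simp
  qed
  have "independent (b ` J)"
    unfolding independent_explicit
  proof (intro conjI allI impI ballI finite_imageI J(1))
    fix U v assume "(\<Sum>v\<in>b ` J. U v *\<^sub>R v) = 0" "v \<in> b ` J"
    then show "U v = 0" using lin[of "\<lambda>i. U (b i)"] ind by (auto simp: sum.reindex)
  qed
  moreover have "card (b ` J) = CARD('d)" using J ind by (simp add: card_image)
  ultimately have "UNIV \<subseteq> span (b ` J)"
    by (intro card_ge_dim_independent) auto
  then have "z \<in> span (b ` J)" by auto
  then obtain U where "z = (\<Sum>v\<in>b ` J. U v *\<^sub>R v)"
    using J by (auto simp: span_finite)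
  then have "z = (\<Sum>i\<in>J. U (b i) *\<^sub>R b i)" using ind by (simp add: sum.reindex)
  then show ?thesis by (rule that)
qed

text \<open>For each fixed \<open>u\<close> the right-hand condition is closed in \<open>b\<close>,
  which gives measurability of the distance test; it also commutes with linear maps, which allows
  rotation and rescaling.\<close>

lemma infdist_affine_hull_image_ge_iff:
  fixes b :: "'i \<Rightarrow> 'a::real_normed_vector"
  assumes J: "finite J" "J \<noteq> {}"
  shows "infdist 0 (affine hull (b ` J)) \<ge> M \<longleftrightarrow> (\<forall>u. (\<Sum>i\<in>J. u i) = 1 \<longrightarrow> norm (\<Sum>i\<in>J. u i *\<^sub>R b i) \<ge> M)"
proof
  assume L: "infdist 0 (affine hull (b ` J)) \<ge> M"
  show "\<forall>u. (\<Sum>i\<in>J. u i) = 1 \<longrightarrow> norm (\<Sum>i\<in>J. u i *\<^sub>R b i) \<ge> M"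
  proof (intro allI impI)
    fix u assume "(\<Sum>i\<in>J. u i) = (1::real)"
    then have "(\<Sum>i\<in>J. u i *\<^sub>R b i) \<in> affine hull (b ` J)" unfolding affine_hull_image_eq[OF J(1)] by blast
    from infdist_le[OF this, of 0] L show "norm (\<Sum>i\<in>J. u i *\<^sub>R b i) \<ge> M" by simp
  qed
next
  assume R: "\<forall>u. (\<Sum>i\<in>J. u i) = 1 \<longrightarrow> norm (\<Sum>i\<in>J. u i *\<^sub>R b i) \<ge> M"
  have ne: "affine hull (b ` J) \<noteq> {}" using J by simp
  show "infdist 0 (affine hull (b ` J)) \<ge> M"
    unfolding infdist_notempty[OF ne]
  proof (rule cINF_greatest[OF ne])
    fix y assume "y \<in> affine hull (b ` J)"
    then show "M \<le> dist 0 y" using R unfolding affine_hull_image_eq[OF J(1)] by auto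
  qed
qed

lemma add_constraints_simps [simp]:
  "i \<le> n \<Longrightarrow> add_constraints n a b i = a i"
  "n < i \<Longrightarrow> add_constraints n a b i = b i"
  by (auto simp: add_constraints_def)

text \<open>The optimal point is the inversion of the foot \<open>y\<close> of the perpendicular
  from 0 to the affine span. All added constraints are tight there, the old ones hold because every
  \<open>a i\<close> is at most as long as \<open>y\<close>, and the cone condition is a dual
  certificate.\<close>

lemma added_constraints_solution:
  fixes a :: "nat \<Rightarrow> real ^ 'd"
  assumes n: "n \<ge> 2"
    and gp: "general_position (n + CARD('d)) (add_constraints n a b)"
    and cone: "z0 \<in> nonneg_cone {n+1..n+CARD('d)} b"
    and dst: "infdist 0 (affine hull (b ` {n+1..n+CARD('d)})) \<ge> Max ((\<lambda>i. norm (a i)) ` {1..n})"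
  shows "lp_solution (n + CARD('d)) (add_constraints n a b) z0 {n+1..n+CARD('d)}"
proof -
  define J where "J = {n+1..n+CARD('d)}"
  define M where "M = Max ((\<lambda>i. norm (a i)) ` {1..n})"
  define A where "A = affine hull (b ` J)"
  define c where "c = add_constraints n a b"
  have cb: "c i = b i" if "i \<in> J" for i using that by (simp add: c_def J_def)
  have J: "finite J" "J \<noteq> {}" "card J = CARD('d)" by (auto simp: J_def)
  have aM: "norm (a i) \<le> M" if "i \<in> {1..n}" for i using that by (simp add: M_def)
  have gpc: "inj_on c K \<and> \<not> affine_dependent (c ` K)" if "K \<subseteq> {1..n + CARD('d)}" "card K \<le> CARD('d) + 1" for K
    using gp that unfolding general_position_def c_def by blast
  \<comment> \<open>Two distinct constraint vectors cannot both vanish, so M > 0, and with it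
    \<open>y \<noteq> 0\<close>.\<close>
  have "inj_on c {1,2}"
    using n by (intro gpc[THEN conjunct1]) (auto simp: card_insert_if)
  then have "c 1 \<noteq> c 2" by (simp add: inj_on_def)
  then have "a 1 \<noteq> a 2" using n by (simp add: c_def)
  then have "norm (a 1) + norm (a 2) > 0" by (cases "a 1 = 0") (auto intro: add_pos_nonneg)
  moreover have "norm (a 1) \<le> M" "norm (a 2) \<le> M" using aM n by auto
  ultimately have M: "M > 0" by linarith
  have A: "closed A" "A \<noteq> {}" "convex A" "affine A" using J by (auto simp: A_def affine_imp_convex)
  define y where "y = closest_point A 0"
  have yA: "y \<in> A" and ymin: "\<forall>w\<in>A. dist 0 y \<le> dist 0 w"
    unfolding y_def using closest_point_exists[OF A(1,2), of 0] by auto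
  have yM: "norm y \<ge> M"
    using infdist_le[OF yA, of 0] dst by (simp add: A_def J_def M_def)
  then have y0: "norm y > 0" using M by linarith
  have yw: "y \<bullet> w = (norm y)\<^sup>2" if w: "w \<in> A" for w
  proof -
    \<comment> \<open>The reflection of \<open>w\<close> in \<open>y\<close> also lies in
      \<open>A\<close>; the variational inequality at both points becomes an equality.\<close>
    have "2 *\<^sub>R y - w \<in> A"
      using mem_affine[OF A(4) yA w, of 2 "-1"] by (simp add: algebra_simps)
    from any_closest_point_dot[OF A(3,1) yA this ymin] any_closest_point_dot[OF A(3,1) yA w ymin]
    show ?thesis by (simp add: inner_diff_right power2_norm_eq_inner scaleR_2 inner_add_right)
  qed
  define x where "x = (1 / (norm y)\<^sup>2) *\<^sub>R y"
  have xA: "w \<bullet> x = 1" if "w \<in> A" for w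
    using yw[OF that] y0 by (simp add: x_def inner_commute)
  have nx: "norm x = 1 / norm y"
    using y0 by (simp add: x_def power2_eq_square)
  have bx: "b i \<bullet> x = 1" if "i \<in> J" for i
    using that by (intro xA) (auto simp: A_def hull_inc)
  have ax: "a i \<bullet> x \<le> 1" if "i \<in> {1..n}" for i
  proof -
    have "a i \<bullet> x \<le> norm (a i) * norm x" by (rule norm_cauchy_schwarz)
    also have "\<dots> \<le> M * (1 / M)"
      unfolding nx using aM[OF that] yM M by (intro mult_mono frac_le) auto
    finally show ?thesis using M by simp
  qed
  \<comment> \<open>The norm estimate leaves equality possible. But a tight old constraint would put
    d + 1 affinely independent vectors into the hyperplane of points with inner product 1 with
    \<open>x\<close>, which misses the origin.\<close>
  have ax1: "a i \<bullet> x \<noteq> 1" if i: "i \<in> {1..n}" for i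
  proof
    assume eq: "a i \<bullet> x = 1"
    have iJ: "i \<notin> J" using i by (auto simp: J_def)
    have sub: "insert i J \<subseteq> {1..n + CARD('d)}" using i by (auto simp: J_def)
    have cJ: "card (insert i J) = CARD('d) + 1" using iJ J by simp
    have gp': "inj_on c (insert i J)" "\<not> affine_dependent (c ` insert i J)"
      using gpc[OF sub] cJ by simp_all
    have "int (card (c ` insert i J)) = aff_dim (c ` insert i J) + 1"
      by (rule aff_dim_affine_independent[OF gp'(2)])
    then have "aff_dim (c ` insert i J) = DIM(real^'d)"
      using card_image[OF gp'(1)] cJ by simp
    then have "affine hull (c ` insert i J) = UNIV" by (simp only: aff_dim_eq_full)
    moreover have "affine hull (c ` insert i J) \<subseteq> {w. x \<bullet> w = 1}"
    proof (rule hull_minimal)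
      have "c i = a i" using i by (simp add: c_def)
      then show "c ` insert i J \<subseteq> {w. x \<bullet> w = 1}"
        using eq bx cb by (auto simp: inner_commute)
    qed (rule affine_hyperplane)
    ultimately have "0 \<in> {w. x \<bullet> w = 1}" by blast
    then show False by simp
  qed
  have feas: "x \<in> lp_feasible (n + CARD('d)) c"
    unfolding lp_feasible_def
  proof safe
    fix i assume i: "i \<in> {1..n + CARD('d)}"
    show "c i \<bullet> x \<le> 1"
      using i ax[of i] bx[of i] by (cases "i \<le> n") (auto simp: c_def J_def)
  qed
  obtain k where k: "\<forall>i\<in>J. 0 \<le> k i" "z0 = (\<Sum>i\<in>J. k i *\<^sub>R b i)"
    using cone unfolding nonneg_cone_def J_def by auto
  \<comment> \<open>Weak duality: a nonnegative combination of constraints that are all tight at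
    \<open>x\<close>.\<close>
  have opt: "z0 \<bullet> w \<le> z0 \<bullet> x" if w: "w \<in> lp_feasible (n + CARD('d)) c" for w
  proof -
    have "b i \<bullet> w \<le> 1" if "i \<in> J" for i
      using w that cb[OF that, symmetric] by (simp add: lp_feasible_def J_def)
    then have "(\<Sum>i\<in>J. k i * (b i \<bullet> w)) \<le> (\<Sum>i\<in>J. k i * (b i \<bullet> x))"
      using k bx by (intro sum_mono mult_left_mono) auto
    then show ?thesis by (simp add: k inner_sum_left)
  qed
  have "J = {i \<in> {1..n + CARD('d)}. c i \<bullet> x = 1}"
  proof (intro equalityI subsetI)
    fix i assume "i \<in> J"
    then show "i \<in> {i \<in> {1..n + CARD('d)}. c i \<bullet> x = 1}" using bx cb by (auto simp: J_def)
  next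
    fix i assume i: "i \<in> {i \<in> {1..n + CARD('d)}. c i \<bullet> x = 1}"
    then show "i \<in> J" using ax1[of i] by (cases "i \<le> n") (auto simp: c_def J_def)
  qed
  with feas opt show ?thesis
    unfolding lp_solution_def lp_optimal_def c_def J_def by blast
qed

section \<open>Perturbed regular simplices\<close>

lemma norm_sum_scaleR_sq_le:
  fixes x :: "'i \<Rightarrow> 'a::real_normed_vector"
  shows "(norm (\<Sum>i\<in>J. c i *\<^sub>R x i))\<^sup>2 \<le> (\<Sum>i\<in>J. (c i)\<^sup>2) * (\<Sum>i\<in>J. (norm (x i))\<^sup>2)"
proof -
  have "norm (\<Sum>i\<in>J. c i *\<^sub>R x i) \<le> (\<Sum>i\<in>J. \<bar>c i\<bar> * norm (x i))"
    by (rule order_trans[OF norm_sum]) simp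
  then have "(norm (\<Sum>i\<in>J. c i *\<^sub>R x i))\<^sup>2 \<le> (\<Sum>i\<in>J. \<bar>c i\<bar> * norm (x i))\<^sup>2"
    by (intro power_mono) auto
  also have "\<dots> \<le> (\<Sum>i\<in>J. \<bar>c i\<bar>\<^sup>2) * (\<Sum>i\<in>J. (norm (x i))\<^sup>2)"
    by (rule Cauchy_Schwarz_ineq_sum)
  finally show ?thesis by simp
qed

text \<open>The other entries sum to \<open>- t i\<close>; Cauchy-Schwarz on them gains the factor
  (d-1)/d over the trivial bound, which is the gap between inradius and circumradius needed for the
  cone criterion.\<close>

lemma square_le_of_sum_zero:
  fixes t :: "'i \<Rightarrow> real"
  assumes J: "finite J" "i \<in> J" and t: "(\<Sum>j\<in>J. t j) = 0"
  shows "card J * (t i)\<^sup>2 \<le> (real (card J) - 1) * (\<Sum>j\<in>J. (t j)\<^sup>2)"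
proof -
  have "t i = - (\<Sum>j\<in>J - {i}. t j)" using t sum.remove[OF J, of t] by simp
  then have "(t i)\<^sup>2 = (\<Sum>j\<in>J - {i}. 1 * t j)\<^sup>2" by simp
  also have "\<dots> \<le> (\<Sum>j\<in>J - {i}. 1\<^sup>2) * (\<Sum>j\<in>J - {i}. (t j)\<^sup>2)" by (rule Cauchy_Schwarz_ineq_sum)
  also have "\<dots> = (real (card J) - 1) * ((\<Sum>j\<in>J. (t j)\<^sup>2) - (t i)\<^sup>2)"
  proof -
    have "card J \<ge> 1" using J by (metis One_nat_def Suc_leI card_gt_0_iff empty_iff)
    then show ?thesis using J sum.remove[OF J, of "\<lambda>j. (t j)\<^sup>2"] by simp
  qed
  finally show ?thesis by (simp add: algebra_simps)
qed

text \<open>The \<open>f i\<close> are the centred vertices. Their Gram matrix is \<open>K\<close>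
  times the projection orthogonal to the all-ones vector, so combinations of the \<open>f i\<close>
  see coefficients only up to an additive constant. Radius l corresponds to K = l^2 d/(d-1).\<close>

locale simplex_frame =
  fixes J :: "nat set" and f :: "nat \<Rightarrow> real ^ 'd" and \<zeta> :: "real ^ 'd" and K :: real
  assumes finJ: "finite J" and cardJ: "card J = CARD('d)" and dim2: "CARD('d) \<ge> 2"
    and K: "K > 0" and \<zeta>: "norm \<zeta> = 1"
    and orth: "\<And>i. i \<in> J \<Longrightarrow> f i \<bullet> \<zeta> = 0"
    and sum0: "(\<Sum>i\<in>J. f i) = 0"
    and gram: "\<And>i j. i \<in> J \<Longrightarrow> j \<in> J \<Longrightarrow> f i \<bullet> f j = K * ((if i = j then 1 else 0) - 1 / CARD('d))"
begin

lemma inner_\<zeta>: "\<zeta> \<bullet> \<zeta> = 1" using \<zeta> by (simp add: norm_eq_1)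

lemma orth': "i \<in> J \<Longrightarrow> \<zeta> \<bullet> f i = 0" using orth[of i] by (simp add: inner_commute)

lemma comb_inner:
  assumes i: "i \<in> J"
  shows "(\<Sum>j\<in>J. c j *\<^sub>R f j) \<bullet> f i = K * (c i - (\<Sum>j\<in>J. c j) / CARD('d))"
proof -
  have "(\<Sum>j\<in>J. c j *\<^sub>R f j) \<bullet> f i = (\<Sum>j\<in>J. K * ((if j = i then c j else 0) - c j / CARD('d)))"
    unfolding inner_sum_left using i by (intro sum.cong) (auto simp: gram algebra_simps)
  also have "\<dots> = K * (c i - (\<Sum>j\<in>J. c j) / CARD('d))"
    using i finJ by (simp add: sum_distrib_left[symmetric] sum_subtractf sum_divide_distrib)
  finally show ?thesis .
qed

lemma comb_norm:
  "(norm (\<Sum>j\<in>J. c j *\<^sub>R f j))\<^sup>2 = K * ((\<Sum>j\<in>J. (c j)\<^sup>2) - (\<Sum>j\<in>J. c j)\<^sup>2 / CARD('d))"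
proof -
  have "(norm (\<Sum>j\<in>J. c j *\<^sub>R f j))\<^sup>2 = (\<Sum>i\<in>J. c i * ((\<Sum>j\<in>J. c j *\<^sub>R f j) \<bullet> f i))"
    by (simp add: power2_norm_eq_inner inner_sum_right)
  also have "\<dots> = (\<Sum>i\<in>J. K * ((c i)\<^sup>2 - (\<Sum>j\<in>J. c j) / CARD('d) * c i))"
    by (intro sum.cong refl) (simp add: comb_inner power2_eq_square algebra_simps)
  also have "\<dots> = K * ((\<Sum>j\<in>J. (c j)\<^sup>2) - (\<Sum>j\<in>J. c j)\<^sup>2 / CARD('d))"
    unfolding sum_distrib_left[symmetric] sum_subtractf power2_eq_square by simp
  finally show ?thesis .
qed

text \<open>With \<open>w\<close> the sum of the \<open>(p \<bullet> f i) *\<^sub>R f i\<close>, the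
  left side X equals \<open>q \<bullet> w\<close>, where \<open>q\<close> is the part of
  \<open>p\<close> orthogonal to \<open>\<zeta>\<close>. The Gram matrix gives norm squared K X for
  \<open>w\<close>, and Cauchy-Schwarz finishes.\<close>

lemma frame_bound: "(\<Sum>i\<in>J. (p \<bullet> f i)\<^sup>2) \<le> K * ((norm p)\<^sup>2 - (p \<bullet> \<zeta>)\<^sup>2)"
proof -
  define q where "q = p - (p \<bullet> \<zeta>) *\<^sub>R \<zeta>"
  define X where "X = (\<Sum>i\<in>J. (p \<bullet> f i)\<^sup>2)"
  define w where "w = (\<Sum>i\<in>J. (p \<bullet> f i) *\<^sub>R f i)"
  have nq: "(norm q)\<^sup>2 = (norm p)\<^sup>2 - (p \<bullet> \<zeta>)\<^sup>2"
    unfolding q_def power2_norm_eq_inner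
    by (simp add: inner_diff_left inner_diff_right inner_\<zeta> inner_commute power2_eq_square)
  have qf: "q \<bullet> f i = p \<bullet> f i" if "i \<in> J" for i
    using orth'[OF that] by (simp add: q_def inner_diff_left)
  have X: "X = q \<bullet> w"
    unfolding X_def w_def inner_sum_right by (intro sum.cong refl) (simp add: qf power2_eq_square)
  have s0: "(\<Sum>i\<in>J. p \<bullet> f i) = 0" using sum0 by (simp flip: inner_sum_right)
  have w: "(norm w)\<^sup>2 = K * X" unfolding w_def comb_norm s0 by (simp add: X_def)
  have X0: "X \<ge> 0" by (simp add: X_def sum_nonneg)
  have "X\<^sup>2 \<le> (norm q)\<^sup>2 * (norm w)\<^sup>2"
    unfolding X using Cauchy_Schwarz_ineq[of q w] by (simp add: power2_norm_eq_inner)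
  then have "X * X \<le> (K * (norm q)\<^sup>2) * X" unfolding w by (simp add: power2_eq_square mult_ac)
  then have "X \<le> K * (norm q)\<^sup>2" using X0 K
    by (cases "X = 0") (auto simp: mult_le_cancel_right)
  then show ?thesis by (simp add: X_def nq)
qed

text \<open>Inner products with the \<open>f j\<close> control the deviations \<open>t j\<close>
  from the mean coefficient, those with \<open>\<zeta>\<close> the sign of the mean. The bound on
  the orthogonal noise is just what confines each deviation to the size of the mean.\<close>

lemma cone_coeffs_nonneg:
  fixes \<sigma> :: real
  assumes rep: "\<zeta> = (\<Sum>i\<in>J. c i *\<^sub>R (\<zeta> + f i + \<sigma> *\<^sub>R g i))"
    and S: "CARD('d) * \<sigma>\<^sup>2 * (\<Sum>i\<in>J. (norm (g i))\<^sup>2 - (g i \<bullet> \<zeta>)\<^sup>2) \<le> K"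
    and pos: "\<And>i. i \<in> J \<Longrightarrow> 1 + \<sigma> * (g i \<bullet> \<zeta>) > 0"
    and i: "i \<in> J"
  shows "c i \<ge> 0"
proof -
  define d where "d = real CARD('d)"
  have d: "d \<ge> 2" using dim2 by (simp add: d_def)
  define \<gamma> where "\<gamma> = (\<Sum>j\<in>J. c j)"
  define t where "t j = c j - \<gamma> / d" for j
  define m where "m = (\<Sum>j\<in>J. (t j)\<^sup>2)"
  define p where "p = (\<Sum>j\<in>J. c j *\<^sub>R g j)"
  define S where "S = (\<Sum>i\<in>J. (norm (g i))\<^sup>2 - (g i \<bullet> \<zeta>)\<^sup>2)"
  define C where "C = (\<Sum>j\<in>J. (c j)\<^sup>2)"
  have rep': "\<zeta> = \<gamma> *\<^sub>R \<zeta> + (\<Sum>j\<in>J. c j *\<^sub>R f j) + \<sigma> *\<^sub>R p"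
    by (subst rep) (simp add: \<gamma>_def p_def scaleR_add_right sum.distrib scaleR_sum_left scaleR_sum_right mult.commute)
  \<comment> \<open>The target \<open>\<zeta>\<close> is orthogonal to \<open>f j\<close>, so the
    deviation must cancel the noise.\<close>
  have Kt: "K * t j = - \<sigma> * (p \<bullet> f j)" if "j \<in> J" for j
  proof -
    have "0 = \<zeta> \<bullet> f j" using orth[OF that] by (simp add: inner_commute)
    also have "\<dots> = (\<gamma> *\<^sub>R \<zeta> + (\<Sum>j\<in>J. c j *\<^sub>R f j) + \<sigma> *\<^sub>R p) \<bullet> f j" by (subst rep') simp
    also have "\<dots> = K * t j + \<sigma> * (p \<bullet> f j)"
      using orth'[OF that] comb_inner[OF that, of c] by (simp add: inner_add_left t_def \<gamma>_def d_def)
    finally show ?thesis by simp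
  qed
  have sumt: "(\<Sum>j\<in>J. t j) = 0"
    using cardJ dim2 by (simp add: t_def sum_subtractf \<gamma>_def d_def)
  have C: "C = \<gamma>\<^sup>2 / d + m"
  proof -
    have "C = (\<Sum>j\<in>J. (t j)\<^sup>2 + (2 * \<gamma> / d) * t j + (\<gamma> / d)\<^sup>2)"
      unfolding C_def t_def using d by (intro sum.cong refl) (simp add: power2_eq_square field_simps)
    also have "\<dots> = m + (2 * \<gamma> / d) * (\<Sum>j\<in>J. t j) + d * (\<gamma> / d)\<^sup>2"
      by (simp add: sum.distrib m_def cardJ d_def sum_distrib_left)
    finally show ?thesis using d by (simp add: sumt power2_eq_square)
  qed
  have perp: "(norm p)\<^sup>2 - (p \<bullet> \<zeta>)\<^sup>2 \<le> C * S"
  proof -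
    define h where "h x = x - (x \<bullet> \<zeta>) *\<^sub>R \<zeta>" for x
    have nh: "(norm (h x))\<^sup>2 = (norm x)\<^sup>2 - (x \<bullet> \<zeta>)\<^sup>2" for x
      unfolding h_def power2_norm_eq_inner
      by (simp add: inner_diff_left inner_diff_right inner_\<zeta> inner_commute power2_eq_square)
    have hp: "h p = (\<Sum>j\<in>J. c j *\<^sub>R h (g j))"
      by (simp add: h_def p_def scaleR_diff_right sum_subtractf inner_sum_left scaleR_sum_left)
    have "(norm (h p))\<^sup>2 \<le> C * (\<Sum>j\<in>J. (norm (h (g j)))\<^sup>2)"
      unfolding hp C_def by (rule norm_sum_scaleR_sq_le)
    then show ?thesis by (simp add: nh S_def)
  qed
  have S0: "d * \<sigma>\<^sup>2 * S \<le> K" using S by (simp add: S_def d_def)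
  have C0: "C \<ge> 0" by (simp add: C_def sum_nonneg)
  have "K\<^sup>2 * m = (\<Sum>j\<in>J. (K * t j)\<^sup>2)" by (simp add: m_def sum_distrib_left power_mult_distrib)
  also have "\<dots> = \<sigma>\<^sup>2 * (\<Sum>j\<in>J. (p \<bullet> f j)\<^sup>2)"
    unfolding sum_distrib_left by (intro sum.cong refl) (simp add: Kt power_mult_distrib)
  also have "\<dots> \<le> \<sigma>\<^sup>2 * (K * (C * S))"
    using K by (intro mult_left_mono order_trans[OF frame_bound] perp) auto
  finally have "d * (K\<^sup>2 * m) \<le> d * (\<sigma>\<^sup>2 * (K * (C * S)))" using d by (intro mult_left_mono) auto
  also have "\<dots> = (d * \<sigma>\<^sup>2 * S) * (K * C)" by (simp add: mult_ac)
  also have "\<dots> \<le> K * (K * C)" using S0 C0 K by (intro mult_right_mono) auto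
  finally have "d * m \<le> C" using K by (simp add: power2_eq_square mult_ac)
  \<comment> \<open>The bound on \<open>m\<close> involves \<open>C\<close>, which contains
    \<open>m\<close> itself; substituting C = \<gamma>^2/d + m resolves the circularity.\<close>
  then have dm: "(d - 1) * m \<le> \<gamma>\<^sup>2 / d" by (simp add: C algebra_simps)
  have bound: "\<bar>t j\<bar> \<le> \<bar>\<gamma>\<bar> / d" if j: "j \<in> J" for j
  proof -
    have "d * (t j)\<^sup>2 \<le> (d - 1) * m"
      using square_le_of_sum_zero[OF finJ j sumt] by (simp add: cardJ d_def m_def)
    with dm have "d * (t j)\<^sup>2 \<le> \<gamma>\<^sup>2 / d" by linarith
    then have "(t j)\<^sup>2 \<le> (\<gamma> / d)\<^sup>2" using d by (simp add: power2_eq_square field_simps)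
    then have "\<bar>t j\<bar> \<le> \<bar>\<gamma> / d\<bar>" by (simp only: abs_le_square_iff)
    then show ?thesis using d by simp
  qed
  have g1: "1 = (\<Sum>j\<in>J. c j * (1 + \<sigma> * (g j \<bullet> \<zeta>)))"
  proof -
    have "1 = \<zeta> \<bullet> \<zeta>" by (simp add: inner_\<zeta>)
    also have "\<dots> = (\<Sum>j\<in>J. c j *\<^sub>R (\<zeta> + f j + \<sigma> *\<^sub>R g j)) \<bullet> \<zeta>" by (subst (1) rep) simp
    also have "\<dots> = (\<Sum>j\<in>J. c j * (1 + \<sigma> * (g j \<bullet> \<zeta>)))"
      unfolding inner_sum_left by (intro sum.cong refl) (simp add: inner_add_left inner_\<zeta> orth)
    finally show ?thesis .
  qed
  \<comment> \<open>All coefficients share the sign of \<open>\<gamma>\<close>; a nonpositive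
    \<open>\<gamma>\<close> would contradict the component along \<open>\<zeta>\<close>, where the
    combination has to equal 1.\<close>
  have "\<gamma> > 0"
  proof (rule ccontr)
    assume "\<not> \<gamma> > 0"
    then have "c j \<le> 0" if "j \<in> J" for j
      using bound[OF that] by (simp add: t_def abs_le_iff)
    then have "(\<Sum>j\<in>J. c j * (1 + \<sigma> * (g j \<bullet> \<zeta>))) \<le> 0"
      using pos by (intro sum_nonpos mult_nonpos_nonneg) (auto intro: less_imp_le)
    with g1 show False by simp
  qed
  then show ?thesis using bound[OF i] by (simp add: t_def abs_le_iff)
qed

text \<open>Spreading the weights lengthens the noiseless point, whose squared norm is 1 + s^2,
  while the noise grows at most like 0.86 (0.01 + s). Comparing the two linearly in s leaves 0.51 -
  0.0086 > 1/2.\<close>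

lemma affine_comb_norm_ge:
  fixes \<sigma> :: real
  assumes T: "\<sigma>\<^sup>2 * (\<Sum>i\<in>J. (norm (g i))\<^sup>2) \<le> (86/100)\<^sup>2 * K"
    and Kd: "K \<le> CARD('d) * (1/100)\<^sup>2"
    and u: "(\<Sum>i\<in>J. u i) = 1"
  shows "norm (\<Sum>i\<in>J. u i *\<^sub>R (\<zeta> + f i + \<sigma> *\<^sub>R g i)) \<ge> 1/2"
proof -
  define d where "d = real CARD('d)"
  have d: "d \<ge> 2" using dim2 by (simp add: d_def)
  define F where "F = (\<Sum>i\<in>J. u i *\<^sub>R f i)"
  define G where "G = (\<Sum>i\<in>J. u i *\<^sub>R g i)"
  define m where "m = (\<Sum>i\<in>J. (u i)\<^sup>2) - 1 / d"
  have eq: "(\<Sum>i\<in>J. u i *\<^sub>R (\<zeta> + f i + \<sigma> *\<^sub>R g i)) = (\<zeta> + F) + \<sigma> *\<^sub>R G"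
  proof -
    have "(\<Sum>i\<in>J. u i *\<^sub>R (\<zeta> + f i + \<sigma> *\<^sub>R g i)) = (\<Sum>i\<in>J. u i *\<^sub>R \<zeta>) + F + \<sigma> *\<^sub>R G"
      by (simp add: F_def G_def scaleR_add_right sum.distrib scaleR_sum_right mult.commute)
    then show ?thesis using u by (simp flip: scaleR_sum_left)
  qed
  have F: "(norm F)\<^sup>2 = K * m" unfolding F_def comb_norm u m_def d_def by simp
  then have "0 \<le> K * m" using zero_le_power2[of "norm F"] by simp
  then have m0: "m \<ge> 0" using K by (simp add: zero_le_mult_iff)
  define s where "s = sqrt (K * m)"
  have s: "s \<ge> 0" "s\<^sup>2 = K * m" using K m0 by (auto simp: s_def)
  have "F \<bullet> \<zeta> = 0" unfolding F_def inner_sum_left by (intro sum.neutral) (simp add: orth)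
  then have n1: "(norm (\<zeta> + F))\<^sup>2 = 1 + s\<^sup>2"
    unfolding s(2) F[symmetric] power2_norm_eq_inner
    by (simp add: inner_add_left inner_add_right inner_\<zeta> inner_commute)
  \<comment> \<open>Cauchy-Schwarz with a nearly unit vector: 0.51^2 + 0.86^2 = 0.9997.\<close>
  have "(51/100 + (86/100) * s)\<^sup>2 \<le> 1 + s\<^sup>2"
  proof -
    have "0 \<le> ((51/100) * s - 86/100)\<^sup>2" "0 \<le> s\<^sup>2" by simp_all
    moreover have "((51/100) * s - 86/100)\<^sup>2 = 2601/10000 * s\<^sup>2 - 8772/10000 * s + 7396/10000"
      "(51/100 + (86/100) * s)\<^sup>2 = 2601/10000 + 8772/10000 * s + 7396/10000 * s\<^sup>2"
      by (simp_all add: power2_eq_square algebra_simps)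
    ultimately show ?thesis by linarith
  qed
  then have A: "norm (\<zeta> + F) \<ge> 51/100 + (86/100) * s"
    unfolding n1[symmetric] by (rule power2_le_imp_le) simp
  have "(norm (\<sigma> *\<^sub>R G))\<^sup>2 \<le> \<sigma>\<^sup>2 * ((\<Sum>i\<in>J. (u i)\<^sup>2) * (\<Sum>i\<in>J. (norm (g i))\<^sup>2))"
    unfolding norm_scaleR power_mult_distrib G_def
    by (simp add: mult_left_mono norm_sum_scaleR_sq_le)
  also have "\<dots> = (\<Sum>i\<in>J. (u i)\<^sup>2) * (\<sigma>\<^sup>2 * (\<Sum>i\<in>J. (norm (g i))\<^sup>2))" by (simp add: mult_ac)
  also have "\<dots> \<le> (\<Sum>i\<in>J. (u i)\<^sup>2) * ((86/100)\<^sup>2 * K)"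
    by (intro mult_left_mono T) (simp add: sum_nonneg)
  also have "\<dots> = (86/100)\<^sup>2 * (K / d + s\<^sup>2)" unfolding s(2) m_def by (simp add: right_diff_distrib)
  also have "\<dots> \<le> (86/100)\<^sup>2 * ((1/100)\<^sup>2 + s\<^sup>2)"
  proof (intro mult_left_mono add_right_mono)
    show "K / d \<le> (1/100)\<^sup>2" using Kd d by (simp add: d_def pos_divide_le_eq mult.commute)
  qed simp
  also have "\<dots> \<le> (86/100 * (1/100 + s))\<^sup>2"
    unfolding power_mult_distrib using s by (intro mult_left_mono) (auto simp: power2_sum)
  finally have B: "norm (\<sigma> *\<^sub>R G) \<le> 86/100 * (1/100 + s)"
    by (rule power2_le_imp_le) (use s in auto)
  have "norm ((\<zeta> + F) + \<sigma> *\<^sub>R G) \<ge> norm (\<zeta> + F) - norm (\<sigma> *\<^sub>R G)"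
    by (rule norm_diff_ineq)
  then show ?thesis unfolding eq using A B by simp
qed

text \<open>With two opposite vertices, testing against \<open>f i\<close> gives one equation
  between the coefficients. Its two factors are positive under a one-sided bound on the components
  \<open>g k \<bullet> f k\<close>, so both coefficients have the same sign, and the component along
  \<open>\<zeta>\<close> makes it positive.\<close>

lemma planar_cone_coeffs_nonneg:
  assumes J2: "J = {i, j}" "i \<noteq> j"
    and rep: "\<zeta> = (\<Sum>k\<in>J. c k *\<^sub>R (\<zeta> + f k + \<sigma> *\<^sub>R g k))"
    and S: "\<And>k. k \<in> J \<Longrightarrow> \<sigma> * (g k \<bullet> f k) > - (K / 2)"
    and pos: "\<And>k. k \<in> J \<Longrightarrow> 1 + \<sigma> * (g k \<bullet> \<zeta>) > 0"
    and k: "k \<in> J"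
  shows "c k \<ge> 0"
proof -
  have ij: "i \<in> J" "j \<in> J" using J2 by auto
  have d2: "CARD('d) = 2" using cardJ J2 by simp
  have fj: "f j = - f i" using sum0 J2 by (simp add: add_eq_0_iff)
  have nf: "f i \<bullet> f i = K / 2" using gram[OF ij(1,1)] d2 by simp
  have z0: "\<zeta> \<bullet> f i = 0" using orth[OF ij(1)] by (simp add: inner_commute)
  have rep2: "\<zeta> = c i *\<^sub>R (\<zeta> + f i + \<sigma> *\<^sub>R g i) + c j *\<^sub>R (\<zeta> - f i + \<sigma> *\<^sub>R g j)"
    using rep J2 fj by simp
  have "0 = (c i *\<^sub>R (\<zeta> + f i + \<sigma> *\<^sub>R g i) + c j *\<^sub>R (\<zeta> - f i + \<sigma> *\<^sub>R g j)) \<bullet> f i"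
    by (subst rep2[symmetric]) (simp add: z0)
  also have "\<dots> = c i * (K / 2 + \<sigma> * (g i \<bullet> f i)) - c j * (K / 2 + \<sigma> * (g j \<bullet> f j))"
    by (simp add: inner_add_left inner_diff_left z0 nf fj algebra_simps)
  finally have e1: "c i * (K / 2 + \<sigma> * (g i \<bullet> f i)) = c j * (K / 2 + \<sigma> * (g j \<bullet> f j))" by simp
  have "1 = \<zeta> \<bullet> \<zeta>" by (simp add: inner_\<zeta>)
  also have "\<dots> = (c i *\<^sub>R (\<zeta> + f i + \<sigma> *\<^sub>R g i) + c j *\<^sub>R (\<zeta> - f i + \<sigma> *\<^sub>R g j)) \<bullet> \<zeta>"
    by (subst (1) rep2) simp
  also have "\<dots> = c i * (1 + \<sigma> * (g i \<bullet> \<zeta>)) + c j * (1 + \<sigma> * (g j \<bullet> \<zeta>))"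
    using orth[OF ij(1)] by (simp add: inner_\<zeta> inner_left_distrib inner_diff_left)
  finally have e2: "1 = c i * (1 + \<sigma> * (g i \<bullet> \<zeta>)) + c j * (1 + \<sigma> * (g j \<bullet> \<zeta>))" .
  have P: "K / 2 + \<sigma> * (g i \<bullet> f i) > 0" "K / 2 + \<sigma> * (g j \<bullet> f j) > 0" using S[OF ij(1)] S[OF ij(2)] by auto
  have "c i > 0 \<longleftrightarrow> c i * (K / 2 + \<sigma> * (g i \<bullet> f i)) > 0" using P by (simp add: zero_less_mult_iff)
  also have "\<dots> \<longleftrightarrow> c j > 0" unfolding e1 using P by (simp add: zero_less_mult_iff)
  finally have same: "c i > 0 \<longleftrightarrow> c j > 0" .
  have "c i > 0"
  proof (rule ccontr)
    assume n: "\<not> c i > 0"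
    then have "c i * (1 + \<sigma> * (g i \<bullet> \<zeta>)) \<le> 0" "c j * (1 + \<sigma> * (g j \<bullet> \<zeta>)) \<le> 0"
      using same pos[OF ij(1)] pos[OF ij(2)] by (auto intro!: mult_nonpos_nonneg)
    then show False using e2 by linarith
  qed
  with same k J2 show ?thesis by auto
qed

text \<open>In the basis of \<open>\<zeta>\<close> and \<open>e\<close>, the line through the two
  points has slope at most 3/2 and passes within a small error of \<open>\<zeta>\<close>. A line of
  slope 3/2 through \<open>\<zeta>\<close> has distance 2/sqrt 13 > 0.55 from the origin, which
  leaves room for the error.\<close>

lemma planar_affine_comb_norm_ge:
  assumes J2: "J = {i, j}" "i \<noteq> j" and l: "l > 0" "K = 2 * l\<^sup>2" "l \<le> 1/100" and \<sigma>: "\<sigma> > 0"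
    and slope: "\<bar>\<sigma> * ((g i - g j) \<bullet> \<zeta>)\<bar> \<le> 3/2 * (2 * l + \<sigma> * ((g i - g j) \<bullet> (f i /\<^sub>R l)))"
    and small: "\<And>k. k \<in> J \<Longrightarrow> \<sigma> * norm (g k) \<le> 3 * l"
    and u: "(\<Sum>i\<in>J. u i) = 1"
  shows "norm (\<Sum>k\<in>J. u k *\<^sub>R (\<zeta> + f k + \<sigma> *\<^sub>R g k)) \<ge> 1/2"
proof -
  have ij: "i \<in> J" "j \<in> J" using J2 by auto
  have d2: "CARD('d) = 2" using cardJ J2 by simp
  have fj: "f j = - f i" using sum0 J2 by (simp add: add_eq_0_iff)
  define e where "e = f i /\<^sub>R l"
  have fi: "f i = l *\<^sub>R e" using l by (simp add: e_def)
  have "f i \<bullet> f i = l\<^sup>2" using gram[OF ij(1,1)] d2 l by simp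
  then have ee: "e \<bullet> e = 1" using l by (simp add: e_def power2_eq_square field_simps)
  have ez: "e \<bullet> \<zeta> = 0" using orth[OF ij(1)] by (simp add: e_def)
  define y where "y = (\<Sum>k\<in>J. u k *\<^sub>R (\<zeta> + f k + \<sigma> *\<^sub>R g k))"
  define t where "t = u i - 1/2"
  have ui: "u i = 1/2 + t" "u j = 1/2 - t" using u J2 by (auto simp: t_def)
  define h where "h = (1/2) *\<^sub>R (g i + g j)"
  define A where "A = \<sigma> * ((g i - g j) \<bullet> \<zeta>)"
  define B where "B = 2 * l + \<sigma> * ((g i - g j) \<bullet> e)"
  have y: "y = \<zeta> + \<sigma> *\<^sub>R h + t *\<^sub>R (2 *\<^sub>R l *\<^sub>R e + \<sigma> *\<^sub>R (g i - g j))"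
  proof -
    have "y = u i *\<^sub>R (\<zeta> + l *\<^sub>R e + \<sigma> *\<^sub>R g i) + u j *\<^sub>R (\<zeta> - l *\<^sub>R e + \<sigma> *\<^sub>R g j)"
      using J2 fj fi by (simp add: y_def)
    also have "\<dots> = \<zeta> + \<sigma> *\<^sub>R h + t *\<^sub>R (2 *\<^sub>R l *\<^sub>R e + \<sigma> *\<^sub>R (g i - g j))"
      unfolding ui h_def vec_eq_iff vector_add_component vector_minus_component vector_scaleR_component
      by (intro allI) (simp add: field_simps)
    finally show ?thesis .
  qed
  have y1: "y \<bullet> \<zeta> = 1 + \<sigma> * (h \<bullet> \<zeta>) + t * A"
    unfolding y A_def by (simp add: inner_add_left inner_diff_left inner_\<zeta> ez)
  have y2: "y \<bullet> e = \<sigma> * (h \<bullet> e) + t * B"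
    unfolding y B_def using ez by (simp add: inner_add_left inner_diff_left ee inner_commute[of \<zeta>])
  have AB: "\<bar>A\<bar> \<le> 3/2 * B" using slope by (simp add: A_def B_def e_def)
  have ne: "norm e = 1" using ee by (simp add: norm_eq_1)
  have "norm h \<le> (norm (g i) + norm (g j)) / 2"
    unfolding h_def using norm_triangle_ineq[of "g i" "g j"] by simp
  then have "\<sigma> * norm h \<le> (\<sigma> * norm (g i) + \<sigma> * norm (g j)) / 2"
    using mult_left_mono[of "norm h" "(norm (g i) + norm (g j)) / 2" \<sigma>] \<sigma> by (simp add: distrib_left)
  then have hs: "\<sigma> * norm h \<le> 3 / 100" using small[OF ij(1)] small[OF ij(2)] l by simp
  have "\<bar>\<sigma> * (h \<bullet> x)\<bar> \<le> 3/100" if "norm x = 1" for x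
  proof -
    have "\<bar>h \<bullet> x\<bar> \<le> norm h" using Cauchy_Schwarz_ineq2[of h x] that by simp
    then have "\<sigma> * \<bar>h \<bullet> x\<bar> \<le> \<sigma> * norm h" using \<sigma> by (intro mult_left_mono) auto
    then show ?thesis unfolding abs_mult using hs \<sigma> by linarith
  qed
  then have h1: "\<bar>\<sigma> * (h \<bullet> \<zeta>)\<bar> \<le> 3/100" "\<bar>\<sigma> * (h \<bullet> e)\<bar> \<le> 3/100" using \<zeta> ne by auto
  have tA: "\<bar>t * A\<bar> \<le> 3/2 * \<bar>t * B\<bar>"
  proof -
    have "\<bar>t * A\<bar> \<le> \<bar>t\<bar> * (3/2 * B)" unfolding abs_mult by (intro mult_left_mono AB) simp
    also have "\<dots> \<le> \<bar>t\<bar> * (3/2 * \<bar>B\<bar>)" by (intro mult_left_mono) auto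
    also have "\<dots> = 3/2 * \<bar>t * B\<bar>" by (simp add: abs_mult)
    finally show ?thesis .
  qed
  \<comment> \<open>The slope bound cancels the dependence on \<open>t\<close>; what is left is at
    least 1 - 0.03 - 1.5 * 0.03 = 0.925.\<close>
  have lower: "y \<bullet> \<zeta> + 3/2 * \<bar>y \<bullet> e\<bar> \<ge> 92/100"
  proof -
    have "\<bar>t * B\<bar> \<le> \<bar>y \<bullet> e\<bar> + \<bar>\<sigma> * (h \<bullet> e)\<bar>" unfolding y2 by linarith
    moreover have "- (\<sigma> * (h \<bullet> \<zeta>)) \<le> 3/100" "- (t * A) \<le> 3/2 * \<bar>t * B\<bar>" using h1 tA by linarith+
    ultimately show ?thesis using h1(2) unfolding y1 by linarith
  qed
  \<comment> \<open>The test vector \<open>\<zeta> + r *\<^sub>R e\<close> has norm sqrt 13 / 2 <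
    1.84, and 0.92/1.84 = 1/2.\<close>
  define r where "r = (if y \<bullet> e \<ge> 0 then 3/2 else - 3/2 :: real)"
  have "y \<bullet> (\<zeta> + r *\<^sub>R e) = y \<bullet> \<zeta> + 3/2 * \<bar>y \<bullet> e\<bar>" by (simp add: inner_add_right r_def)
  moreover have "y \<bullet> (\<zeta> + r *\<^sub>R e) \<le> norm y * norm (\<zeta> + r *\<^sub>R e)" by (rule norm_cauchy_schwarz)
  moreover have "norm (\<zeta> + r *\<^sub>R e) \<le> 184/100"
  proof (rule power2_le_imp_le)
    have "(norm (\<zeta> + r *\<^sub>R e))\<^sup>2 = 1 + r * r"
      unfolding power2_norm_eq_inner using ez by (simp add: inner_add_left inner_add_right inner_\<zeta> ee inner_commute)
    then show "(norm (\<zeta> + r *\<^sub>R e))\<^sup>2 \<le> (184/100)\<^sup>2" by (simp add: r_def power2_eq_square)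
  qed simp
  ultimately have "92/100 \<le> norm y * (184/100)"
    using lower mult_left_mono[of "norm (\<zeta> + r *\<^sub>R e)" "184/100" "norm y"] norm_ge_zero[of y] by linarith
  then show ?thesis by (simp add: y_def)
qed

end

text \<open>Equal edges and equal radii force, by polarization, a common inner product
  \<open>\<rho>\<close> of distinct centred vertices; since the vertices are centred,
  \<open>\<rho>\<close> equals -l^2/(d-1).\<close>

lemma regular_simplex_frame:
  fixes abar' :: "nat \<Rightarrow> real ^ 'd"
  assumes d: "CARD('d) \<ge> 2" and J: "finite J" "card J = CARD('d)" and z: "norm z = 1" and l: "l > 0"
    and rs: "regular_simplex J abar' z z l"
  shows "simplex_frame J (\<lambda>i. abar' i - z) z (l\<^sup>2 * CARD('d) / (real CARD('d) - 1))"
proof -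
  define D where "D = real CARD('d)"
  have D: "D \<ge> 2" using d by (simp add: D_def)
  define f where "f i = abar' i - z" for i
  note rs' = rs[unfolded regular_simplex_def]
  obtain s where s': "\<forall>i\<in>J. \<forall>j\<in>J. i \<noteq> j \<longrightarrow> dist (abar' i) (abar' j) = s"
    using rs'[THEN conjunct1] by (elim exE conjE)
  have s: "dist (abar' i) (abar' j) = s" if "i \<in> J" "j \<in> J" "i \<noteq> j" for i j
    using s'[rule_format, OF that] .
  have c: "z = (1 / real (card J)) *\<^sub>R (\<Sum>i\<in>J. abar' i)"
    using rs' by (elim conjE)
  have o': "\<forall>i\<in>J. (abar' i - z) \<bullet> z = 0" using rs' by (elim conjE)
  have r': "\<forall>i\<in>J. norm (z - abar' i) = l" using rs' by (elim conjE)
  have o: "f i \<bullet> z = 0" if "i \<in> J" for i unfolding f_def using o' that by (rule bspec)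
  have r: "norm (z - abar' i) = l" if "i \<in> J" for i using r' that by (rule bspec)
  have "real (card J) *\<^sub>R z = real (card J) *\<^sub>R ((1 / real (card J)) *\<^sub>R (\<Sum>i\<in>J. abar' i))"
    using c by (rule arg_cong)
  also have "\<dots> = (\<Sum>i\<in>J. abar' i)" using J d by simp
  finally have "(\<Sum>i\<in>J. abar' i) = real (card J) *\<^sub>R z" ..
  then have sum0: "(\<Sum>i\<in>J. f i) = 0"
    unfolding f_def sum_subtractf sum_constant_scaleR by simp
  have ff: "f i \<bullet> f i = l\<^sup>2" if "i \<in> J" for i
    using r[OF that] by (simp add: f_def power2_norm_eq_inner[symmetric] norm_minus_commute)
  define \<rho> where "\<rho> = l\<^sup>2 - s\<^sup>2 / 2"
  have fij: "f i \<bullet> f j = \<rho>" if "i \<in> J" "j \<in> J" "i \<noteq> j" for i j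
  proof -
    have "s\<^sup>2 = (norm (f i - f j))\<^sup>2" using s[OF that] by (simp add: f_def dist_norm)
    also have "\<dots> = l\<^sup>2 + l\<^sup>2 - 2 * (f i \<bullet> f j)"
      unfolding power2_norm_eq_inner using ff that by (simp add: inner_diff_left inner_diff_right inner_commute)
    finally show ?thesis by (simp add: \<rho>_def field_simps)
  qed
  have "J \<noteq> {}" using J d by auto
  then obtain i where i: "i \<in> J" by blast
  have "0 = f i \<bullet> (\<Sum>j\<in>J. f j)" by (simp add: sum0)
  also have "\<dots> = (\<Sum>j\<in>J. f i \<bullet> f j)" by (rule inner_sum_right)
  also have "\<dots> = f i \<bullet> f i + (\<Sum>j\<in>J - {i}. f i \<bullet> f j)" using J i by (intro sum.remove) auto
  also have "(\<Sum>j\<in>J - {i}. f i \<bullet> f j) = (\<Sum>j\<in>J - {i}. \<rho>)" using fij i by (intro sum.cong) auto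
  also have "\<dots> = (D - 1) * \<rho>" using J i d by (simp add: D_def of_nat_diff)
  finally have \<rho>: "\<rho> = - l\<^sup>2 / (D - 1)" using ff[OF i] D by (simp add: field_simps)
  show ?thesis
  proof
    show "finite J" "card J = CARD('d)" "2 \<le> CARD('d)" "norm z = 1" by fact+
    show "0 < l\<^sup>2 * CARD('d) / (real CARD('d) - 1)" using l d by simp
    show "(abar' i - z) \<bullet> z = 0" if "i \<in> J" for i using o[OF that] by (simp add: f_def)
    show "(\<Sum>i\<in>J. abar' i - z) = 0" using sum0 by (simp add: f_def)
    show "(abar' i - z) \<bullet> (abar' j - z) = l\<^sup>2 * CARD('d) / (real CARD('d) - 1) * ((if i = j then 1 else 0) - 1 / CARD('d))"
      if "i \<in> J" "j \<in> J" for i j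
    proof (cases "i = j")
      case True
      then show ?thesis using ff[OF that(1)] D by (simp add: f_def D_def[symmetric] field_simps)
    next
      case False
      then show ?thesis using fij[OF that False] D by (simp add: f_def \<rho> D_def[symmetric] field_simps)
    qed
  qed
qed

section \<open>Probability of a good sample\<close>

lemma sigma1_pos: "d \<ge> 2 \<Longrightarrow> n \<ge> 2 \<Longrightarrow> sigma1 d n > 0"
  by (auto simp: sigma1_def c1_def)

lemma simplex_radius_pos: "d \<ge> 2 \<Longrightarrow> simplex_radius d > 0"
  by (auto simp: simplex_radius_def c1_def)

text \<open>The factor \<open>c1\<close> is common to both constants, so this is a comparison free
  of \<open>c1\<close>. It is the form in which the noise level is measured against the size of the
  simplex.\<close>

lemma sigma1_le_simplex_radius:
  assumes d: "d \<ge> 2" and n: "n \<ge> 2"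
  shows "(sigma1 d n)\<^sup>2 * (real d ^ 3 * ln (real d)) \<le> (simplex_radius d)\<^sup>2"
proof -
  have ln: "ln (real d) > 0" using d by simp
  have pw: "(real d powr (3/2))\<^sup>2 = real d ^ 3"
    using d by (simp add: powr_power powr_realpow)
  have "(sigma1 d n)\<^sup>2 \<le> (c1 / (real d powr (3 / 2) * ln (real d)))\<^sup>2"
    using sigma1_pos[OF d n] by (intro power_mono) (auto simp: sigma1_def)
  also have "\<dots> = c1\<^sup>2 / (real d ^ 3 * (ln (real d))\<^sup>2)"
    by (simp add: power_divide power_mult_distrib pw)
  finally have "(sigma1 d n)\<^sup>2 * (real d ^ 3 * ln (real d)) \<le>
      c1\<^sup>2 / (real d ^ 3 * (ln (real d))\<^sup>2) * (real d ^ 3 * ln (real d))"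
    using ln d by (intro mult_right_mono) auto
  also have "\<dots> = c1\<^sup>2 / ln (real d)" using ln d by (simp add: power2_eq_square)
  also have "\<dots> = (simplex_radius d)\<^sup>2" using ln by (simp add: simplex_radius_def power_divide)
  finally show ?thesis .
qed

lemma simplex_radius_le:
  assumes "d \<ge> 2" shows "simplex_radius d \<le> 1 / 200"
proof -
  have "ln (real d) \<ge> ln 2" using assms by simp
  then have "ln (real d) \<ge> (2/3)\<^sup>2" using ln2_ge_two_thirds by (simp add: power2_eq_square)
  then have "sqrt (ln (real d)) \<ge> sqrt ((2/3)\<^sup>2)" by (rule real_sqrt_le_mono)
  then have "sqrt (ln (real d)) \<ge> 2/3" by simp
  then have "simplex_radius d \<le> (1 / 300) / (2/3)"
    unfolding simplex_radius_def c1_def using assms by (intro divide_left_mono) auto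
  then show ?thesis by simp
qed

lemma ln_3_ge: "ln 3 \<ge> (1::real)"
  using exp_le by (subst ln_ge_iff) auto

text \<open>Combined with the previous comparison it yields 2 d (d-1)^2 \<sigma>^2 \<le> l^2, which
  puts the cone threshold at twice the mean of the orthogonal noise. From d = 8 on, ln d \<ge> 2
  suffices; smaller dimensions are checked in groups.\<close>

lemma dimension_ln_bound:
  assumes "d \<ge> 3"
  shows "(real d)\<^sup>2 * ln (real d) \<ge> 2 * (real d - 1)\<^sup>2"
proof -
  have l4: "ln 4 \<ge> (4/3::real)"
    using ln2_ge_two_thirds ln_realpow[of 2 2] by simp
  have l6: "ln 6 \<ge> (5/3::real)"
    using ln2_ge_two_thirds ln_3_ge ln_mult[of 2 "3::real"] by simp
  have l8: "ln 8 \<ge> (2::real)"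
    using ln2_ge_two_thirds ln_realpow[of 2 3] by simp
  consider "d = 3" | "d = 4 \<or> d = 5" | "d = 6 \<or> d = 7" | "d \<ge> 8" using assms by linarith
  then show ?thesis
  proof cases
    case 1
    then show ?thesis using ln_3_ge by (simp add: power2_eq_square)
  next
    case 2
    have "ln (real d) \<ge> ln 4" using 2 by auto
    with l4 have "ln (real d) \<ge> 4/3" by linarith
    then have "(real d)\<^sup>2 * ln (real d) \<ge> (real d)\<^sup>2 * (4/3)" by (intro mult_left_mono) auto
    moreover have "(real d)\<^sup>2 * (4/3) \<ge> 2 * (real d - 1)\<^sup>2" using 2 by (auto simp: power2_eq_square)
    ultimately show ?thesis by linarith
  next
    case 3
    have "ln (real d) \<ge> ln 6" using 3 by auto
    with l6 have "ln (real d) \<ge> 5/3" by linarith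
    then have "(real d)\<^sup>2 * ln (real d) \<ge> (real d)\<^sup>2 * (5/3)" by (intro mult_left_mono) auto
    moreover have "(real d)\<^sup>2 * (5/3) \<ge> 2 * (real d - 1)\<^sup>2" using 3 by (auto simp: power2_eq_square)
    ultimately show ?thesis by linarith
  next
    case 4
    have "ln (real d) \<ge> ln 8" using 4 by auto
    with l8 have "ln (real d) \<ge> 2" by linarith
    then have "(real d)\<^sup>2 * ln (real d) \<ge> (real d)\<^sup>2 * 2" by (intro mult_left_mono) auto
    moreover have "(real d)\<^sup>2 * 2 \<ge> 2 * (real d - 1)\<^sup>2"
      using 4 by (auto intro!: power_mono)
    ultimately show ?thesis by linarith
  qed
qed

lemma exp_1_lower: "exp 1 \<ge> (271/100::real)"
proof -
  have "1 + 1/8 + (1/8)\<^sup>2 / 2 \<le> exp (1/8::real)" by (rule exp_lower_Taylor_quadratic) simp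
  then have "(1 + 1/8 + (1/8)\<^sup>2 / 2) ^ 8 \<le> exp (1/8::real) ^ 8" by (rule power_mono) (simp add: power2_eq_square)
  also have "exp (1/8::real) ^ 8 = exp 1" by (simp flip: exp_of_nat_mult)
  finally show ?thesis by (simp add: power2_eq_square eval_nat_numeral)
qed

lemma exp_11_10_lower: "exp (11/10) \<ge> (29/10::real)"
proof -
  have "1 + 11/40 + (11/40)\<^sup>2 / 2 \<le> exp (11/40::real)" by (rule exp_lower_Taylor_quadratic) simp
  then have "(1 + 11/40 + (11/40)\<^sup>2 / 2) ^ 4 \<le> exp (11/40::real) ^ 4" by (rule power_mono) (simp add: power2_eq_square)
  also have "exp (11/40::real) ^ 4 = exp (11/10)" by (simp flip: exp_of_nat_mult)
  finally show ?thesis by (simp add: power2_eq_square eval_nat_numeral)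
qed

text \<open>The part of success that concerns the unrotated, unscaled sample only. Cone and distance
  are stated through coefficients so that they pass through \<open>U\<close>; the 1/2 becomes M0
  \<ge> M after scaling by 2 M0, and the last clause serves the half-space estimate.\<close>

definition good_sample :: "nat set \<Rightarrow> (nat \<Rightarrow> real ^ 'd) \<Rightarrow> real ^ 'd \<Rightarrow> real \<Rightarrow> bool" where
  "good_sample J v \<zeta> r \<longleftrightarrow>
     (\<exists>c. (\<forall>i\<in>J. 0 \<le> c i) \<and> \<zeta> = (\<Sum>i\<in>J. c i *\<^sub>R v i)) \<and>
     (\<forall>u. (\<Sum>i\<in>J. u i) = 1 \<longrightarrow> 1/2 \<le> norm (\<Sum>i\<in>J. u i *\<^sub>R v i)) \<and>
     (\<forall>i\<in>J. norm (v i - \<zeta>) \<le> r)"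

text \<open>The distance bound keeps 0 off the affine hull, so by affine independence
  \<open>\<zeta>\<close> has some representation; it then suffices that every representation has
  nonnegative coefficients.\<close>

lemma good_sampleI:
  fixes v :: "nat \<Rightarrow> real ^ 'd"
  assumes J: "finite J" "card J = CARD('d)"
    and ind: "inj_on v J" "\<not> affine_dependent (v ` J)"
    and dst: "\<And>u. (\<Sum>i\<in>J. u i) = 1 \<Longrightarrow> 1/2 \<le> norm (\<Sum>i\<in>J. u i *\<^sub>R v i)"
    and cone: "\<And>c i. \<zeta> = (\<Sum>i\<in>J. c i *\<^sub>R v i) \<Longrightarrow> i \<in> J \<Longrightarrow> 0 \<le> c i"
    and near: "\<And>i. i \<in> J \<Longrightarrow> norm (v i - \<zeta>) \<le> r"
  shows "good_sample J v \<zeta> r"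
proof -
  have "0 \<notin> affine hull (v ` J)"
  proof
    assume "0 \<in> affine hull (v ` J)"
    then obtain u where "(\<Sum>i\<in>J. u i) = 1" "0 = (\<Sum>i\<in>J. u i *\<^sub>R v i)"
      unfolding affine_hull_image_eq[OF J(1)] by auto
    with dst[of u] show False by simp
  qed
  from affine_independent_linear_combination[OF J ind this, of \<zeta>]
  obtain c where c: "\<zeta> = (\<Sum>i\<in>J. c i *\<^sub>R v i)" by blast
  show ?thesis unfolding good_sample_def using c cone[OF c] dst near by blast
qed

text \<open>Origin of the radius 4l: l from the simplex and at most 3l from the noise.\<close>

lemma norm_simplex_noise_le:
  fixes x :: "real ^ 'd" and g :: "nat \<Rightarrow> real ^ 'd"
  assumes J: "finite J" "i \<in> J" and f: "norm (x) = l" and \<sigma>: "\<sigma> > 0"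
    and T: "\<sigma>\<^sup>2 * (\<Sum>i\<in>J. (norm (g i))\<^sup>2) \<le> (3 * l)\<^sup>2" and l: "l \<ge> 0"
  shows "\<sigma> * norm (g i) \<le> 3 * l" "norm (x + \<sigma> *\<^sub>R g i) \<le> 4 * l"
proof -
  have "(norm (g i))\<^sup>2 \<le> (\<Sum>i\<in>J. (norm (g i))\<^sup>2)" using J by (intro member_le_sum) auto
  then have "\<sigma>\<^sup>2 * (norm (g i))\<^sup>2 \<le> (3 * l)\<^sup>2"
    using T by (meson mult_left_mono order_trans zero_le_power2)
  then have "(\<sigma> * norm (g i))\<^sup>2 \<le> (3 * l)\<^sup>2" by (simp add: power_mult_distrib)
  then show 1: "\<sigma> * norm (g i) \<le> 3 * l" by (rule power2_le_imp_le) (use l in simp)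
  have "norm (x + \<sigma> *\<^sub>R g i) \<le> norm (x) + \<sigma> * norm (g i)"
    by (rule order_trans[OF norm_triangle_ineq]) (use \<sigma> in simp)
  then show "norm (x + \<sigma> *\<^sub>R g i) \<le> 4 * l" using 1 f by linarith
qed

lemma noise_inner_pos:
  assumes "\<sigma> * norm x \<le> 3 * l" "l \<le> 1/200" "norm \<zeta> = 1" "\<sigma> > 0"
  shows "1 + \<sigma> * (x \<bullet> \<zeta>) > 0"
proof -
  have "\<bar>x \<bullet> \<zeta>\<bar> \<le> norm x" using Cauchy_Schwarz_ineq2[of x \<zeta>] assms by simp
  then have "\<sigma> * (- norm x) \<le> \<sigma> * (x \<bullet> \<zeta>)" using assms by (intro mult_left_mono) auto
  then show ?thesis using assms by simp
qed


text \<open>Delivers a measurable set on which everything holds, so that \<open>P\<close>, and later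
  \<open>good_sample\<close>, need not be shown to be measurable.\<close>

lemma (in prob_space) prob_avoid_ge:
  assumes "finite I" "\<And>i. i \<in> I \<Longrightarrow> B i \<in> events" "AE x in M. P x"
  obtains A where "A \<in> events" "prob A \<ge> 1 - (\<Sum>i\<in>I. prob (B i))"
    "\<And>x i. x \<in> A \<Longrightarrow> i \<in> I \<Longrightarrow> x \<notin> B i" "\<And>x. x \<in> A \<Longrightarrow> P x"
proof -
  obtain N where N: "N \<in> events" "emeasure M N = 0" "{x \<in> space M. \<not> P x} \<subseteq> N"
    using AE_E[OF assms(3)] by metis
  let ?B = "N \<union> (\<Union>i\<in>I. B i)"
  have ev: "?B \<in> events" using N assms by auto
  have "prob ?B \<le> prob N + prob (\<Union>i\<in>I. B i)" using N assms by (intro measure_Un_le) auto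
  also have "prob N = 0" using N by (simp add: measure_def)
  also have "prob (\<Union>i\<in>I. B i) \<le> (\<Sum>i\<in>I. prob (B i))"
    using assms by (intro finite_measure_subadditive_finite) auto
  finally have "prob (space M - ?B) \<ge> 1 - (\<Sum>i\<in>I. prob (B i))"
    using prob_compl[OF ev] by simp
  moreover have "space M - ?B \<in> events" using ev by auto
  ultimately show ?thesis using N(3) by (intro that[of "space M - ?B"]) auto
qed

lemma gaussian_family_space [simp]: "space (gaussian_family J) = PiE J (\<lambda>_. UNIV)"
  by (simp add: space_PiM)

context simplex_frame
begin

text \<open>The two Frobenius norms are large only with the chi-square tail probabilities
  \<open>(2/e)\<^sup>3 < 0.405\<close> and \<open>(2/2.9)\<^sup>9 < 0.04\<close>.\<close>

lemma good_sample_probability_ge3: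
  fixes l \<sigma> :: real
  assumes d3: "CARD('d) \<ge> 3" and l: "l > 0" "l \<le> 1/200" and Kl: "K = l\<^sup>2 * CARD('d) / (real CARD('d) - 1)"
    and \<sigma>: "\<sigma> > 0" and \<sigma>l: "\<sigma>\<^sup>2 * (real CARD('d) ^ 3 * ln (real CARD('d))) \<le> l\<^sup>2"
    and ind: "AE g in gaussian_family J. inj_on (\<lambda>i. \<zeta> + f i + \<sigma> *\<^sub>R g i) J \<and>
                \<not> affine_dependent ((\<lambda>i. \<zeta> + f i + \<sigma> *\<^sub>R g i) ` J)"
  obtains A where "A \<in> sets (gaussian_family J)" "measure (gaussian_family J) A \<ge> 55/100"
    "\<And>g. g \<in> A \<Longrightarrow> good_sample J (\<lambda>i. \<zeta> + f i + \<sigma> *\<^sub>R g i) \<zeta> (4 * l)"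
proof -
  interpret P: prob_space "gaussian_family J :: (nat \<Rightarrow> real^'d) measure" by (rule prob_space_gaussian_family)
  define d where "d = real CARD('d)"
  have d: "d \<ge> 3" using d3 by (simp add: d_def)
  have dln: "d\<^sup>2 * ln d \<ge> 2 * (d - 1)\<^sup>2" unfolding d_def using d3 by (rule dimension_ln_bound)
  have Kd: "K = l\<^sup>2 * d / (d - 1)" by (simp add: Kl d_def)
  have \<sigma>l': "\<sigma>\<^sup>2 * (2 * d * (d - 1)\<^sup>2) \<le> l\<^sup>2"
  proof -
    have "2 * d * (d - 1)\<^sup>2 \<le> d * (d\<^sup>2 * ln d)" using mult_left_mono[OF dln, of d] d by simp
    also have "\<dots> = d ^ 3 * ln d" by (simp add: power2_eq_square power3_eq_cube)
    finally have "\<sigma>\<^sup>2 * (2 * d * (d - 1)\<^sup>2) \<le> \<sigma>\<^sup>2 * (d ^ 3 * ln d)" by (intro mult_left_mono) auto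
    with \<sigma>l show ?thesis by (simp add: d_def)
  qed
  \<comment> \<open>The cone criterion tolerates orthogonal noise up to K/(d \<sigma>^2), thus at
    least 2d(d-1), twice the mean.\<close>
  have K1: "K \<ge> d * \<sigma>\<^sup>2 * (2 * d * (d - 1))"
  proof -
    have "d * \<sigma>\<^sup>2 * (2 * d * (d - 1)) * (d - 1) = d * (\<sigma>\<^sup>2 * (2 * d * (d - 1)\<^sup>2))" by (simp add: power2_eq_square)
    also have "\<dots> \<le> d * l\<^sup>2" using \<sigma>l' d by (intro mult_left_mono) auto
    finally show ?thesis unfolding Kd using d by (simp add: pos_le_divide_eq mult.commute)
  qed
  \<comment> \<open>Here d \<ge> 3 enters through 2(d-1) \<ge> 4. The distance criterion thus
    tolerates total noise 0.7396 * 4 d^2, nearly three times its mean d^2.\<close>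
  have K2: "K \<ge> \<sigma>\<^sup>2 * (4 * d\<^sup>2)"
  proof -
    have "\<sigma>\<^sup>2 * (4 * d\<^sup>2) \<le> \<sigma>\<^sup>2 * ((2 * (d - 1)) * d\<^sup>2)" using d by (intro mult_left_mono mult_right_mono) auto
    also have "\<dots> = d * \<sigma>\<^sup>2 * (2 * d * (d - 1))" by (simp add: power2_eq_square)
    finally show ?thesis using K1 by linarith
  qed
  have Kl2: "K \<le> 3/2 * l\<^sup>2"
  proof -
    have "l\<^sup>2 * d \<le> l\<^sup>2 * (3/2 * (d - 1))" using d by (intro mult_left_mono) auto
    then show ?thesis unfolding Kd using d by (simp add: pos_divide_le_eq algebra_simps)
  qed
  \<comment> \<open>Both bad events are scaled by their Chernoff parameter. The second is total
    noise at least 44/15 d^2, just below the tolerated 2.9584 d^2.\<close>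
  define B :: "nat \<Rightarrow> (nat \<Rightarrow> real^'d) set" where "B k = (if k = 0
      then {g \<in> space (gaussian_family J). 1/4 * (\<Sum>i\<in>J. (norm (g i))\<^sup>2 - (g i \<bullet> \<zeta>)\<^sup>2) \<ge> d * (d - 1) / 2}
      else {g \<in> space (gaussian_family J). 3/8 * (\<Sum>i\<in>J. (norm (g i))\<^sup>2) \<ge> 11/10 * d\<^sup>2})" for k
  have Bm: "B k \<in> P.events" for k unfolding B_def by (simp del: gaussian_family_space)
  have half: "1 / sqrt (1 - 2 * (1/4)) = sqrt 2" by (simp add: real_sqrt_divide)
  have "P.prob (B 0) \<le> exp (- (d * (d - 1) / 2)) * sqrt 2 ^ ((CARD('d) - 1) * CARD('d))"
    unfolding B_def using gaussian_family_norm_sq_tail(2)[OF finJ _ _ \<zeta>, of "1/4" "d * (d - 1) / 2"]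
    unfolding half by (simp add: cardJ)
  also have "sqrt 2 ^ ((CARD('d) - 1) * CARD('d)) = 2 powr (d * (d - 1) / 2)"
  proof -
    have "sqrt 2 ^ ((CARD('d) - 1) * CARD('d)) = sqrt 2 powr (d * (d - 1))"
      by (subst powr_realpow[symmetric]) (use d3 in \<open>auto simp: d_def of_nat_diff mult.commute\<close>)
    also have "\<dots> = (2 powr (1/2)) powr (d * (d - 1))" by (simp add: powr_half_sqrt)
    finally show ?thesis by (simp add: powr_powr)
  qed
  also have "exp (- (d * (d - 1) / 2)) * 2 powr (d * (d - 1) / 2) = (2 / exp 1) powr (d * (d - 1) / 2)"
    by (simp add: powr_divide exp_powr_real exp_minus inverse_eq_divide)
  also have "\<dots> \<le> (2 / exp 1) powr 3"
  proof (rule powr_mono')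
    have "3 * 2 \<le> d * (d - 1)" using d by (intro mult_mono) auto
    then show "3 \<le> d * (d - 1) / 2" by simp
    show "2 / exp 1 \<le> (1::real)" using exp_1_lower by simp
  qed simp
  also have "\<dots> = (2 / exp 1) ^ 3" by (simp add: powr_numeral)
  also have "\<dots> \<le> (2 / (271/100)) ^ 3" using exp_1_lower by (intro power_mono divide_left_mono) auto
  also have "\<dots> \<le> 405 / 1000" by (simp add: eval_nat_numeral)
  finally have P0: "P.prob (B 0) \<le> 405 / 1000" .
  have quart: "1 / sqrt (1 - 2 * (3/8)) = (2::real)" by (simp add: real_sqrt_divide)
  have "P.prob (B 1) \<le> exp (- (11/10 * d\<^sup>2)) * 2 ^ (CARD('d) * CARD('d))"
    unfolding B_def using gaussian_family_norm_sq_tail(1)[OF finJ, of "3/8" "11/10 * d\<^sup>2"]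
    unfolding quart by (simp add: cardJ)
  also have "exp (- (11/10 * d\<^sup>2)) = (1 / exp (11/10)) ^ (CARD('d) * CARD('d))"
    by (simp add: d_def power2_eq_square exp_minus power_one_over inverse_eq_divide flip: exp_of_nat_mult)
  also have "(1 / exp (11/10)) ^ (CARD('d) * CARD('d)) * 2 ^ (CARD('d) * CARD('d)) = (2 / exp (11/10::real)) ^ (CARD('d) * CARD('d))"
    by (simp add: power_divide)
  also have "\<dots> \<le> (2 / exp (11/10::real)) ^ 9"
  proof (rule power_decreasing)
    show "9 \<le> CARD('d) * CARD('d)" using mult_le_mono[OF d3 d3] by simp
    show "2 / exp (11/10) \<le> (1::real)" using exp_11_10_lower by simp
  qed simp
  also have "\<dots> \<le> (2 / (29/10)) ^ 9" using exp_11_10_lower by (intro power_mono divide_left_mono) auto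
  also have "\<dots> \<le> 4 / 100" by (simp add: eval_nat_numeral)
  finally have P1: "P.prob (B 1) \<le> 4 / 100" .
  obtain A where A: "A \<in> P.events" "P.prob A \<ge> 1 - (\<Sum>i\<in>{0,1}. P.prob (B i))"
    "\<And>x i. x \<in> A \<Longrightarrow> i \<in> {0,1} \<Longrightarrow> x \<notin> B i"
    "\<And>g. g \<in> A \<Longrightarrow> inj_on (\<lambda>i. \<zeta> + f i + \<sigma> *\<^sub>R g i) J \<and> \<not> affine_dependent ((\<lambda>i. \<zeta> + f i + \<sigma> *\<^sub>R g i) ` J)"
    using P.prob_avoid_ge[of "{0,1}" B, OF _ Bm ind] by blast
  show ?thesis
  proof (rule that[OF A(1)])
    show "P.prob A \<ge> 55/100" using A(2) P0 P1 by simp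
    fix g assume g: "g \<in> A"
    have gs: "g \<in> space (gaussian_family J)" using g A(1) sets.sets_into_space by blast
    have S: "1/4 * (\<Sum>i\<in>J. (norm (g i))\<^sup>2 - (g i \<bullet> \<zeta>)\<^sup>2) < d * (d - 1) / 2"
      using A(3)[OF g, of 0] gs unfolding B_def by (simp del: gaussian_family_space)
    have T: "3/8 * (\<Sum>i\<in>J. (norm (g i))\<^sup>2) < 11/10 * d\<^sup>2"
      using A(3)[OF g, of 1] gs unfolding B_def by (simp del: gaussian_family_space)
    have T': "\<sigma>\<^sup>2 * (\<Sum>i\<in>J. (norm (g i))\<^sup>2) \<le> (86/100)\<^sup>2 * K"
    proof -
      have "\<sigma>\<^sup>2 * (\<Sum>i\<in>J. (norm (g i))\<^sup>2) \<le> \<sigma>\<^sup>2 * ((86/100)\<^sup>2 * (4 * d\<^sup>2))"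
      proof (intro mult_left_mono)
        have "(86/100)\<^sup>2 * (4 * d\<^sup>2) = 29584/10000 * d\<^sup>2" by (simp add: power2_eq_square)
        moreover have "0 \<le> d\<^sup>2" by simp
        ultimately show "(\<Sum>i\<in>J. (norm (g i))\<^sup>2) \<le> (86/100)\<^sup>2 * (4 * d\<^sup>2)" using T by linarith
      qed simp
      also have "\<dots> = (86/100)\<^sup>2 * (\<sigma>\<^sup>2 * (4 * d\<^sup>2))" by simp
      also have "\<dots> \<le> (86/100)\<^sup>2 * K" using K2 by (intro mult_left_mono) auto
      finally show ?thesis .
    qed
    have T3: "\<sigma>\<^sup>2 * (\<Sum>i\<in>J. (norm (g i))\<^sup>2) \<le> (3 * l)\<^sup>2"
    proof -
      have e: "(3 * l)\<^sup>2 = 9 * l\<^sup>2" "(86/100::real)\<^sup>2 = 7396/10000" by (simp_all add: power2_eq_square)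
      have "0 \<le> l\<^sup>2" by simp
      then show ?thesis using T'[unfolded e] Kl2 unfolding e by linarith
    qed
    have S': "CARD('d) * \<sigma>\<^sup>2 * (\<Sum>i\<in>J. (norm (g i))\<^sup>2 - (g i \<bullet> \<zeta>)\<^sup>2) \<le> K"
    proof -
      have "d * \<sigma>\<^sup>2 * (\<Sum>i\<in>J. (norm (g i))\<^sup>2 - (g i \<bullet> \<zeta>)\<^sup>2) \<le> d * \<sigma>\<^sup>2 * (2 * d * (d - 1))"
        using S d by (intro mult_left_mono) auto
      then show ?thesis using K1 unfolding d_def by (rule order_trans)
    qed
    have fl: "norm (f i) = l" if "i \<in> J" for i
    proof -
      have "(norm (f i))\<^sup>2 = l\<^sup>2"
      proof -
        have "1 - 1 / d = (d - 1) / d" using d by (simp add: diff_divide_distrib)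
        then have "K * (1 - 1 / d) = l\<^sup>2" unfolding Kd using d by simp
        then show ?thesis using gram[OF that that] by (simp add: power2_norm_eq_inner d_def)
      qed
      then show ?thesis using l by simp
    qed
    have Ksmall: "K \<le> CARD('d) * (1/100)\<^sup>2"
    proof -
      have "l\<^sup>2 \<le> (1/200)\<^sup>2" using l by (intro power_mono) auto
      then have "K \<le> 3/2 * (1/200)\<^sup>2" using Kl2 by linarith
      then show ?thesis using d by (simp add: power2_eq_square flip: d_def)
    qed
    have small: "\<sigma> * norm (g i) \<le> 3 * l" if "i \<in> J" for i
      using norm_simplex_noise_le(1)[OF finJ that fl[OF that] \<sigma> T3] l by simp
    have pos: "1 + \<sigma> * (g i \<bullet> \<zeta>) > 0" if "i \<in> J" for i
      by (rule noise_inner_pos[OF small[OF that] l(2) \<zeta> \<sigma>])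
    show "good_sample J (\<lambda>i. \<zeta> + f i + \<sigma> *\<^sub>R g i) \<zeta> (4 * l)"
    proof (rule good_sampleI[OF finJ cardJ])
      show "inj_on (\<lambda>i. \<zeta> + f i + \<sigma> *\<^sub>R g i) J" "\<not> affine_dependent ((\<lambda>i. \<zeta> + f i + \<sigma> *\<^sub>R g i) ` J)"
        using A(4)[OF g] by auto
      show "1/2 \<le> norm (\<Sum>i\<in>J. u i *\<^sub>R (\<zeta> + f i + \<sigma> *\<^sub>R g i))" if "(\<Sum>i\<in>J. u i) = 1" for u
        by (rule affine_comb_norm_ge[OF T' Ksmall that])
      show "0 \<le> c i" if "\<zeta> = (\<Sum>i\<in>J. c i *\<^sub>R (\<zeta> + f i + \<sigma> *\<^sub>R g i))" "i \<in> J" for c i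
        by (rule cone_coeffs_nonneg[OF that(1) S' pos that(2)])
      show "norm (\<zeta> + f i + \<sigma> *\<^sub>R g i - \<zeta>) \<le> 4 * l" if "i \<in> J" for i
        using norm_simplex_noise_le(2)[OF finJ that fl[OF that] \<sigma> T3] l by (simp add: algebra_simps)
    qed
  qed
qed

text \<open>Only finitely many linear functionals of the noise matter: two for the cone, two for the
  sign cases of the slope. Their Gaussian tails, with a generous bound on the total noise, add up to
  a failure probability of at most 1/4.\<close>

lemma good_sample_probability_2:
  fixes l \<sigma> :: real
  assumes d2: "CARD('d) = 2" and l: "l > 0" "l \<le> 1/200" and Kl: "K = 2 * l\<^sup>2"
    and \<sigma>: "\<sigma> > 0" and \<sigma>l: "\<sigma>\<^sup>2 * (8 * ln 2) \<le> l\<^sup>2"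
    and ind: "AE g in gaussian_family J. inj_on (\<lambda>i. \<zeta> + f i + \<sigma> *\<^sub>R g i) J \<and>
                \<not> affine_dependent ((\<lambda>i. \<zeta> + f i + \<sigma> *\<^sub>R g i) ` J)"
  obtains A where "A \<in> sets (gaussian_family J)" "measure (gaussian_family J) A \<ge> 55/100"
    "\<And>g. g \<in> A \<Longrightarrow> good_sample J (\<lambda>i. \<zeta> + f i + \<sigma> *\<^sub>R g i) \<zeta> (4 * l)"
proof -
  interpret P: prob_space "gaussian_family J :: (nat \<Rightarrow> real^'d) measure" by (rule prob_space_gaussian_family)
  obtain p q where J2: "J = {p, q}" "p \<noteq> q"
    using cardJ d2 by (auto simp: card_2_iff)
  have pq: "p \<in> J" "q \<in> J" using J2 by auto
  have r: "(l / \<sigma>)\<^sup>2 \<ge> 8 * ln 2"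
    using \<sigma>l \<sigma> by (simp add: power_divide pos_le_divide_eq mult.commute)
  have fl: "norm (f i) = l" if "i \<in> J" for i
  proof -
    have "(norm (f i))\<^sup>2 = l\<^sup>2"
      using gram[OF that that] d2 unfolding power2_norm_eq_inner Kl by simp
    then show ?thesis using l by simp
  qed
  define e where "e = f p /\<^sub>R l"
  have "norm e = 1" using fl[OF pq(1)] l by (simp add: e_def)
  then have ee: "e \<bullet> e = 1" by (simp add: norm_eq_1)
  have ez: "e \<bullet> \<zeta> = 0" "\<zeta> \<bullet> e = 0" using orth[OF pq(1)] by (simp_all add: e_def inner_commute)
  \<comment> \<open>Cases 0 and 1 are the components along the vertices, with variance l^2. Cases 2
    and 3 are the two signs in the slope condition, with variance 2 * 13/4.\<close>
  define w :: "nat \<Rightarrow> nat \<Rightarrow> real ^ 'd" where "w k i = (if k = 0 then (if i = p then - f p else 0)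
      else if k = 1 then (if i = q then - f q else 0)
      else if k = 2 then (if i = p then \<zeta> - (3/2) *\<^sub>R e else (3/2) *\<^sub>R e - \<zeta>)
      else (if i = p then - \<zeta> - (3/2) *\<^sub>R e else (3/2) *\<^sub>R e + \<zeta>))" for k i
  define t where "t k = (if k \<le> 1 then l\<^sup>2 / \<sigma> else 3 * l / \<sigma>)" for k :: nat
  define B :: "nat \<Rightarrow> (nat \<Rightarrow> real^'d) set" where "B k = (if k \<le> 3
      then {g \<in> space (gaussian_family J). (\<Sum>i\<in>J. w k i \<bullet> g i) \<ge> t k}
      else {g \<in> space (gaussian_family J). 1/4 * (\<Sum>i\<in>J. (norm (g i))\<^sup>2) \<ge> 18 * ln 2})" for k
  have Bm: "B k \<in> P.events" for k unfolding B_def by (simp del: gaussian_family_space)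
  have e2: "exp (- (x * ln 2)) = (2::real) powr (- x)" for x by (simp add: powr_def)
  have P01: "P.prob (B k) \<le> 1/16" if k: "k \<le> 1" for k
  proof -
    have "(\<Sum>i\<in>J. (norm (w k i))\<^sup>2) = l\<^sup>2"
      using k fl[OF pq(1)] fl[OF pq(2)] J2 by (cases "k = 0") (auto simp: w_def)
    then have "P.prob (B k) \<le> exp (- (t k)\<^sup>2 / (2 * l\<^sup>2))"
      using k gaussian_family_linear_tail[OF finJ, of "w k" "l\<^sup>2" "t k"] l \<sigma>
      unfolding B_def by (auto simp: t_def)
    also have "- (t k)\<^sup>2 / (2 * l\<^sup>2) = - ((l / \<sigma>)\<^sup>2 / 2)"
      using k l by (simp add: t_def power2_eq_square)
    also have "exp (- ((l / \<sigma>)\<^sup>2 / 2)) \<le> exp (- (4 * ln 2))" using r by simp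
    also have "\<dots> = 1/16" unfolding e2 by (simp add: powr_minus)
    finally show ?thesis .
  qed
  have P23: "P.prob (B k) \<le> 1/32" if k: "k = 2 \<or> k = 3" for k
  proof -
    have nn: "(norm (\<zeta> - (3/2) *\<^sub>R e))\<^sup>2 = 13/4" "(norm ((3/2) *\<^sub>R e - \<zeta>))\<^sup>2 = 13/4"
      "(norm (- \<zeta> - (3/2) *\<^sub>R e))\<^sup>2 = 13/4" "(norm ((3/2) *\<^sub>R e + \<zeta>))\<^sup>2 = 13/4"
      unfolding power2_norm_eq_inner by (simp_all add: inner_diff_left inner_diff_right inner_add_left inner_add_right inner_\<zeta> ee ez)
    have "(\<Sum>i\<in>J. (norm (w k i))\<^sup>2) = 13/2"
      using k J2 nn by (auto simp: w_def)
    then have "P.prob (B k) \<le> exp (- (t k)\<^sup>2 / (2 * (13/2)))"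
      using k gaussian_family_linear_tail[OF finJ, of "w k" "13/2" "t k"] l \<sigma>
      unfolding B_def by (auto simp: t_def)
    also have "- (t k)\<^sup>2 / (2 * (13/2)) = - (9/13 * (l / \<sigma>)\<^sup>2)"
      using k by (auto simp: t_def power_divide power_mult_distrib)
    also have "exp (- (9/13 * (l / \<sigma>)\<^sup>2)) \<le> exp (- (5 * ln 2))"
    proof -
      have "0 < ln (2::real)" by simp
      with r have "5 * ln 2 \<le> 9/13 * (l / \<sigma>)\<^sup>2" by linarith
      then show ?thesis by simp
    qed
    also have "\<dots> = 1/32" unfolding e2 by (simp add: powr_minus)
    finally show ?thesis .
  qed
  have P4: "P.prob (B 4) \<le> 1/16"
  proof -
    have half: "1 / sqrt (1 - 2 * (1/4)) = sqrt 2" by (simp add: real_sqrt_divide)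
    have "P.prob (B 4) \<le> exp (- (18 * ln 2)) * sqrt 2 ^ (CARD('d) * CARD('d))"
      unfolding B_def using gaussian_family_norm_sq_tail(1)[OF finJ, of "1/4" "18 * ln 2"]
      unfolding half by (simp add: cardJ)
    also have "\<dots> = exp (- (18 * ln 2)) * 4" unfolding d2 by (simp add: eval_nat_numeral)
    also have "\<dots> \<le> 1/16" unfolding e2 by (simp add: powr_minus)
    finally show ?thesis .
  qed
  obtain A where A: "A \<in> P.events" "P.prob A \<ge> 1 - (\<Sum>i\<in>{..4}. P.prob (B i))"
    "\<And>x i. x \<in> A \<Longrightarrow> i \<in> {..4} \<Longrightarrow> x \<notin> B i"
    "\<And>g. g \<in> A \<Longrightarrow> inj_on (\<lambda>i. \<zeta> + f i + \<sigma> *\<^sub>R g i) J \<and> \<not> affine_dependent ((\<lambda>i. \<zeta> + f i + \<sigma> *\<^sub>R g i) ` J)"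
    using P.prob_avoid_ge[of "{..4}" B, OF _ Bm ind] by blast
  show ?thesis
  proof (rule that[OF A(1)])
    have "(\<Sum>i\<in>{..4}. P.prob (B i)) = P.prob (B 0) + P.prob (B 1) + P.prob (B 2) + P.prob (B 3) + P.prob (B 4)"
      by (simp add: eval_nat_numeral)
    \<comment> \<open>The budget is 2/16 + 2/32 + 1/16 = 1/4.\<close>
    then show "P.prob A \<ge> 55/100" using A(2) P01[of 0] P01[of 1] P23[of 2] P23[of 3] P4 by simp
    fix g assume g: "g \<in> A"
    have gs: "g \<in> space (gaussian_family J)" using g A(1) sets.sets_into_space by blast
    have L: "(\<Sum>i\<in>J. w k i \<bullet> g i) < t k" if "k \<le> 3" for k
      using A(3)[OF g, of k] gs that unfolding B_def by (simp del: gaussian_family_space)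
    have T: "1/4 * (\<Sum>i\<in>J. (norm (g i))\<^sup>2) < 18 * ln 2"
      using A(3)[OF g, of 4] gs unfolding B_def by (simp del: gaussian_family_space)
    have T3: "\<sigma>\<^sup>2 * (\<Sum>i\<in>J. (norm (g i))\<^sup>2) \<le> (3 * l)\<^sup>2"
    proof -
      have "\<sigma>\<^sup>2 * (\<Sum>i\<in>J. (norm (g i))\<^sup>2) \<le> \<sigma>\<^sup>2 * (9 * (8 * ln 2))"
        using T by (intro mult_left_mono) auto
      then show ?thesis using \<sigma>l by (simp add: power2_eq_square)
    qed
    have cone0: "\<sigma> * (g i \<bullet> f i) > - (K / 2)" if "i \<in> J" for i
    proof -
      have "- (f i \<bullet> g i) < l\<^sup>2 / \<sigma>"
        using L[of 0] L[of 1] J2 that by (auto simp: w_def t_def)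
      then have "- (\<sigma> * (g i \<bullet> f i)) < l\<^sup>2" using \<sigma> by (simp add: pos_less_divide_eq inner_commute mult.commute)
      then show ?thesis by (simp add: Kl)
    qed
    have slope: "\<bar>\<sigma> * ((g p - g q) \<bullet> \<zeta>)\<bar> \<le> 3/2 * (2 * l + \<sigma> * ((g p - g q) \<bullet> (f p /\<^sub>R l)))"
    proof -
      have "(g p - g q) \<bullet> \<zeta> - 3/2 * ((g p - g q) \<bullet> e) < 3 * l / \<sigma>"
        using L[of 2] J2 by (simp add: w_def t_def inner_diff_left inner_commute algebra_simps)
      then have "((g p - g q) \<bullet> \<zeta> - 3/2 * ((g p - g q) \<bullet> e)) * \<sigma> < 3 * l"
        using \<sigma> by (simp only: pos_less_divide_eq)
      then have 1: "\<sigma> * ((g p - g q) \<bullet> \<zeta>) - 3/2 * (\<sigma> * ((g p - g q) \<bullet> e)) < 3 * l"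
        by (simp add: right_diff_distrib mult.commute[of _ \<sigma>])
      have "- ((g p - g q) \<bullet> \<zeta>) - 3/2 * ((g p - g q) \<bullet> e) < 3 * l / \<sigma>"
        using L[of 3] J2 by (simp add: w_def t_def inner_diff_left inner_add_left inner_commute algebra_simps)
      then have "(- ((g p - g q) \<bullet> \<zeta>) - 3/2 * ((g p - g q) \<bullet> e)) * \<sigma> < 3 * l"
        using \<sigma> by (simp only: pos_less_divide_eq)
      then have 2: "- (\<sigma> * ((g p - g q) \<bullet> \<zeta>)) - 3/2 * (\<sigma> * ((g p - g q) \<bullet> e)) < 3 * l"
        by (simp add: right_diff_distrib mult.commute[of _ \<sigma>])
      have "\<bar>X\<bar> \<le> 3/2 * (2 * l + Y)" if "X - 3/2 * Y < 3 * l" "- X - 3/2 * Y < 3 * l" for X Y :: real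
        using that by (auto simp: abs_le_iff field_simps)
      from this[OF 1 2] show ?thesis unfolding e_def .
    qed
    have small: "\<sigma> * norm (g i) \<le> 3 * l" if "i \<in> J" for i
      using norm_simplex_noise_le(1)[OF finJ that fl[OF that] \<sigma> T3] l by simp
    have pos: "1 + \<sigma> * (g i \<bullet> \<zeta>) > 0" if "i \<in> J" for i
      by (rule noise_inner_pos[OF small[OF that] l(2) \<zeta> \<sigma>])
    show "good_sample J (\<lambda>i. \<zeta> + f i + \<sigma> *\<^sub>R g i) \<zeta> (4 * l)"
    proof (rule good_sampleI[OF finJ cardJ])
      show "inj_on (\<lambda>i. \<zeta> + f i + \<sigma> *\<^sub>R g i) J" "\<not> affine_dependent ((\<lambda>i. \<zeta> + f i + \<sigma> *\<^sub>R g i) ` J)"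
        using A(4)[OF g] by auto
      show "1/2 \<le> norm (\<Sum>i\<in>J. u i *\<^sub>R (\<zeta> + f i + \<sigma> *\<^sub>R g i))" if "(\<Sum>i\<in>J. u i) = 1" for u
        by (rule planar_affine_comb_norm_ge[OF J2 l(1) Kl _ \<sigma> slope small that]) (use l in auto)
      show "0 \<le> c i" if "\<zeta> = (\<Sum>i\<in>J. c i *\<^sub>R (\<zeta> + f i + \<sigma> *\<^sub>R g i))" "i \<in> J" for c i
        by (rule planar_cone_coeffs_nonneg[OF J2 that(1) cone0 pos that(2)])
      show "norm (\<zeta> + f i + \<sigma> *\<^sub>R g i - \<zeta>) \<le> 4 * l" if "i \<in> J" for i
        using norm_simplex_noise_le(2)[OF finJ that fl[OF that] \<sigma> T3] l by (simp add: algebra_simps)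
    qed
  qed
qed

end

section \<open>Random rotations\<close>

lemma haar_orthogonal_setup:
  assumes "haar_orthogonal (\<mu> :: (real^'d^'d) measure)"
  shows "prob_space \<mu>" "sets \<mu> = sets (restrict_space borel {Q. orthogonal_matrix Q})"
    "space \<mu> = {Q. orthogonal_matrix Q}"
    "\<And>Q. orthogonal_matrix Q \<Longrightarrow> distr \<mu> \<mu> (\<lambda>V. Q ** V) = \<mu>"
    "(\<lambda>U. U) \<in> \<mu> \<rightarrow>\<^sub>M borel"
proof -
  show *: "prob_space \<mu>" "sets \<mu> = sets (restrict_space borel {Q. orthogonal_matrix Q})"
    "\<And>Q. orthogonal_matrix Q \<Longrightarrow> distr \<mu> \<mu> (\<lambda>V. Q ** V) = \<mu>"
    using assms by (auto simp: haar_orthogonal_def)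
  show "space \<mu> = {Q. orthogonal_matrix Q}"
    using sets_eq_imp_space_eq[OF *(2)] by (simp add: space_restrict_space)
  have "(\<lambda>U. U) \<in> restrict_space borel {Q :: real^'d^'d. orthogonal_matrix Q} \<rightarrow>\<^sub>M borel"
    by (rule measurable_restrict_space1) simp
  then show "(\<lambda>U. U) \<in> \<mu> \<rightarrow>\<^sub>M borel"
    by (subst measurable_cong_sets[OF *(2) refl])
qed

lemma matrix_vector_mult_measurable [measurable]:
  assumes "f \<in> M \<rightarrow>\<^sub>M (borel :: (real^'d^'e) measure)" "g \<in> M \<rightarrow>\<^sub>M borel"
  shows "(\<lambda>x. f x *v g x) \<in> M \<rightarrow>\<^sub>M borel"
proof -
  have "continuous_on UNIV (\<lambda>p :: (real^'d^'e) \<times> (real^'d). fst p *v snd p)"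
    unfolding matrix_vector_mult_def by (intro continuous_intros)
  from borel_measurable_continuous_on[OF this borel_measurable_Pair[OF assms]]
  show ?thesis by simp
qed

lemma matrix_mult_continuous: "continuous_on UNIV (\<lambda>V :: real^'d^'d. Q ** V)"
  unfolding matrix_matrix_mult_def by (intro continuous_intros)

lemma haar_orthogonal_mult_measurable:
  assumes \<mu>: "haar_orthogonal (\<mu> :: (real^'d^'d) measure)" and Q: "orthogonal_matrix Q"
  shows "(\<lambda>V. Q ** V) \<in> \<mu> \<rightarrow>\<^sub>M \<mu>"
proof -
  note h = haar_orthogonal_setup[OF \<mu>]
  have "(\<lambda>V. Q ** V) \<in> \<mu> \<rightarrow>\<^sub>M restrict_space borel {Q. orthogonal_matrix Q}"
  proof (rule measurable_restrict_space2)
    show "(\<lambda>V. Q ** V) \<in> space \<mu> \<rightarrow> {Q. orthogonal_matrix Q}"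
      using Q by (auto simp: h(3) orthogonal_matrix_mul)
    show "(\<lambda>V. Q ** V) \<in> borel_measurable \<mu>"
      using borel_measurable_continuous_on[OF matrix_mult_continuous h(5)] .
  qed
  then show ?thesis by (subst measurable_cong_sets[OF refl h(2)])
qed

lemma orthogonal_matrix_inner:
  "orthogonal_matrix Q \<Longrightarrow> (Q *v x) \<bullet> (Q *v y) = x \<bullet> (y :: real^'d)"
  using orthogonal_transformation_matrix[of "(*v) Q"]
  by (simp add: orthogonal_transformation_def)

lemma orthogonal_matrix_norm: "orthogonal_matrix Q \<Longrightarrow> norm (Q *v x) = norm (x :: real^'d)"
  using orthogonal_matrix_inner[of Q x x] by (simp add: norm_eq_sqrt_inner)

text \<open>Left invariance of Haar measure lets one average over a Gaussian direction \<open>w\<close> instead of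
  fixing \<open>h\<close>; for each fixed \<open>U\<close> all the relevant quantities are then exactly Gaussian.\<close>

lemma haar_halfspace_probability:
  fixes v :: "nat \<Rightarrow> real ^ 'd" and h \<zeta> :: "real ^ 'd"
  assumes \<mu>: "haar_orthogonal \<mu>" and J: "finite J" "J \<noteq> {}" and h: "h \<noteq> 0" and \<zeta>: "norm \<zeta> = 1"
    and near: "\<And>i. i \<in> J \<Longrightarrow> norm (v i - \<zeta>) \<le> r" and r: "r > 0" and \<theta>: "\<theta> \<ge> 0"
  shows "measure \<mu> {U \<in> space \<mu>. \<forall>i\<in>J. h \<bullet> (U *v v i) < 0} \<ge> 1/2 - \<theta>/2 - card J * exp (- \<theta>\<^sup>2 / (2 * r\<^sup>2))"
proof -
  note hs = haar_orthogonal_setup[OF \<mu>]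
  interpret M: prob_space \<mu> by (rule hs(1))
  interpret N: prob_space "gaussian 0 1 :: (real^'d) measure" by (rule prob_space_gaussian) simp
  interpret P: pair_prob_space \<mu> "gaussian 0 1 :: (real^'d) measure" ..
  note hs(5)[measurable]
  define F where "F w = measure \<mu> {U \<in> space \<mu>. \<forall>i\<in>J. w \<bullet> (U *v v i) < 0}" for w
  have ev: "{U \<in> space \<mu>. \<forall>i\<in>J. w \<bullet> (U *v v i) < 0} \<in> sets \<mu>" for w
    using J by measurable
  \<comment> \<open>For nonzero \<open>w\<close> this is left invariance under a rotation taking the
    direction of \<open>w\<close> to that of \<open>h\<close>; the length is irrelevant for a sign
    condition. For \<open>w = 0\<close> the event is empty because \<open>J\<close> is
    nonempty.\<close>
  have Fle: "F w \<le> F h" for w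
  proof (cases "w = 0")
    case True
    then have "F w = 0" using J by (simp add: F_def)
    then show ?thesis by (simp add: F_def)
  next
    case False
    have "norm ((norm h / norm w) *\<^sub>R w) = norm h" using False by simp
    then obtain T :: "real^'d \<Rightarrow> real^'d" where T: "orthogonal_transformation T" "T ((norm h / norm w) *\<^sub>R w) = h"
      using orthogonal_transformation_exists by blast
    define Q where "Q = matrix T"
    have Q: "orthogonal_matrix Q" using T orthogonal_transformation_matrix by (auto simp: Q_def)
    have QT: "Q *v x = T x" for x
      using T by (simp add: Q_def matrix_works orthogonal_transformation_linear)
    have iff: "h \<bullet> ((Q ** U) *v x) < 0 \<longleftrightarrow> w \<bullet> (U *v x) < 0" for U :: "real^'d^'d" and x
    proof -
      have "h \<bullet> ((Q ** U) *v x) = (Q *v ((norm h / norm w) *\<^sub>R w)) \<bullet> (Q *v (U *v x))"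
        using T QT by (simp add: matrix_vector_mul_assoc)
      also have "\<dots> = (norm h / norm w) * (w \<bullet> (U *v x))"
        by (simp add: orthogonal_matrix_inner[OF Q])
      finally show ?thesis using h False by (simp add: mult_less_0_iff divide_less_0_iff)
    qed
    have "F h = measure (distr \<mu> \<mu> (\<lambda>V. Q ** V)) {U \<in> space \<mu>. \<forall>i\<in>J. h \<bullet> (U *v v i) < 0}"
      unfolding hs(4)[OF Q] F_def ..
    also have "\<dots> = measure \<mu> ((\<lambda>V. Q ** V) -` {U \<in> space \<mu>. \<forall>i\<in>J. h \<bullet> (U *v v i) < 0} \<inter> space \<mu>)"
      by (rule measure_distr[OF haar_orthogonal_mult_measurable[OF \<mu> Q] ev])
    also have "(\<lambda>V. Q ** V) -` {U \<in> space \<mu>. \<forall>i\<in>J. h \<bullet> (U *v v i) < 0} \<inter> space \<mu>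
        = {U \<in> space \<mu>. \<forall>i\<in>J. w \<bullet> (U *v v i) < 0}"
      using Q by (auto simp: iff hs(3) orthogonal_matrix_mul)
    finally show ?thesis by (simp add: F_def)
  qed
  define E where "E = {(U, w). U \<in> space \<mu> \<and> (\<forall>i\<in>J. w \<bullet> (U *v v i) < 0)}"
  have E: "E \<in> sets (\<mu> \<Otimes>\<^sub>M gaussian 0 1)"
  proof -
    have "E = {x \<in> space (\<mu> \<Otimes>\<^sub>M gaussian 0 1). \<forall>i\<in>J. snd x \<bullet> (fst x *v v i) < 0}"
      by (auto simp: E_def space_pair_measure)
    also have "\<dots> \<in> sets (\<mu> \<Otimes>\<^sub>M gaussian 0 1)" using J by measurable
    finally show ?thesis .
  qed
  define c where "c = 1/2 - \<theta>/2 - card J * exp (- \<theta>\<^sup>2 / (2 * r\<^sup>2))"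
  have inner: "measure (gaussian 0 1) {w. \<forall>i\<in>J. w \<bullet> (U *v v i) < 0} \<ge> c" if U: "U \<in> space \<mu>" for U
  proof -
    have Q: "orthogonal_matrix U" using U by (simp add: hs(3))
    let ?A = "{w :: real^'d. w \<bullet> (U *v \<zeta>) < - \<theta>}" and ?B = "\<lambda>i. {w :: real^'d. w \<bullet> (U *v (v i - \<zeta>)) \<ge> \<theta>}"
    let ?C = "{w :: real^'d. \<forall>i\<in>J. w \<bullet> (U *v v i) < 0}"
    have Cm: "?C \<in> N.events" using J by (auto intro!: borel_measurable_pred_less pred_intros_finite simp: pred_def)
    \<comment> \<open>If the main term is below -\<theta> and every perturbation is below \<theta>,
      then all the sums are negative.\<close>
    have "?A \<subseteq> ?C \<union> (\<Union>i\<in>J. ?B i)"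
    proof
      fix w assume "w \<in> ?A"
      then show "w \<in> ?C \<union> (\<Union>i\<in>J. ?B i)"
        by (fastforce simp: matrix_vector_mult_diff_distrib inner_diff_right)
    qed
    then have "N.prob ?A \<le> N.prob (?C \<union> (\<Union>i\<in>J. ?B i))"
      using J Cm by (intro N.finite_measure_mono) auto
    also have "\<dots> \<le> N.prob ?C + N.prob (\<Union>i\<in>J. ?B i)"
      using J Cm by (intro measure_Un_le) auto
    also have "N.prob (\<Union>i\<in>J. ?B i) \<le> (\<Sum>i\<in>J. N.prob (?B i))"
      using J by (intro N.finite_measure_subadditive_finite) auto
    also have "\<dots> \<le> (\<Sum>i\<in>J. exp (- \<theta>\<^sup>2 / (2 * r\<^sup>2)))"
      by (intro sum_mono gaussian_linear_tail r \<theta>) (simp add: orthogonal_matrix_norm[OF Q] near)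
    finally have "N.prob ?A \<le> N.prob ?C + card J * exp (- \<theta>\<^sup>2 / (2 * r\<^sup>2))" by simp
    moreover have "N.prob ?A \<ge> 1/2 - \<theta>/2"
      by (rule gaussian_anticoncentration) (simp_all add: orthogonal_matrix_norm[OF Q] \<zeta> \<theta>)
    ultimately show ?thesis by (simp add: c_def)
  qed
  have "ennreal c = (\<integral>\<^sup>+U. ennreal c \<partial>\<mu>)" by (simp add: M.emeasure_space_1)
  also have "\<dots> \<le> (\<integral>\<^sup>+U. emeasure (gaussian 0 1) (Pair U -` E) \<partial>\<mu>)"
  proof (rule nn_integral_mono)
    fix U assume U: "U \<in> space \<mu>"
    have "Pair U -` E = {w. \<forall>i\<in>J. w \<bullet> (U *v v i) < 0}" using U by (auto simp: E_def)
    then show "ennreal c \<le> emeasure (gaussian 0 1) (Pair U -` E)"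
      using inner[OF U] by (simp add: N.emeasure_eq_measure ennreal_leI)
  qed
  also have "\<dots> = emeasure (\<mu> \<Otimes>\<^sub>M gaussian 0 1) E"
    by (rule N.emeasure_pair_measure_alt[OF E, symmetric])
  also have "\<dots> = (\<integral>\<^sup>+w. emeasure \<mu> ((\<lambda>x. (x, w)) -` E) \<partial>gaussian 0 1)"
    by (rule P.emeasure_pair_measure_alt2[OF E])
  also have "\<dots> \<le> (\<integral>\<^sup>+w. ennreal (F h) \<partial>(gaussian 0 1 :: (real^'d) measure))"
  proof (rule nn_integral_mono)
    fix w :: "real ^ 'd"
    have "(\<lambda>x. (x, w)) -` E = {U \<in> space \<mu>. \<forall>i\<in>J. w \<bullet> (U *v v i) < 0}" by (auto simp: E_def)
    then show "emeasure \<mu> ((\<lambda>x. (x, w)) -` E) \<le> ennreal (F h)"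
      using Fle[of w] by (simp add: M.emeasure_eq_measure F_def ennreal_leI)
  qed
  also have "\<dots> = ennreal (F h)" using N.emeasure_space_1 by simp
  finally have "c \<le> F h" by (simp add: F_def)
  then show ?thesis by (simp add: c_def F_def)
qed

section \<open>General position of the added vectors\<close>

lemma PiM_gaussian_eq_distr:
  fixes m :: "nat \<Rightarrow> real ^ 'd" and T :: "real ^ 'd \<Rightarrow> real ^ 'd"
  assumes I: "finite I" and T: "orthogonal_transformation T" and s: "s > 0"
  shows "PiM I (\<lambda>i. gaussian (m i) s) =
    distr (gaussian_family I) (PiM I (\<lambda>_. borel)) (\<lambda>g. \<lambda>i\<in>I. m i + s *\<^sub>R T (g i))"
    and "(\<lambda>g. \<lambda>i\<in>I. m i + s *\<^sub>R T (g i)) \<in> gaussian_family I \<rightarrow>\<^sub>M PiM I (\<lambda>_. borel)"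
proof -
  interpret G: product_prob_space "\<lambda>i. gaussian (m i) s"
    by (intro product_prob_spaceI prob_space_gaussian s)
  interpret N: product_prob_space "\<lambda>_::nat. gaussian (0::real^'d) 1"
    by (intro product_prob_spaceI prob_space_gaussian) simp
  have [measurable]: "T \<in> borel \<rightarrow>\<^sub>M borel"
    using T by (intro borel_measurable_continuous_onI linear_continuous_on linear_conv_bounded_linear[THEN iffD1])
      (simp add: orthogonal_transformation)
  show Phi: "(\<lambda>g. \<lambda>i\<in>I. m i + s *\<^sub>R T (g i)) \<in> gaussian_family I \<rightarrow>\<^sub>M PiM I (\<lambda>_. borel)"
    by measurable
  have "distr (gaussian_family I) (PiM I (\<lambda>_. borel)) (\<lambda>g. \<lambda>i\<in>I. m i + s *\<^sub>R T (g i)) = PiM I (\<lambda>i. gaussian (m i) s)"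
  proof (rule G.PiM_eqI[OF I])
    show "sets (distr (gaussian_family I) (PiM I (\<lambda>_. borel)) (\<lambda>g. \<lambda>i\<in>I. m i + s *\<^sub>R T (g i))) = sets (PiM I (\<lambda>i. gaussian (m i) s))"
      by (simp cong: sets_PiM_cong)
    fix A assume A: "\<And>i. i \<in> I \<Longrightarrow> A i \<in> sets (gaussian (m i) s)"
    then have [measurable]: "\<And>i. i \<in> I \<Longrightarrow> A i \<in> sets borel" by simp
    have pre: "(\<lambda>x. m i + s *\<^sub>R T x) -` A i \<in> sets borel" if "i \<in> I" for i
      using that measurable_sets[of "\<lambda>x. m i + s *\<^sub>R T x" borel borel "A i"] by simp
    have "emeasure (distr (gaussian_family I) (PiM I (\<lambda>_. borel)) (\<lambda>g. \<lambda>i\<in>I. m i + s *\<^sub>R T (g i))) (PiE I A)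
        = emeasure (gaussian_family I) ((\<lambda>g. \<lambda>i\<in>I. m i + s *\<^sub>R T (g i)) -` PiE I A \<inter> space (gaussian_family I))"
      using I by (intro emeasure_distr Phi sets_PiM_I_finite) auto
    also have "(\<lambda>g. \<lambda>i\<in>I. m i + s *\<^sub>R T (g i)) -` PiE I A \<inter> space (gaussian_family I)
        = PiE I (\<lambda>i. (\<lambda>x. m i + s *\<^sub>R T x) -` A i)"
      by (auto simp: PiE_def Pi_def extensional_def)
    also have "emeasure (gaussian_family I) \<dots> = (\<Prod>i\<in>I. emeasure (gaussian 0 1) ((\<lambda>x. m i + s *\<^sub>R T x) -` A i))"
      using N.emeasure_PiM[OF I, of "\<lambda>i. (\<lambda>x. m i + s *\<^sub>R T x) -` A i"] pre by simp
    also have "\<dots> = (\<Prod>i\<in>I. emeasure (gaussian (m i) s) (A i))"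
    proof (intro prod.cong refl)
      fix i assume i: "i \<in> I"
      have "emeasure (distr (gaussian 0 1) borel (\<lambda>x. m i + s *\<^sub>R T x)) (A i)
          = emeasure (gaussian 0 1) ((\<lambda>x. m i + s *\<^sub>R T x) -` A i)"
        using i by (subst emeasure_distr) auto
      then show "emeasure (gaussian 0 1) ((\<lambda>x. m i + s *\<^sub>R T x) -` A i) = emeasure (gaussian (m i) s) (A i)"
        unfolding gaussian_distr_orthogonal[OF T s] by simp
    qed
    finally show "emeasure (distr (gaussian_family I) (PiM I (\<lambda>_. borel)) (\<lambda>g. \<lambda>i\<in>I. m i + s *\<^sub>R T (g i))) (PiE I A)
        = (\<Prod>i\<in>I. emeasure (gaussian (m i) s) (A i))" .
  qed
  then show "PiM I (\<lambda>i. gaussian (m i) s) =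
    distr (gaussian_family I) (PiM I (\<lambda>_. borel)) (\<lambda>g. \<lambda>i\<in>I. m i + s *\<^sub>R T (g i))" ..
qed

text \<open>Coordinates outside \<open>I\<close> are constantly \<open>undefined\<close> on the
  product space, so the identity is measurable into the Borel sets of the full function space. Borel
  sets there can therefore be used as events.\<close>

lemma PiM_to_borel_fun:
  fixes M :: "nat \<Rightarrow> ('b::second_countable_topology) measure"
  assumes M: "\<And>i. i \<in> I \<Longrightarrow> sets (M i) = sets borel"
  shows "(\<lambda>b. b) \<in> PiM I M \<rightarrow>\<^sub>M borel"
proof (rule measurable_coordinatewise_then_product)
  fix i
  show "(\<lambda>b. b i) \<in> PiM I M \<rightarrow>\<^sub>M borel"
  proof (cases "i \<in> I")
    case True
    then have "(\<lambda>b. b i) \<in> PiM I M \<rightarrow>\<^sub>M M i" by (rule measurable_component_singleton)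
    then show ?thesis by (subst measurable_cong_sets[OF refl M[OF True, symmetric]])
  next
    case False
    then have "(\<lambda>b. b i) \<in> PiM I M \<rightarrow>\<^sub>M borel \<longleftrightarrow> (\<lambda>b. undefined :: 'b) \<in> PiM I M \<rightarrow>\<^sub>M borel"
      by (intro measurable_cong) (auto simp: space_PiM PiE_def extensional_def)
    then show ?thesis by simp
  qed
qed

lemma closed_outside_zero: "closed {p :: 'x::topological_space \<times> (nat \<Rightarrow> real). \<forall>k. k \<notin> K \<longrightarrow> snd p k = 0}"
proof (rule closed_Collect_all)
  fix k
  have "continuous_on UNIV (\<lambda>p :: 'x \<times> (nat \<Rightarrow> real). snd p k)"
    by (rule continuous_on_product_then_coordinatewise[OF continuous_on_snd[OF continuous_on_id]])
  then have "closed {p :: 'x \<times> (nat \<Rightarrow> real). snd p k = 0}"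
    by (intro closed_Collect_eq) (auto intro: continuous_intros)
  then show "closed {p :: 'x \<times> (nat \<Rightarrow> real). k \<notin> K \<longrightarrow> snd p k = 0}"
    by (cases "k \<in> K") auto
qed

text \<open>The coefficients are made to vanish outside \<open>K\<close>, which exhibits the set as
  a projection of the closed set \<open>C\<close> covered by
  \<open>borel_ex_finite_support\<close>.\<close>

lemma borel_mem_affine_hull:
  fixes c :: "'x::topological_space \<Rightarrow> nat \<Rightarrow> real ^ 'd"
  assumes K: "finite K" and c: "\<And>k. continuous_on UNIV (\<lambda>x. c x k)" and p: "continuous_on UNIV p"
  shows "{x. p x \<in> affine hull (c x ` K)} \<in> sets borel"
proof -
  define C where "C = {q :: 'x \<times> (nat \<Rightarrow> real). p (fst q) = (\<Sum>k\<in>K. snd q k *\<^sub>R c (fst q) k)}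
     \<inter> {q. (\<Sum>k\<in>K. snd q k) = 1} \<inter> {q. \<forall>k. k \<notin> K \<longrightarrow> snd q k = 0}"
  have s: "continuous_on UNIV (\<lambda>q :: 'x \<times> (nat \<Rightarrow> real). snd q k)" for k
    by (rule continuous_on_product_then_coordinatewise[OF continuous_on_snd[OF continuous_on_id]])
  have f: "continuous_on UNIV (\<lambda>q :: 'x \<times> (nat \<Rightarrow> real). h (fst q))" if "continuous_on UNIV h" for h :: "'x \<Rightarrow> real^'d"
    by (rule continuous_on_compose2[OF that continuous_on_fst[OF continuous_on_id]]) auto
  have "closed C"
    unfolding C_def
    by (intro closed_Int closed_outside_zero closed_Collect_eq continuous_on_sum continuous_on_scaleR s f c p
        continuous_on_const)
  then have "{x. \<exists>u. (x, u) \<in> C} \<in> sets borel"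
    by (rule borel_ex_finite_support[OF _ K]) (auto simp: C_def)
  also have "{x. \<exists>u. (x, u) \<in> C} = {x. p x \<in> affine hull (c x ` K)}"
  proof (intro set_eqI iffI; unfold mem_Collect_eq)
    fix x assume "\<exists>u. (x, u) \<in> C"
    then show "p x \<in> affine hull (c x ` K)"
      unfolding affine_hull_image_eq[OF K] C_def by auto
  next
    fix x assume "p x \<in> affine hull (c x ` K)"
    then obtain u where u: "p x = (\<Sum>k\<in>K. u k *\<^sub>R c x k)" "(\<Sum>k\<in>K. u k) = 1"
      unfolding affine_hull_image_eq[OF K] by auto
    have "(x, \<lambda>k. if k \<in> K then u k else 0) \<in> C" using u by (simp add: C_def)
    then show "\<exists>u. (x, u) \<in> C" by blast
  qed
  finally show ?thesis .
qed

text \<open>At most d points have an affine hull inside a hyperplane, which is a null set.\<close>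

lemma AE_gaussian_not_in_affine_hull:
  fixes S :: "(real ^ 'd) set"
  assumes S: "finite S" "card S \<le> CARD('d)"
  shows "AE y in gaussian m s. y \<notin> affine hull S"
proof -
  have "aff_dim (affine hull S) < DIM(real^'d)"
    using aff_dim_le_card[OF S(1)] S(2) by simp
  then obtain a b where ab: "a \<noteq> 0" "affine hull S \<subseteq> {x. a \<bullet> x = b}"
    using aff_lowdim_subset_hyperplane by blast
  have "{x. a \<bullet> x = b} \<in> null_sets lebesgue"
    using negligible_hyperplane[of a b] ab by (simp add: negligible_iff_null_sets)
  moreover have "{x. a \<bullet> x = b} \<in> sets lborel"
    using closed_hyperplane[of a b] by auto
  ultimately have "{x. a \<bullet> x = b} \<in> null_sets lborel"
    by (simp add: null_sets_completion_iff)
  then have "AE y in lborel. y \<notin> {x. a \<bullet> x = b}" by (rule AE_not_in)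
  then have "AE y in lborel. y \<notin> affine hull S" by eventually_elim (use ab in auto)
  then show ?thesis
    unfolding gaussian_def by (subst AE_density) auto
qed

text \<open>Almost surely no added vector lies in the affine hull of at most d others, old or new.
  In an affine dependence the coefficients of added vectors must then vanish, and the rest is
  excluded by general position of \<open>a\<close>.\<close>

lemma AE_general_position_added:
  fixes a m :: "nat \<Rightarrow> real ^ 'd"
  assumes gp: "general_position n a" and s: "s > 0"
  shows "AE b in PiM {n+1..n+CARD('d)} (\<lambda>i. gaussian (m i) s). general_position (n + CARD('d)) (add_constraints n a b)"
proof -
  define I where "I = {n+1..n+CARD('d)}"
  define G where "G i = gaussian (m i) s" for i
  interpret G: product_prob_space G
    unfolding G_def by (intro product_prob_spaceI prob_space_gaussian s)
  have emb: "(\<lambda>b. b) \<in> PiM I G \<rightarrow>\<^sub>M borel" by (rule PiM_to_borel_fun) (simp add: G_def)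
  have cc: "continuous_on UNIV (\<lambda>b. add_constraints n a b k)" for k
    by (cases "k \<le> n") (simp_all add: add_constraints_def)
  \<comment> \<open>Fubini with coordinate \<open>i\<close> innermost: the hull does not involve
    \<open>i\<close>, hence is fixed while \<open>b i\<close> varies.\<close>
  have key: "AE b in PiM I G. b i \<notin> affine hull (add_constraints n a b ` K)"
    if i: "i \<in> I" and K: "K \<subseteq> {1..n + CARD('d)} - {i}" "card K \<le> CARD('d)" for i K
  proof -
    have finK: "finite K" using K(1) finite_subset by auto
    define N where "N = {b. b i \<in> affine hull (add_constraints n a b ` K)}"
    have "N \<in> sets borel" unfolding N_def by (rule borel_mem_affine_hull[OF finK cc]) simp
    from measurable_sets[OF emb this] have N: "N \<inter> space (PiM I G) \<in> sets (PiM I G)" by simp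
    have ins: "insert i (I - {i}) = I" using i by auto
    have "emeasure (PiM I G) (N \<inter> space (PiM I G)) = (\<integral>\<^sup>+b. indicator (N \<inter> space (PiM I G)) b \<partial>PiM I G)"
      using N by simp
    also have "\<dots> = (\<integral>\<^sup>+x. (\<integral>\<^sup>+y. indicator (N \<inter> space (PiM I G)) (x(i := y)) \<partial>G i) \<partial>PiM (I - {i}) G)"
      using G.product_nn_integral_insert[of "I - {i}" i "indicator (N \<inter> space (PiM I G))"] N
      unfolding ins by (simp add: I_def)
    also have "\<dots> = (\<integral>\<^sup>+x. 0 \<partial>PiM (I - {i}) G)"
    proof (rule nn_integral_cong)
      fix x
      have eq: "add_constraints n a (x(i := y)) ` K = add_constraints n a x ` K" for y
        using K i by (intro image_cong) (auto simp: add_constraints_def I_def)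
      have "AE y in G i. y \<notin> affine hull (add_constraints n a x ` K)"
        unfolding G_def using K finK
        by (intro AE_gaussian_not_in_affine_hull) (auto intro: order_trans[OF card_image_le])
      then have "AE y in G i. indicator (N \<inter> space (PiM I G)) (x(i := y)) = (0::ennreal)"
        by eventually_elim (auto simp: N_def eq indicator_def)
      then have "(\<integral>\<^sup>+y. indicator (N \<inter> space (PiM I G)) (x(i := y)) \<partial>G i) = (\<integral>\<^sup>+y. 0 \<partial>G i)"
        by (rule nn_integral_cong_AE)
      then show "(\<integral>\<^sup>+y. indicator (N \<inter> space (PiM I G)) (x(i := y)) \<partial>G i) = 0" by simp
    qed
    finally have "emeasure (PiM I G) (N \<inter> space (PiM I G)) = 0" by simp
    with N have "N \<inter> space (PiM I G) \<in> null_sets (PiM I G)" by (auto intro: null_setsI)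
    then have "AE b in PiM I G. b \<notin> N \<inter> space (PiM I G)" by (rule AE_not_in)
    with AE_space show ?thesis by eventually_elim (auto simp: N_def)
  qed
  have "AE b in PiM I G. \<forall>p\<in>{(i, K). i \<in> I \<and> K \<subseteq> {1..n + CARD('d)} - {i} \<and> card K \<le> CARD('d)}.
      b (fst p) \<notin> affine hull (add_constraints n a b ` snd p)"
  proof (rule AE_finite_allI)
    have "{(i, K). i \<in> I \<and> K \<subseteq> {1..n + CARD('d)} - {i} \<and> card K \<le> CARD('d)} \<subseteq> I \<times> Pow {1..n + CARD('d)}" by auto
    then show "finite {(i, K). i \<in> I \<and> K \<subseteq> {1..n + CARD('d)} - {i} \<and> card K \<le> CARD('d)}"
      by (rule finite_subset) (simp add: I_def)
  qed (use key in auto)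
  then have "AE b in PiM I G. general_position (n + CARD('d)) (add_constraints n a b)"
  proof eventually_elim
    case (elim b)
    define c where "c = add_constraints n a b"
    have out: "c i \<notin> affine hull (c ` K)" if "i \<in> I" "K \<subseteq> {1..n + CARD('d)} - {i}" "card K \<le> CARD('d)" for i K
      using bspec[OF elim, of "(i, K)"] that by (auto simp: c_def I_def)
    show ?case
      unfolding general_position_def c_def[symmetric]
    proof (intro allI impI)
      fix L assume L: "L \<subseteq> {1..n + CARD('d)}" "card L \<le> CARD('d) + 1"
      have finL: "finite L" using L(1) finite_subset by auto
      show "inj_on c L \<and> \<not> affine_dependent (c ` L)"
        unfolding affine_independent_family_iff[OF finL]
      proof (intro allI impI)
        fix u assume u: "(\<Sum>i\<in>L. u i) = 0" "(\<Sum>i\<in>L. u i *\<^sub>R c i) = 0"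
        \<comment> \<open>Otherwise solving the dependence for \<open>c i\<close> writes it as an
          affine combination of the at most d remaining vectors.\<close>
        have big: "u i = 0" if i: "i \<in> L" "i \<in> I" for i
        proof (rule ccontr)
          assume ui: "u i \<noteq> 0"
          have s1: "(\<Sum>k\<in>L - {i}. u k) = - u i" using u(1) sum.remove[OF finL i(1), of u] by simp
          have s2: "(\<Sum>k\<in>L - {i}. u k *\<^sub>R c k) = - (u i *\<^sub>R c i)"
            using u(2) sum.remove[OF finL i(1), of "\<lambda>k. u k *\<^sub>R c k"] by (simp add: add_eq_0_iff)
          have "(\<Sum>k\<in>L - {i}. - (u k / u i)) = 1"
            using s1 ui by (simp add: sum_negf flip: sum_divide_distrib)
          moreover have "(\<Sum>k\<in>L - {i}. (- (u k / u i)) *\<^sub>R c k) = c i"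
          proof -
            have "(\<Sum>k\<in>L - {i}. (- (u k / u i)) *\<^sub>R c k) = (- 1 / u i) *\<^sub>R (\<Sum>k\<in>L - {i}. u k *\<^sub>R c k)"
              by (simp add: scaleR_sum_right sum_negf)
            then show ?thesis using ui by (simp add: s2)
          qed
          ultimately have "c i \<in> affine hull (c ` (L - {i}))"
            unfolding affine_hull_image_eq[OF finite_Diff[OF finL]] mem_Collect_eq
            by (intro exI[of _ "\<lambda>k. - (u k / u i)"]) simp
          moreover have "card (L - {i}) \<le> CARD('d)" using L i finL by (simp add: card_Diff_singleton)
          ultimately show False using out[of i "L - {i}"] i L by auto
        qed
        define L' where "L' = L \<inter> {1..n}"
        have L': "finite L'" "L' \<subseteq> {1..n}" "card L' \<le> CARD('d) + 1"
          using finL L card_mono[OF finL, of L'] by (auto simp: L'_def)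
        have u0: "u k = 0" if "k \<in> L - L'" for k
          using big[of k] that L by (auto simp: L'_def I_def)
        have "(\<Sum>i\<in>L'. u i) = 0" "(\<Sum>i\<in>L'. u i *\<^sub>R a i) = 0"
        proof -
          show "(\<Sum>i\<in>L'. u i) = 0"
            using u(1) sum.mono_neutral_left[OF finL, of L' u] u0 by (auto simp: L'_def)
          have "(\<Sum>i\<in>L'. u i *\<^sub>R a i) = (\<Sum>i\<in>L'. u i *\<^sub>R c i)"
            by (intro sum.cong refl) (auto simp: L'_def c_def)
          also have "\<dots> = (\<Sum>i\<in>L. u i *\<^sub>R c i)"
            using u0 by (intro sum.mono_neutral_left finL) (auto simp: L'_def)
          finally show "(\<Sum>i\<in>L'. u i *\<^sub>R a i) = 0" using u(2) by simp
        qed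
        moreover have "inj_on a L' \<and> \<not> affine_dependent (a ` L')"
          using gp L' unfolding general_position_def by blast
        ultimately have "\<forall>i\<in>L'. u i = 0"
          unfolding affine_independent_family_iff[OF L'(1)] by blast
        then show "\<forall>i\<in>L. u i = 0" using u0 by blast
      qed
    qed
  qed
  then show ?thesis unfolding I_def G_def .
qed

section \<open>Success of the algorithm\<close>

text \<open>The origin in the closure means t \<ge> 0. Passing to the open half-space through the
  origin makes the condition invariant under the scaling by 2 M0.\<close>

lemma halfspace_through_origin:
  fixes H :: "(real ^ 'd) set"
  assumes "numb_halfspace n a z H"
  obtains h where "h \<noteq> 0" "{x. h \<bullet> x < 0} \<subseteq> H" "H \<in> sets borel"
proof -
  obtain h t where h: "h \<noteq> 0" "H = {x. h \<bullet> x \<le> t} \<or> H = {x. h \<bullet> x < t}" and 0: "0 \<in> closure H"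
    using assms unfolding numb_halfspace_def halfspace_def by blast
  have "closure H \<subseteq> {x. h \<bullet> x \<le> t}"
    using h(2) by (intro closure_minimal closed_halfspace_le) auto
  then have "t \<ge> 0" using 0 by auto
  then have "{x. h \<bullet> x < 0} \<subseteq> H" using h(2) by auto
  moreover have "H \<in> sets borel"
    using h(2) closed_halfspace_le[of h t] open_halfspace_lt[of h t] by auto
  ultimately show ?thesis using that h(1) by blast
qed

text \<open>The cone condition is a projection along coefficients supported on \<open>J\<close>; the
  distance condition is an intersection of closed sets over all weights \<open>u\<close>.\<close>

lemma borel_success_event:
  fixes z :: "real ^ 'd"
  assumes J: "finite J" "J \<noteq> {}" and H: "H \<in> sets borel"
  shows "{(U, b). t *\<^sub>R (U *v z) \<in> nonneg_cone J b \<and> infdist 0 (affine hull (b ` J)) \<ge> M \<and> (\<forall>i\<in>J. b i \<in> H)}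
     \<in> sets (borel :: ((real^'d^'d) \<times> (nat \<Rightarrow> real^'d)) measure)"
proof -
  let ?B = "borel :: ((real^'d^'d) \<times> (nat \<Rightarrow> real^'d)) measure"
  have cb: "continuous_on S (\<lambda>x. snd x i)" for S :: "((real^'d^'d) \<times> (nat \<Rightarrow> real^'d)) set" and i
    by (rule continuous_on_product_then_coordinatewise[OF continuous_on_snd[OF continuous_on_id]])
  define C where "C = {q :: ((real^'d^'d) \<times> (nat \<Rightarrow> real^'d)) \<times> (nat \<Rightarrow> real).
       t *\<^sub>R (fst (fst q) *v z) = (\<Sum>i\<in>J. snd q i *\<^sub>R snd (fst q) i)}
     \<inter> {q. \<forall>i. i \<in> J \<longrightarrow> 0 \<le> snd q i} \<inter> {q. \<forall>k. k \<notin> J \<longrightarrow> snd q k = 0}"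
  have s: "continuous_on UNIV (\<lambda>q :: ((real^'d^'d) \<times> (nat \<Rightarrow> real^'d)) \<times> (nat \<Rightarrow> real). snd q k)" for k
    by (rule continuous_on_product_then_coordinatewise[OF continuous_on_snd[OF continuous_on_id]])
  have f: "continuous_on UNIV (\<lambda>q :: ((real^'d^'d) \<times> (nat \<Rightarrow> real^'d)) \<times> (nat \<Rightarrow> real). snd (fst q) k)" for k
    by (rule continuous_on_product_then_coordinatewise[OF continuous_on_snd[OF continuous_on_fst[OF continuous_on_id]]])
  have mv: "continuous_on UNIV (\<lambda>q :: ((real^'d^'d) \<times> (nat \<Rightarrow> real^'d)) \<times> (nat \<Rightarrow> real). t *\<^sub>R (fst (fst q) *v z))"
    unfolding matrix_vector_mult_def by (intro continuous_intros)
  have "closed {q :: ((real^'d^'d) \<times> (nat \<Rightarrow> real^'d)) \<times> (nat \<Rightarrow> real). i \<in> J \<longrightarrow> 0 \<le> snd q i}" for i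
    by (cases "i \<in> J") (auto intro!: closed_Collect_le s continuous_on_const)
  then have "closed C"
    unfolding C_def
    by (intro closed_Int closed_outside_zero closed_Collect_eq mv continuous_on_sum continuous_on_scaleR s f closed_Collect_all)
  then have "{x. \<exists>u. (x, u) \<in> C} \<in> sets ?B"
    by (rule borel_ex_finite_support[OF _ J(1)]) (auto simp: C_def)
  also have "{x. \<exists>u. (x, u) \<in> C} = {x. t *\<^sub>R (fst x *v z) \<in> nonneg_cone J (snd x)}"
  proof (intro set_eqI iffI; unfold mem_Collect_eq)
    fix x assume "\<exists>u. (x, u) \<in> C"
    then show "t *\<^sub>R (fst x *v z) \<in> nonneg_cone J (snd x)"
      unfolding nonneg_cone_def C_def by auto
  next
    fix x :: "(real^'d^'d) \<times> (nat \<Rightarrow> real^'d)" assume "t *\<^sub>R (fst x *v z) \<in> nonneg_cone J (snd x)"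
    then obtain u where u: "t *\<^sub>R (fst x *v z) = (\<Sum>k\<in>J. u k *\<^sub>R snd x k)" "\<forall>k\<in>J. 0 \<le> u k"
      unfolding nonneg_cone_def by auto
    have "(x, \<lambda>k. if k \<in> J then u k else 0) \<in> C" using u by (simp add: C_def)
    then show "\<exists>u. (x, u) \<in> C" by blast
  qed
  finally have 1: "{x. t *\<^sub>R (fst x *v z) \<in> nonneg_cone J (snd x)} \<in> sets ?B" .
  have "closed {x :: (real^'d^'d) \<times> (nat \<Rightarrow> real^'d). infdist 0 (affine hull (snd x ` J)) \<ge> M}"
    unfolding infdist_affine_hull_image_ge_iff[OF J]
  proof (rule closed_Collect_all)
    fix u :: "nat \<Rightarrow> real"
    have "closed {x :: (real^'d^'d) \<times> (nat \<Rightarrow> real^'d). M \<le> norm (\<Sum>i\<in>J. u i *\<^sub>R snd x i)}"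
      by (intro closed_Collect_le continuous_on_const continuous_on_norm continuous_on_sum continuous_on_scaleR cb)
    then show "closed {x :: (real^'d^'d) \<times> (nat \<Rightarrow> real^'d). sum u J = 1 \<longrightarrow> M \<le> norm (\<Sum>i\<in>J. u i *\<^sub>R snd x i)}"
      by (cases "sum u J = 1") auto
  qed
  then have 2: "{x. infdist 0 (affine hull (snd x ` J)) \<ge> M} \<in> sets ?B" by (rule borel_closed)
  have "(\<lambda>x. snd x i) \<in> ?B \<rightarrow>\<^sub>M borel" for i by (rule borel_measurable_continuous_onI[OF cb])
  then have 3: "{x. snd x i \<in> H} \<in> sets ?B" for i
    using measurable_sets[of "\<lambda>x. snd x i" ?B borel H] H by (simp add: vimage_def)
  have "{x. \<forall>i\<in>J. snd x i \<in> H} = (\<Inter>i\<in>J. {x :: (real^'d^'d) \<times> (nat \<Rightarrow> real^'d). snd x i \<in> H})" by auto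
  also have "\<dots> \<in> sets ?B" using J 3 by (intro sets.finite_INT) auto
  finally have 3: "{x. \<forall>i\<in>J. snd x i \<in> H} \<in> sets ?B" .
  have "{(U, b). t *\<^sub>R (U *v z) \<in> nonneg_cone J b \<and> infdist 0 (affine hull (b ` J)) \<ge> M \<and> (\<forall>i\<in>J. b i \<in> H)}
     = {x. t *\<^sub>R (fst x *v z) \<in> nonneg_cone J (snd x)} \<inter> {x. infdist 0 (affine hull (snd x ` J)) \<ge> M}
       \<inter> {x. \<forall>i\<in>J. snd x i \<in> H}" by auto
  also have "\<dots> \<in> sets ?B" using 1 2 3 by auto
  finally show ?thesis .
qed

lemma good_sample_success:
  fixes v :: "nat \<Rightarrow> real ^ 'd"
  assumes J: "finite J" "J \<noteq> {}" and good: "good_sample J v \<zeta> r" and U: "orthogonal_matrix U"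
    and M0: "M0 > 0" "M \<le> M0" and b: "\<And>i. i \<in> J \<Longrightarrow> b i = (2 * M0) *\<^sub>R (U *v v i)"
  shows "(2 * M0) *\<^sub>R (U *v \<zeta>) \<in> nonneg_cone J b" "infdist 0 (affine hull (b ` J)) \<ge> M"
proof -
  have lin: "(\<Sum>i\<in>J. u i *\<^sub>R b i) = (2 * M0) *\<^sub>R (U *v (\<Sum>i\<in>J. u i *\<^sub>R v i))" for u
  proof -
    have "(\<Sum>i\<in>J. u i *\<^sub>R b i) = (\<Sum>i\<in>J. (2 * M0) *\<^sub>R (U *v (u i *\<^sub>R v i)))"
      by (intro sum.cong refl) (simp add: b matrix_vector_mult_scaleR)
    also have "\<dots> = (2 * M0) *\<^sub>R (\<Sum>i\<in>J. U *v (u i *\<^sub>R v i))" by (simp add: scaleR_sum_right)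
    also have "(\<Sum>i\<in>J. U *v (u i *\<^sub>R v i)) = U *v (\<Sum>i\<in>J. u i *\<^sub>R v i)"
      using linear_sum[OF matrix_vector_mul_linear[of U], of "\<lambda>i. u i *\<^sub>R v i" J] by simp
    finally show ?thesis .
  qed
  obtain c where c: "\<forall>i\<in>J. 0 \<le> c i" "\<zeta> = (\<Sum>i\<in>J. c i *\<^sub>R v i)"
    using good unfolding good_sample_def by blast
  show "(2 * M0) *\<^sub>R (U *v \<zeta>) \<in> nonneg_cone J b"
    unfolding nonneg_cone_def mem_Collect_eq by (intro exI[of _ c] conjI c(1)) (simp only: lin flip: c(2))
  show "infdist 0 (affine hull (b ` J)) \<ge> M"
    unfolding infdist_affine_hull_image_ge_iff[OF J]
  proof (intro allI impI)
    fix u :: "nat \<Rightarrow> real" assume "sum u J = 1"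
    then have "1/2 \<le> norm (\<Sum>i\<in>J. u i *\<^sub>R v i)" using good unfolding good_sample_def by blast
    then have "2 * M0 * (1/2) \<le> 2 * M0 * norm (\<Sum>i\<in>J. u i *\<^sub>R v i)" using M0 by (intro mult_left_mono) auto
    moreover have "norm (\<Sum>i\<in>J. u i *\<^sub>R b i) = 2 * M0 * norm (\<Sum>i\<in>J. u i *\<^sub>R v i)"
      unfolding lin using M0 by (simp add: orthogonal_matrix_norm[OF U])
    ultimately show "M \<le> norm (\<Sum>i\<in>J. u i *\<^sub>R b i)" using M0 by linarith
  qed
qed

text \<open>Taken with margin \<theta> = 0.06 and r = 4l: anticoncentration costs 0.03 and the d
  tails together at most 1/512.\<close>

lemma haar_halfspace_simplex_probability:
  fixes v :: "nat \<Rightarrow> real ^ 'd"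
  assumes \<mu>: "haar_orthogonal \<mu>" and d: "CARD('d) \<ge> 2" and J: "finite J" "card J = CARD('d)" and h: "h \<noteq> 0"
    and \<zeta>: "norm \<zeta> = 1" and near: "\<And>i. i \<in> J \<Longrightarrow> norm (v i - \<zeta>) \<le> 4 * simplex_radius CARD('d)"
  shows "measure \<mu> {U \<in> space \<mu>. \<forall>i\<in>J. h \<bullet> (U *v v i) < 0} \<ge> 465/1000"
proof -
  define D where "D = real CARD('d)"
  define l where "l = simplex_radius CARD('d)"
  have D: "D \<ge> 2" using d by (simp add: D_def)
  have ln: "ln D > 0" using D by simp
  have l: "l > 0" "l\<^sup>2 = (1/300)\<^sup>2 / ln D"
    using simplex_radius_pos[OF d] ln by (auto simp: l_def simplex_radius_def c1_def power_divide D_def)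
  have "J \<noteq> {}" using J d by auto
  then have "measure \<mu> {U \<in> space \<mu>. \<forall>i\<in>J. h \<bullet> (U *v v i) < 0}
      \<ge> 1/2 - (6/100)/2 - card J * exp (- (6/100)\<^sup>2 / (2 * (4 * l)\<^sup>2))"
    using l by (intro haar_halfspace_probability[OF \<mu> J(1) _ h \<zeta>]) (auto simp: near l_def)
  moreover have "card J * exp (- (6/100)\<^sup>2 / (2 * (4 * l)\<^sup>2)) \<le> 1/512"
  proof -
    \<comment> \<open>The square root of the logarithm in the simplex radius turns the tail into a
      power of d, and 81/8 > 10.\<close>
    have "- (6/100)\<^sup>2 / (2 * (4 * l)\<^sup>2) = - (81/8 * ln D)"
      unfolding power_mult_distrib l(2) using ln by (simp add: power2_eq_square field_simps)
    then have "exp (- (6/100)\<^sup>2 / (2 * (4 * l)\<^sup>2)) \<le> exp (- (real 10 * ln D))"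
      using ln by simp
    also have "\<dots> = 1 / D ^ 10"
      using D by (simp only: exp_minus exp_of_nat_mult) (simp add: inverse_eq_divide)
    finally have "card J * exp (- (6/100)\<^sup>2 / (2 * (4 * l)\<^sup>2)) \<le> D * (1 / D ^ 10)"
      unfolding J(2) D_def[symmetric] using D by (intro mult_left_mono) auto
    also have "\<dots> = 1 / D ^ 9" using D by (simp add: eval_nat_numeral)
    also have "\<dots> \<le> 1 / 2 ^ 9" using D by (intro divide_left_mono power_mono) auto
    finally show ?thesis by simp
  qed
  ultimately show ?thesis by simp
qed

lemma good_sample_probability:
  fixes abar' :: "nat \<Rightarrow> real ^ 'd"
  assumes d: "CARD('d) \<ge> 2" and n: "n \<ge> 2" and J: "J = {n+1..n+CARD('d)}"
    and gp: "general_position n (a :: nat \<Rightarrow> real ^ 'd)" and z: "norm z0' = 1"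
    and rs: "regular_simplex J abar' z0' z0' (simplex_radius CARD('d))"
  obtains A where "A \<in> sets (gaussian_family J)" "measure (gaussian_family J) A \<ge> 55/100"
    "\<And>g. g \<in> A \<Longrightarrow> good_sample J (\<lambda>i. abar' i + sigma1 CARD('d) n *\<^sub>R g i) z0' (4 * simplex_radius CARD('d))"
proof -
  define l where "l = simplex_radius CARD('d)"
  define \<sigma> where "\<sigma> = sigma1 CARD('d) n"
  have l: "l > 0" "l \<le> 1/200" and \<sigma>: "\<sigma> > 0"
    unfolding l_def \<sigma>_def by (intro simplex_radius_pos simplex_radius_le sigma1_pos d n)+
  have \<sigma>l: "\<sigma>\<^sup>2 * (real CARD('d) ^ 3 * ln (real CARD('d))) \<le> l\<^sup>2"
    unfolding l_def \<sigma>_def by (rule sigma1_le_simplex_radius[OF d n])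
  have J': "finite J" "card J = CARD('d)" by (auto simp: J)
  interpret simplex_frame J "\<lambda>i. abar' i - z0'" z0' "l\<^sup>2 * CARD('d) / (real CARD('d) - 1)"
    using rs by (intro regular_simplex_frame d J' z l(1)) (simp add: l_def)
  have eq: "z0' + (abar' i - z0') + \<sigma> *\<^sub>R x = abar' i + \<sigma> *\<^sub>R x" for i x by simp
  have T: "orthogonal_transformation (\<lambda>x :: real^'d. x)" by (rule orthogonal_transformation_id)
  \<comment> \<open>Affine independence of the noisy vertices is read off from general position of
    the extended family, transported to the standard noise \<open>g\<close> and restricted to
    \<open>J\<close>.\<close>
  have "AE b in PiM J (\<lambda>i. gaussian (abar' i) \<sigma>). general_position (n + CARD('d)) (add_constraints n a b)"
    unfolding J by (rule AE_general_position_added[OF gp \<sigma>])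
  then have "AE g in gaussian_family J. general_position (n + CARD('d)) (add_constraints n a (\<lambda>i\<in>J. abar' i + \<sigma> *\<^sub>R g i))"
    unfolding PiM_gaussian_eq_distr(1)[OF J'(1) T \<sigma>]
    by (rule AE_distrD[OF PiM_gaussian_eq_distr(2)[OF J'(1) T \<sigma>]])
  then have ind: "AE g in gaussian_family J. inj_on (\<lambda>i. z0' + (abar' i - z0') + \<sigma> *\<^sub>R g i) J \<and>
                \<not> affine_dependent ((\<lambda>i. z0' + (abar' i - z0') + \<sigma> *\<^sub>R g i) ` J)"
  proof eventually_elim
    case (elim g)
    let ?c = "add_constraints n a (\<lambda>i\<in>J. abar' i + \<sigma> *\<^sub>R g i)"
    have c: "?c i = z0' + (abar' i - z0') + \<sigma> *\<^sub>R g i" if "i \<in> J" for i using that by (simp add: J)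
    have "J \<subseteq> {1..n + CARD('d)}" "card J \<le> CARD('d) + 1" by (auto simp: J)
    then have gpc: "inj_on ?c J \<and> \<not> affine_dependent (?c ` J)"
      using elim unfolding general_position_def by blast
    have 1: "?c ` J = (\<lambda>i. z0' + (abar' i - z0') + \<sigma> *\<^sub>R g i) ` J"
      by (rule image_cong[OF refl c])
    have 2: "inj_on ?c J \<longleftrightarrow> inj_on (\<lambda>i. z0' + (abar' i - z0') + \<sigma> *\<^sub>R g i) J"
      by (rule inj_on_cong[OF c])
    show ?case using gpc unfolding 1 2 .
  qed
  obtain A where A: "A \<in> sets (gaussian_family J)" "measure (gaussian_family J) A \<ge> 55/100"
    "\<And>g. g \<in> A \<Longrightarrow> good_sample J (\<lambda>i. z0' + (abar' i - z0') + \<sigma> *\<^sub>R g i) z0' (4 * l)"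
  proof (cases "CARD('d) = 2")
    case True
    have 1: "\<sigma>\<^sup>2 * (8 * ln 2) \<le> l\<^sup>2" using \<sigma>l True by simp
    have 2: "l\<^sup>2 * CARD('d) / (real CARD('d) - 1) = 2 * l\<^sup>2" using True by simp
    show ?thesis by (rule good_sample_probability_2[OF True l 2 \<sigma> 1 ind]) (rule that)
  next
    case False
    then have "CARD('d) \<ge> 3" using d by simp
    then show ?thesis by (rule good_sample_probability_ge3[OF _ l refl \<sigma> \<sigma>l ind]) (rule that)
  qed
  show ?thesis
    by (rule that[OF A(1,2)]) (use A(3) in \<open>simp add: eq l_def \<sigma>_def\<close>)
qed

text \<open>Moves all dependence on \<open>U\<close> from the law into a deterministic map of a
  noise whose law does not involve \<open>U\<close>; this makes rotation and noise
  independent.\<close>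

lemma added_law_eq_distr:
  fixes abar' :: "nat \<Rightarrow> real ^ 'd"
  assumes U: "orthogonal_matrix U" and \<sigma>: "sigma1 CARD('d) n > 0" and M0: "M0 > 0"
  shows "added_law n abar' M0 U = distr (gaussian_family {n+1..n+CARD('d)}) (PiM {n+1..n+CARD('d)} (\<lambda>_. borel))
    (\<lambda>g. \<lambda>i\<in>{n+1..n+CARD('d)}. (2 * M0) *\<^sub>R (U *v (abar' i + sigma1 CARD('d) n *\<^sub>R g i)))"
proof -
  have T: "orthogonal_transformation ((*v) U)"
    using U orthogonal_transformation_matrix[of "(*v) U"] by simp
  have eq: "(2 * M0) *\<^sub>R (U *v abar' i) + (2 * M0 * sigma1 CARD('d) n) *\<^sub>R (U *v x)
      = (2 * M0) *\<^sub>R (U *v (abar' i + sigma1 CARD('d) n *\<^sub>R x))" for i x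
    by (simp add: matrix_vector_right_distrib matrix_vector_mult_scaleR scaleR_add_right)
  show ?thesis
    unfolding added_law_def
    by (subst PiM_gaussian_eq_distr(1)[OF _ T]) (use M0 \<sigma> in \<open>simp_all add: eq\<close>)
qed

lemma rotation_added_law_success_ge:
  fixes a :: "nat \<Rightarrow> real ^ 'd" and z z0' :: "real ^ 'd" and abar' :: "nat \<Rightarrow> real ^ 'd"
  assumes d: "CARD('d) \<ge> 2" and n: "n \<ge> 2"
    and gp: "general_position n a"
    and nh: "numb_halfspace n a z H"
    and M0: "M0 > 0" "M0 \<ge> Max ((\<lambda>i. norm (a i)) ` {1..n})"
    and z: "norm z0' = 1"
    and rs: "regular_simplex {n+1..n+CARD('d)} abar' z0' z0' (simplex_radius CARD('d))"
    and \<mu>: "haar_orthogonal \<mu>"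
  shows "\<P>((U, b) in rotation_added_law n abar' M0 \<mu>.
            \<exists>b' z0. adding_constraints n a z0' M0 U b = Some (b', z0) \<and>
              (\<forall>i\<in>{n+1..n+CARD('d)}. b' i \<in> H)) \<ge> 1 / 4"
proof -
  define J where "J = {n+1..n+CARD('d)}"
  have J: "finite J" "J \<noteq> {}" "card J = CARD('d)" by (auto simp: J_def)
  define M where "M = Max ((\<lambda>i. norm (a i)) ` {1..n})"
  define \<sigma> where "\<sigma> = sigma1 CARD('d) n"
  have \<sigma>: "\<sigma> > 0" unfolding \<sigma>_def by (rule sigma1_pos[OF d n])
  obtain h where h: "h \<noteq> 0" "{x. h \<bullet> x < 0} \<subseteq> H" and H: "H \<in> sets borel"
    using halfspace_through_origin[OF nh] .
  note hs = haar_orthogonal_setup[OF \<mu>]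
  interpret M: prob_space \<mu> by (rule hs(1))
  interpret G: prob_space "gaussian_family J :: (nat \<Rightarrow> real^'d) measure" by (rule prob_space_gaussian_family)
  interpret P: pair_prob_space \<mu> "gaussian_family J :: (nat \<Rightarrow> real^'d) measure" ..
  note hs(5)[measurable]
  define PB where "PB = PiM J (\<lambda>_. borel :: (real^'d) measure)"
  define \<Phi> where "\<Phi> U g = (\<lambda>i\<in>J. (2 * M0) *\<^sub>R (U *v (abar' i + \<sigma> *\<^sub>R g i)))" for U :: "real^'d^'d" and g :: "nat \<Rightarrow> real^'d"
  define E where "E = {(U, b). (2 * M0) *\<^sub>R (U *v z0') \<in> nonneg_cone J b \<and>
      infdist 0 (affine hull (b ` J)) \<ge> M \<and> (\<forall>i\<in>J. b i \<in> H)}"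
  define E' where "E' = {x \<in> space (\<mu> \<Otimes>\<^sub>M PB). x \<in> E}"
  have [measurable]: "(\<lambda>b. b) \<in> PB \<rightarrow>\<^sub>M borel" unfolding PB_def by (rule PiM_to_borel_fun) simp
  have E': "E' \<in> sets (\<mu> \<Otimes>\<^sub>M PB)"
  proof -
    have "E \<in> sets borel" unfolding E_def by (rule borel_success_event[OF J(1,2) H])
    moreover have "(\<lambda>x. (fst x, snd x)) \<in> \<mu> \<Otimes>\<^sub>M PB \<rightarrow>\<^sub>M borel"
      by (intro borel_measurable_Pair measurable_compose[OF measurable_fst hs(5)] measurable_compose[OF measurable_snd]) measurable
    ultimately show ?thesis
      using measurable_sets[of "\<lambda>x. (fst x, snd x)" "\<mu> \<Otimes>\<^sub>M PB" borel E]
      by (simp add: E'_def vimage_def Int_def conj_commute)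
  qed
  have \<Phi>m: "(\<lambda>(U, g). (U, \<Phi> U g)) \<in> \<mu> \<Otimes>\<^sub>M gaussian_family J \<rightarrow>\<^sub>M \<mu> \<Otimes>\<^sub>M PB"
    unfolding \<Phi>_def PB_def by measurable
  have \<kappa>: "distr (added_law n abar' M0 U) (\<mu> \<Otimes>\<^sub>M PB) (\<lambda>b. (U, b)) = distr (gaussian_family J) (\<mu> \<Otimes>\<^sub>M PB) (\<lambda>g. (U, \<Phi> U g))"
    if U: "U \<in> space \<mu>" for U
  proof -
    have \<Phi>U: "\<Phi> U = (\<lambda>g. \<lambda>i\<in>J. (2 * M0) *\<^sub>R (U *v (abar' i + \<sigma> *\<^sub>R g i)))"
      by (rule ext) (simp only: \<Phi>_def)
    have UO: "orthogonal_matrix U" using U unfolding hs(3) by simp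
    have 1: "added_law n abar' M0 U = distr (gaussian_family J) PB (\<Phi> U)"
      unfolding \<Phi>U PB_def J_def \<sigma>_def by (rule added_law_eq_distr[OF UO \<sigma>[unfolded \<sigma>_def] M0(1)])
    have 2: "\<Phi> U \<in> gaussian_family J \<rightarrow>\<^sub>M PB"
      using measurable_compose[OF measurable_Pair1'[OF U] measurable_compose[OF \<Phi>m measurable_snd]]
      by (simp add: case_prod_beta)
    have 3: "(\<lambda>b. (U, b)) \<in> PB \<rightarrow>\<^sub>M \<mu> \<Otimes>\<^sub>M PB" using U by (rule measurable_Pair1')
    show ?thesis unfolding 1 distr_distr[OF 3 2] comp_def ..
  qed
  \<comment> \<open>Measurability in \<open>U\<close> is clear for the representation by the fixed
    law of \<open>g\<close> and the jointly measurable \<open>\<Phi>\<close>; it is needed to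
    evaluate the monadic bind.\<close>
  have kernel: "(\<lambda>U. distr (added_law n abar' M0 U) (\<mu> \<Otimes>\<^sub>M PB) (\<lambda>b. (U, b))) \<in> \<mu> \<rightarrow>\<^sub>M subprob_algebra (\<mu> \<Otimes>\<^sub>M PB)"
  proof -
    have "(\<lambda>U. distr (gaussian_family J) (\<mu> \<Otimes>\<^sub>M PB) (\<lambda>g. (U, \<Phi> U g))) \<in> \<mu> \<rightarrow>\<^sub>M subprob_algebra (\<mu> \<Otimes>\<^sub>M PB)"
      by (rule measurable_distr2[OF \<Phi>m])
         (simp add: space_subprob_algebra G.subprob_space_axioms)
    then show ?thesis by (subst measurable_cong[OF \<kappa>])
  qed
  define R where "R = rotation_added_law n abar' M0 \<mu>"
  have R: "R = \<mu> \<bind> (\<lambda>U. distr (added_law n abar' M0 U) (\<mu> \<Otimes>\<^sub>M PB) (\<lambda>b. (U, b)))"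
    by (simp add: R_def rotation_added_law_def PB_def J_def)
  have setsR: "sets R = sets (\<mu> \<Otimes>\<^sub>M PB)"
    unfolding R by (rule sets_bind) (auto simp: M.not_empty)
  have spaceR: "space R = space (\<mu> \<Otimes>\<^sub>M PB)" by (rule sets_eq_imp_space_eq[OF setsR])
  obtain A where A: "A \<in> sets (gaussian_family J)" "measure (gaussian_family J) A \<ge> 55/100"
    "\<And>g. g \<in> A \<Longrightarrow> good_sample J (\<lambda>i. abar' i + \<sigma> *\<^sub>R g i) z0' (4 * simplex_radius CARD('d))"
    by (rule good_sample_probability[OF d n J_def gp z rs[folded J_def], folded \<sigma>_def]) (rule that)
  define F where "F = {x \<in> space (\<mu> \<Otimes>\<^sub>M gaussian_family J). (fst x, \<Phi> (fst x) (snd x)) \<in> E'}"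
  have F: "F \<in> sets (\<mu> \<Otimes>\<^sub>M gaussian_family J)"
    using measurable_sets[OF \<Phi>m E'] by (simp add: F_def vimage_def Int_def conj_commute case_prod_beta)
  \<comment> \<open>The product is 0.25575. The chain first integrates over \<open>U\<close> for
    each good \<open>g\<close>, then exchanges the order so that \<open>U\<close> is outermost, as
    in the joint law.\<close>
  have "ennreal (1/4) \<le> ennreal (465/1000 * (55/100))" by (rule ennreal_leI) simp
  also have "\<dots> \<le> ennreal (465/1000 * measure (gaussian_family J) A)"
    using A(2) by (intro ennreal_leI mult_left_mono) auto
  also have "\<dots> = (\<integral>\<^sup>+g. ennreal (465/1000) * indicator A g \<partial>gaussian_family J)"
    using A(1) by (simp add: nn_integral_cmult G.emeasure_eq_measure flip: ennreal_mult)
  also have "\<dots> \<le> (\<integral>\<^sup>+g. emeasure \<mu> ((\<lambda>U. (U, g)) -` F) \<partial>gaussian_family J)"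
  proof (rule nn_integral_mono)
    \<comment> \<open>For a good \<open>g\<close> the cone and distance tests succeed for every
      rotation; only membership in \<open>H\<close> depends on \<open>U\<close>.\<close>
    fix g assume g: "g \<in> space (gaussian_family J :: (nat \<Rightarrow> real^'d) measure)"
    show "ennreal (465/1000) * indicator A g \<le> emeasure \<mu> ((\<lambda>U. (U, g)) -` F)"
    proof (cases "g \<in> A")
      case True
      define v where "v i = abar' i + \<sigma> *\<^sub>R g i" for i
      have good: "good_sample J v z0' (4 * simplex_radius CARD('d))" using A(3)[OF True] by (simp add: v_def[abs_def])
      let ?S = "{U \<in> space \<mu>. \<forall>i\<in>J. h \<bullet> (U *v v i) < 0}"
      have "measure \<mu> ?S \<ge> 465/1000"
        using good by (intro haar_halfspace_simplex_probability[OF \<mu> d J(1,3) h(1) z]) (auto simp: good_sample_def)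
      then have "ennreal (465/1000) \<le> emeasure \<mu> ?S" by (simp add: M.emeasure_eq_measure ennreal_leI)
      also have "\<dots> \<le> emeasure \<mu> ((\<lambda>U. (U, g)) -` F)"
      proof (rule emeasure_mono)
        show "?S \<subseteq> (\<lambda>U. (U, g)) -` F"
        proof
          fix U assume U: "U \<in> ?S"
          then have UO: "orthogonal_matrix U" by (simp add: hs(3))
          have b: "\<Phi> U g i = (2 * M0) *\<^sub>R (U *v v i)" if "i \<in> J" for i using that by (simp add: \<Phi>_def v_def)
          have "\<Phi> U g i \<in> H" if "i \<in> J" for i
          proof -
            have "h \<bullet> \<Phi> U g i < 0" using U that M0 by (simp add: b mult_pos_neg)
            then show ?thesis using h(2) by blast
          qed
          then have "(U, \<Phi> U g) \<in> E"
            using good_sample_success[OF J(1,2) good UO M0(1) M0(2)[folded M_def] b] by (simp add: E_def)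
          moreover have "(U, \<Phi> U g) \<in> space (\<mu> \<Otimes>\<^sub>M PB)"
            using U by (auto simp: space_pair_measure PB_def space_PiM \<Phi>_def)
          ultimately show "U \<in> (\<lambda>U. (U, g)) -` F"
            using U g by (simp add: F_def E'_def space_pair_measure)
        qed
        show "(\<lambda>U. (U, g)) -` F \<in> sets \<mu>" by (rule sets_Pair2[OF F])
      qed
      finally show ?thesis using True by simp
    qed simp
  qed
  also have "\<dots> = emeasure (\<mu> \<Otimes>\<^sub>M gaussian_family J) F"
    by (rule P.emeasure_pair_measure_alt2[OF F, symmetric])
  also have "\<dots> = (\<integral>\<^sup>+U. emeasure (gaussian_family J) (Pair U -` F) \<partial>\<mu>)"
    by (rule G.emeasure_pair_measure_alt[OF F])
  also have "\<dots> = (\<integral>\<^sup>+U. emeasure (distr (added_law n abar' M0 U) (\<mu> \<Otimes>\<^sub>M PB) (\<lambda>b. (U, b))) E' \<partial>\<mu>)"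
  proof (rule nn_integral_cong)
    fix U assume U: "U \<in> space \<mu>"
    have "(\<lambda>g. (U, \<Phi> U g)) \<in> gaussian_family J \<rightarrow>\<^sub>M \<mu> \<Otimes>\<^sub>M PB"
      using measurable_compose[OF measurable_Pair1'[OF U] \<Phi>m] by simp
    then have "emeasure (distr (gaussian_family J) (\<mu> \<Otimes>\<^sub>M PB) (\<lambda>g. (U, \<Phi> U g))) E'
        = emeasure (gaussian_family J) ((\<lambda>g. (U, \<Phi> U g)) -` E' \<inter> space (gaussian_family J))"
      using E' by (rule emeasure_distr)
    also have "(\<lambda>g. (U, \<Phi> U g)) -` E' \<inter> space (gaussian_family J) = Pair U -` F"
      using U by (auto simp: F_def space_pair_measure simp del: gaussian_family_space)
    finally show "emeasure (gaussian_family J) (Pair U -` F)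
        = emeasure (distr (added_law n abar' M0 U) (\<mu> \<Otimes>\<^sub>M PB) (\<lambda>b. (U, b))) E'"
      unfolding \<kappa>[OF U] by simp
  qed
  also have "\<dots> = emeasure R E'"
    unfolding R by (rule emeasure_bind[OF M.not_empty kernel E', symmetric])
  finally have lower: "ennreal (1/4) \<le> emeasure R E'" .
  have "prob_space R"
    unfolding R
  proof (rule M.prob_space_bind)
    show "AE U in \<mu>. prob_space (distr (added_law n abar' M0 U) (\<mu> \<Otimes>\<^sub>M PB) (\<lambda>b. (U, b)))"
    proof (rule AE_I2)
      fix U assume U: "U \<in> space \<mu>"
      show "prob_space (distr (added_law n abar' M0 U) (\<mu> \<Otimes>\<^sub>M PB) (\<lambda>b. (U, b)))"
        unfolding \<kappa>[OF U]
        using measurable_compose[OF measurable_Pair1'[OF U] \<Phi>m] by (intro G.prob_space_distr) simp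
    qed
  qed (rule kernel)
  then interpret R: prob_space R .
  have "1/4 \<le> measure R E'" using lower by (simp add: R.emeasure_eq_measure)
  also have "E' = {x \<in> space R. case x of (U, b) \<Rightarrow> \<exists>b' z0. adding_constraints n a z0' M0 U b = Some (b', z0) \<and>
              (\<forall>i\<in>{n+1..n+CARD('d)}. b' i \<in> H)}"
    unfolding E'_def E_def spaceR adding_constraints_def Let_def J_def[symmetric] M_def[symmetric]
    by (auto split: if_splits)
  finally show ?thesis unfolding R_def by (simp add: case_prod_unfold)
qed

theorem theorem5p5:
  fixes a :: "nat \<Rightarrow> real ^ 'd" and z z0' :: "real ^ 'd" and abar' :: "nat \<Rightarrow> real ^ 'd"
    and n :: nat and M0 :: real and H :: "(real ^ 'd) set" and \<mu> :: "(real ^ 'd ^ 'd) measure"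
  assumes "CARD('d) \<ge> 2" and "n \<ge> 2"
    and "general_position n a"
    and "numb_halfspace n a z H"
    and "M0 > 0" and "M0 \<ge> Max ((\<lambda>i. norm (a i)) ` {1..n})"
    and "norm z0' = 1"
    and "regular_simplex {n+1..n+CARD('d)} abar' z0' z0' (simplex_radius CARD('d))"
    and "haar_orthogonal \<mu>"
  shows "(\<forall>U. orthogonal_matrix U \<longrightarrow>
            (AE b in added_law n abar' M0 U.
               general_position (n + CARD('d)) (add_constraints n a b)) \<and>
            (\<forall>b b' z0. general_position (n + CARD('d)) (add_constraints n a b) \<longrightarrow>
               adding_constraints n a z0' M0 U b = Some (b', z0) \<longrightarrow>
               lp_solution (n + CARD('d)) (add_constraints n a b') z0 {n+1..n+CARD('d)})) \<and>
         \<P>((U, b) in rotation_added_law n abar' M0 \<mu>.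
            \<exists>b' z0. adding_constraints n a z0' M0 U b = Some (b', z0) \<and>
              (\<forall>i\<in>{n+1..n+CARD('d)}. b' i \<in> H)) \<ge> 1 / 4"
proof (intro conjI allI impI)
  fix U :: "real ^ 'd ^ 'd"
  assume U: "orthogonal_matrix U"
  have "2 * M0 * sigma1 CARD('d) n > 0"
    using sigma1_pos[OF assms(1,2)] assms(5) by simp
  then show "AE b in added_law n abar' M0 U. general_position (n + CARD('d)) (add_constraints n a b)"
    unfolding added_law_def by (rule AE_general_position_added[OF assms(3)])
  fix b b' z0
  assume gp: "general_position (n + CARD('d)) (add_constraints n a b)"
    and run: "adding_constraints n a z0' M0 U b = Some (b', z0)"
  have "b' = b" "z0 \<in> nonneg_cone {n+1..n+CARD('d)} b"
    "infdist 0 (affine hull (b ` {n+1..n+CARD('d)})) \<ge> Max ((\<lambda>i. norm (a i)) ` {1..n})"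
    using run unfolding adding_constraints_def Let_def by (auto split: if_splits)
  then show "lp_solution (n + CARD('d)) (add_constraints n a b') z0 {n+1..n+CARD('d)}"
    using added_constraints_solution[OF assms(2) gp] by simp
next
  show "\<P>((U, b) in rotation_added_law n abar' M0 \<mu>.
            \<exists>b' z0. adding_constraints n a z0' M0 U b = Some (b', z0) \<and>
              (\<forall>i\<in>{n+1..n+CARD('d)}. b' i \<in> H)) \<ge> 1 / 4"
    by (rule rotation_added_law_success_ge[OF assms(1-9)])
qed

end
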